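(* Let $J_1$ be the jump kernel on $\mathbb R^2\times\mathbb R^2$ defined in the context. The martingale problem for the operator $$\mathcal Lf(x)=\int_{\mathbb R^2}(f(x+h)-f(x))\,J_1(x,x+h)\,dh$$ acting on $C^2_c(\mathbb R^2)$ functions is not well-posed.
   Context: Fix $a,b$ with $0<a<b<2$ and $a<(2-b)/b$. For $(z_1,z_2)\in\mathbb R^2\setminus\{0\}$ set $m(z_1,z_2)=\min(|z_1|^{-a-2},|z_2|^{-b-2})$ if $|z_1|\vee|z_2|\le1$ and $m(z_1,z_2)=0$ if $|z_1|\vee|z_2|>1$ (with $0^{-s}=+\infty$ for $s>0$). Let $V=\{(x_1,x_2)\in\mathbb R^2:|x_1|<|x_2|\}$ and let $B=B(0,1)$ be the open unit ball. For $x\neq y$ in $\mathbb R^2$ define - $J_1(x,y)=m(|x_1-y_1|,|x_2-y_2|)\mathbf 1_{(x-y\in B)}$ if $x,y\in V$; - $J_1(x,y)=m(|x_2-y_2|,|x_1-y_1|)\mathbf 1_{(x-y\in B)}$ if $x,y\in V^c$; - $J_1(x,y)=\big(|x_1-y_1|^{-2-a}\wedge|x_2-y_2|^{-2-a}\big)\mathbf 1_{(x-y\in B)}$ if $x\in V,\ y\in V^c$ or vice versa. A solution to the martingale problem for $\mathcal L$ started at $x$ is a probability measure $\mathbb P$ on the space of right continuous paths with left limits $[0,\infty)\to\mathbb R^2$ (with coordinate process $X_t$) such that $\mathbb P(X_0=x)=1$ and $f(X_t)-f(X_0)-\int_0^t\mathcal Lf(X_u)\,du$ is a $\mathbb P$-martingale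 for every $f\in C^2_c(\mathbb R^2)$. The martingale problem is well-posed if for every $x\in\mathbb R^2$ there is exactly one solution started at $x$. *)

theory Defs
  imports "HOL-Probability.Probability"
begin

section \<open>The jump kernel\<close>

text \<open>The value \<open>r\<^sup>-\<^sup>s\<close> for \<open>r \<ge> 0\<close>, \<open>s > 0\<close>, with \<open>0\<^sup>-\<^sup>s = +\<infinity>\<close>; note that \<open>0 powr (- s)\<close> would be \<open>0\<close>.\<close>

definition neg_power :: "real \<Rightarrow> real \<Rightarrow> ennreal" where
  "neg_power r s = (if r = 0 then \<infinity> else ennreal (r powr (- s)))"

definition m_kernel :: "real \<Rightarrow> real \<Rightarrow> real \<Rightarrow> real \<Rightarrow> ennreal" where
  "m_kernel a b z1 z2 =
     (if max \<bar>z1\<bar> \<bar>z2\<bar> \<le> 1 then min (neg_power \<bar>z1\<bar> (a + 2)) (neg_power \<bar>z2\<bar> (b + 2)) else 0)"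

definition V :: "(real \<times> real) set" where
  "V = {(x1, x2). \<bar>x1\<bar> < \<bar>x2\<bar>}"

text \<open>
  The kernel is only meaningful off the diagonal, where the extended values below are finite
  (\<open>J1_ext_finite\<close>), so that \<^const>\<open>enn2real\<close> loses nothing. On the diagonal \<open>J1\<close> is \<open>0\<close>.
\<close>

definition J1_ext :: "real \<Rightarrow> real \<Rightarrow> real \<times> real \<Rightarrow> real \<times> real \<Rightarrow> ennreal" where
  "J1_ext a b x y =
     (if x \<in> V \<and> y \<in> V then m_kernel a b \<bar>fst x - fst y\<bar> \<bar>snd x - snd y\<bar>
      else if x \<notin> V \<and> y \<notin> V then m_kernel a b \<bar>snd x - snd y\<bar> \<bar>fst x - fst y\<bar>
      else min (neg_power \<bar>fst x - fst y\<bar> (2 + a)) (neg_power \<bar>snd x - snd y\<bar> (2 + a)))"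

definition J1 :: "real \<Rightarrow> real \<Rightarrow> real \<times> real \<Rightarrow> real \<times> real \<Rightarrow> real" where
  "J1 a b x y = enn2real (J1_ext a b x y) * indicator (ball 0 1) (x - y)"

lemma J1_ext_finite: "x \<noteq> y \<Longrightarrow> J1_ext a b x y < \<infinity>"
  by (auto simp: J1_ext_def m_kernel_def neg_power_def min_def prod_eq_iff less_top[symmetric] top_unique)

definition jump_operator ::
  "(real \<times> real \<Rightarrow> real \<times> real \<Rightarrow> real) \<Rightarrow> (real \<times> real \<Rightarrow> real) \<Rightarrow> real \<times> real \<Rightarrow> real" where
  "jump_operator J f x = (\<integral>h. (f (x + h) - f x) * J x (x + h) \<partial>lborel)"

definition C2c :: "('a::euclidean_space \<Rightarrow> real) set" where
  "C2c = {f. compact (closure {x. f x \<noteq> 0}) \<and>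
     (\<exists>(D :: 'a \<Rightarrow> 'a \<Rightarrow>\<^sub>L real) (D2 :: 'a \<Rightarrow> 'a \<Rightarrow>\<^sub>L ('a \<Rightarrow>\<^sub>L real)).
        (\<forall>x. (f has_derivative blinfun_apply (D x)) (at x)) \<and>
        (\<forall>x. (D has_derivative blinfun_apply (D2 x)) (at x)) \<and>
        continuous_on UNIV D2)}"

section \<open>Path space\<close>

text \<open>
  A path \<open>[0,\<infinity>) \<rightarrow> E\<close> is a function on the reals that is extensional on \<open>{0..}\<close>.
\<close>

definition cadlag_paths :: "(real \<Rightarrow> 'a::euclidean_space) set" where
  "cadlag_paths = {\<omega> \<in> extensional {0..}.
     (\<forall>t\<ge>0. continuous (at_right t) \<omega>) \<and> (\<forall>t>0. \<exists>l. (\<omega> \<longlongrightarrow> l) (at_left t))}"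

text \<open>The \<open>\<sigma>\<close>-algebra generated by the coordinates \<open>X\<^sub>s\<close>, \<open>s \<in> T\<close>.\<close>

definition coord_sigma :: "real set \<Rightarrow> (real \<Rightarrow> 'a::euclidean_space) measure" where
  "coord_sigma T = sigma cadlag_paths
     {(\<lambda>\<omega>. \<omega> s) -` A \<inter> cadlag_paths | s A. s \<in> T \<and> A \<in> sets borel}"

definition path_space :: "(real \<Rightarrow> 'a::euclidean_space) measure" where
  "path_space = coord_sigma {0..}"

definition path_filtration :: "real \<Rightarrow> (real \<Rightarrow> 'a::euclidean_space) measure" where
  "path_filtration t = coord_sigma {0..t}"

lemma space_coord_sigma: "space (coord_sigma T) = cadlag_paths"
  unfolding coord_sigma_def by (intro space_measure_of) auto

lemma sets_coord_sigma_mono: "S \<subseteq> T \<Longrightarrow> sets (coord_sigma S) \<subseteq> sets (coord_sigma T)"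
  unfolding coord_sigma_def by (subst (1 2) sets_measure_of) (auto intro!: sigma_sets_mono')

lemma filtration_path_filtration: "filtration cadlag_paths path_filtration"
  by (standard; unfold path_filtration_def)
    (auto simp: space_coord_sigma intro!: sets_coord_sigma_mono)

lemma subalgebra_path_filtration:
  "sets M = sets path_space \<Longrightarrow> subalgebra M (path_filtration t)"
  using sets_coord_sigma_mono[of "{0..t}" "{0..}"]
  by (auto simp: subalgebra_def path_space_def path_filtration_def space_coord_sigma
      dest!: sets_eq_imp_space_eq)

section \<open>The martingale problem\<close>

definition martingale :: "'w measure \<Rightarrow> (real \<Rightarrow> 'w measure) \<Rightarrow> (real \<Rightarrow> 'w \<Rightarrow> real) \<Rightarrow> bool" where
  "martingale M F Y \<longleftrightarrow>
     filtration (space M) F \<and> (\<forall>t\<ge>0. subalgebra M (F t)) \<and>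
     (\<forall>t\<ge>0. Y t \<in> borel_measurable (F t) \<and> integrable M (Y t)) \<and>
     (\<forall>s t. 0 \<le> s \<and> s \<le> t \<longrightarrow> (AE \<omega> in M. real_cond_exp M (F s) (Y t) \<omega> = Y s \<omega>))"

definition martingale_problem_solution ::
  "(('a::euclidean_space \<Rightarrow> real) \<Rightarrow> 'a \<Rightarrow> real) \<Rightarrow> 'a \<Rightarrow> (real \<Rightarrow> 'a) measure \<Rightarrow> bool" where
  "martingale_problem_solution L x P \<longleftrightarrow>
     prob_space P \<and> sets P = sets path_space \<and>
     measure P {\<omega> \<in> space P. \<omega> 0 = x} = 1 \<and>
     (\<forall>f\<in>C2c. martingale P path_filtration
        (\<lambda>t \<omega>. f (\<omega> t) - f (\<omega> 0) - (LINT u:{0..t}|lborel. L f (\<omega> u))))"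

definition martingale_problem_well_posed ::
  "(('a::euclidean_space \<Rightarrow> real) \<Rightarrow> 'a \<Rightarrow> real) \<Rightarrow> bool" where
  "martingale_problem_well_posed L \<longleftrightarrow> (\<forall>x. \<exists>!P. martingale_problem_solution L x P)"

end

theory Submission
  imports Defs
begin

text \<open>
  Write \<open>w x = \<bar>x\<^sub>2\<bar> - \<bar>x\<^sub>1\<bar>\<close>, so that \<open>V = {w > 0}\<close>, and \<open>\<kappa> = (b + 2) / (a + 2) > 1\<close>.
  Integrating \<open>m\<close> over its first argument shows that vertical jumps inside \<open>V\<close> have index
  \<open>\<beta> = b + 1 - \<kappa>\<close>; the hypothesis \<open>a < (2 - b) / b\<close> says exactly that \<open>\<beta> < 1\<close>. Horizontal jumps
  inside \<open>V\<close> and jumps between \<open>V\<close> and its complement have indices smaller than \<open>\<beta>\<close>. Close to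
  the origin the process in \<open>V\<close> is therefore a vertical pure jump process of index below one
  that is reflected, not killed, at the edge of \<open>V\<close>: it leaves the origin without
  touching the diagonals. The coordinate swap exchanges \<open>V\<close> with its complement up to
  the diagonals, so the process has two ways to leave the origin, and a single law cannot
  solve the problem: the choice between the two ways is visible immediately after time \<open>0\<close>, and a
  solution conditioned on such an event is another solution.

  The quantitative tool is the function \<open>G\<^sub>\<delta> = max 0 (1 - (\<delta> / w)\<^sup>1\<^sup>-\<^sup>\<beta>)\<close> on \<open>V\<close>, extended by \<open>0\<close>
  (\<open>strip_barrier\<close>). The power \<open>w\<^sup>\<beta>\<^sup>-\<^sup>1\<close> is harmonic for the censored \<open>\<beta>\<close>-stable process on the
  half-line, which follows from explicit primitives. Hence \<open>L G\<^sub>\<delta>\<close> is bounded below by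
  \<open>- C \<delta>\<^sup>-\<^sup>\<theta>\<close> for some \<open>\<theta> < \<beta>\<close>: only the jumps of smaller index contribute
  (\<open>drift_lower_bound\<close>). On \<open>V \<inter> {w \<le> \<delta>}\<close> one even has \<open>L G\<^sub>\<delta> \<ge> c \<delta>\<^sup>-\<^sup>\<beta>\<close>
  (\<open>strip_lower_bound\<close>), and both estimates hold for the mirror image of \<open>G\<^sub>\<delta>\<close>.

  The second estimate bounds the time spent in the strip \<open>\<bar>w\<bar> \<le> \<delta>\<close> (\<open>strip_occupation\<close>). In particular no
  time is spent on the diagonals, so that the mirror image of a solution started at \<open>0\<close> is again
  a solution (\<open>swap_solution\<close>). The first estimate makes \<open>G\<^sub>\<delta>\<close> almost a submartingale. Along times
  \<open>t\<^sub>n\<close> of order \<open>2\<^sup>-\<^sup>n\<close>, with \<open>\<delta>\<close> a suitable power of \<open>t\<^sub>n\<close>, the probability to be in \<open>V\<close> at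
  time \<open>t\<^sub>n\<^sub>+\<^sub>1\<close> and outside \<open>V\<close> at the later time \<open>t\<^sub>n\<close> decays geometrically (\<open>escape_times\<close>).

  If \<open>P\<close> were the only solution started at \<open>0\<close>, it would be mirror symmetric, so each event
  \<open>X\<^bsub>t\<^sub>n\<^esub> \<in> V\<close> would have probability \<open>1/2\<close>. By the Borel-Cantelli lemma these events converge to an
  event of probability \<open>1/2\<close>. Conditioning \<open>P\<close> on it gives a solution
  (\<open>conditioned_solution\<close>) that differs from \<open>P\<close>.
\<close>

section \<open>The censored stable process on the half-line\<close>

lemma powr_sub_le_linear:
  fixes s d \<beta> :: real
  assumes "0 < s" "0 < d" "0 < \<beta>" "\<beta> < 1"
  shows "\<bar>s powr \<beta> - d powr \<beta>\<bar> \<le> d powr (\<beta> - 1) * \<bar>s - d\<bar>"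
proof -
  have e: "s powr \<beta> = d powr \<beta> * (s / d) powr \<beta>"
    using assms by (simp add: powr_divide)
  have "\<bar>(s / d) powr \<beta> - 1\<bar> \<le> \<bar>s / d - 1\<bar>"
  proof (cases "s \<le> d")
    case True
    then have "(s / d) powr 1 \<le> (s / d) powr \<beta>" "(s / d) powr \<beta> \<le> 1"
      using assms powr_mono'[of \<beta> 1 "s / d"] by (auto intro!: powr_le1 simp del: powr_one)
    then show ?thesis using assms True by (simp add: powr_one)
  next
    case False
    then have "(s / d) powr \<beta> \<le> (s / d) powr 1" "1 \<le> (s / d) powr \<beta>"
      using assms powr_mono[of \<beta> 1 "s / d"] by (auto intro!: ge_one_powr_ge_zero simp del: powr_one)
    then show ?thesis using assms False by (simp add: powr_one)
  qed
  then have "d powr \<beta> * \<bar>(s / d) powr \<beta> - 1\<bar> \<le> d powr \<beta> * \<bar>s / d - 1\<bar>"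
    by (intro mult_left_mono) auto
  moreover have "d powr \<beta> * \<bar>(s / d) powr \<beta> - 1\<bar> = \<bar>s powr \<beta> - d powr \<beta>\<bar>"
    unfolding e by (metis abs_mult abs_of_nonneg mult.right_neutral powr_ge_zero right_diff_distrib)
  moreover have "d powr \<beta> * \<bar>s / d - 1\<bar> = d powr (\<beta> - 1) * \<bar>s - d\<bar>"
  proof -
    have "s / d - 1 = (s - d) / d" using assms by (simp add: diff_divide_distrib)
    then have "\<bar>s / d - 1\<bar> = \<bar>s - d\<bar> / d" using assms by (simp only: abs_div_pos)
    then show ?thesis using assms by (simp add: powr_diff)
  qed
  ultimately show ?thesis by simp
qed

text \<open>
  The primitives below, found by differentiating \<open>(s / \<bar>s - d\<bar>)\<^sup>\<beta>\<close>, evaluate the generator of the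
  censored \<open>\<beta>\<close>-stable process at the function \<open>s\<^sup>\<beta>\<^sup>-\<^sup>1\<close> in closed form, separately over
  jumps to the left and to the right of \<open>d\<close>. Both parts are absolutely convergent because \<open>\<beta> < 1\<close>,
  so no principal value is needed.
\<close>

lemma primitive_left:
  fixes s d \<beta> :: real
  assumes "0 < s" "s < d" "0 < \<beta>"
  shows "((\<lambda>s. (s powr \<beta> - d powr \<beta>) * (d - s) powr (- \<beta>) / (\<beta> * d)) has_real_derivative
     (s powr (\<beta> - 1) - d powr (\<beta> - 1)) * (d - s) powr (- 1 - \<beta>)) (at s)"
proof -
  have a: "s powr \<beta> = s * s powr (\<beta> - 1)" "d powr \<beta> = d * d powr (\<beta> - 1)"
    "(d - s) powr (- \<beta>) = (d - s) * (d - s) powr (- 1 - \<beta>)"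
    using assms by (simp_all add: powr_diff powr_minus field_simps)
  have b: "- \<beta> - 1 = - 1 - \<beta>" by simp
  show ?thesis
    apply (rule derivative_eq_intros refl | use assms in force)+
    unfolding b a using assms
    apply (simp add: field_simps)
    done
qed

lemma primitive_right:
  fixes s d \<beta> :: real
  assumes "d < s" "0 < d" "0 < \<beta>"
  shows "((\<lambda>s. (s powr \<beta> - d powr \<beta>) * (s - d) powr (- \<beta>) / (\<beta> * d)) has_real_derivative
     (d powr (\<beta> - 1) - s powr (\<beta> - 1)) * (s - d) powr (- 1 - \<beta>)) (at s)"
proof -
  have a: "s powr \<beta> = s * s powr (\<beta> - 1)" "d powr \<beta> = d * d powr (\<beta> - 1)"
    "(s - d) powr (- \<beta>) = (s - d) * (s - d) powr (- 1 - \<beta>)"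
    using assms by (simp_all add: powr_diff powr_minus field_simps)
  have b: "- \<beta> - 1 = - 1 - \<beta>" by simp
  show ?thesis
    apply (rule derivative_eq_intros refl | use assms in force)+
    unfolding b a using assms
    apply (simp add: field_simps)
    done
qed

lemma primitive_other:
  fixes s e \<beta> :: real
  assumes "0 < s" "0 < e" "0 < \<beta>"
  shows "((\<lambda>s. s powr \<beta> * (s + e) powr (- \<beta>) / (\<beta> * e)) has_real_derivative
     s powr (\<beta> - 1) * (s + e) powr (- 1 - \<beta>)) (at s)"
    "((\<lambda>s. - ((s + e) powr (- \<beta>)) / \<beta>) has_real_derivative (s + e) powr (- 1 - \<beta>)) (at s)"
proof -
  have a: "s powr \<beta> = s * s powr (\<beta> - 1)" 
    "(s + e) powr (- \<beta>) = (s + e) * (s + e) powr (- 1 - \<beta>)"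
    using assms powr_mult_base[of "s + e" "- 1 - \<beta>"] by (simp_all add: powr_diff powr_minus field_simps)
  have b: "- \<beta> - 1 = - 1 - \<beta>" by simp
  show "((\<lambda>s. s powr \<beta> * (s + e) powr (- \<beta>) / (\<beta> * e)) has_real_derivative
     s powr (\<beta> - 1) * (s + e) powr (- 1 - \<beta>)) (at s)"
    apply (rule derivative_eq_intros refl | use assms in force)+
    unfolding b a using assms
    apply (simp add: field_simps)
    done
  show "((\<lambda>s. - ((s + e) powr (- \<beta>)) / \<beta>) has_real_derivative (s + e) powr (- 1 - \<beta>)) (at s)"
    apply (rule derivative_eq_intros refl | use assms in force)+
    unfolding b using assms
    apply (simp add: field_simps)
    done
qed

text \<open>
  This value and the one in \<open>integral_right\<close> agree: gains and losses of \<open>s\<^sup>\<beta>\<^sup>-\<^sup>1\<close> cancel, so the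
  function is harmonic.
\<close>

lemma integral_left:
  fixes d \<beta> :: real
  assumes "0 < d" "0 < \<beta>" "\<beta> < 1"
  shows "set_integrable lborel {0<..<d} (\<lambda>s. (s powr (\<beta> - 1) - d powr (\<beta> - 1)) * (d - s) powr (- 1 - \<beta>))"
    "(LINT s:{0<..<d}|lborel. (s powr (\<beta> - 1) - d powr (\<beta> - 1)) * (d - s) powr (- 1 - \<beta>)) = 1 / (\<beta> * d)"
proof -
  let ?F = "\<lambda>s. (s powr \<beta> - d powr \<beta>) * (d - s) powr (- \<beta>) / (\<beta> * d)"
  let ?f = "\<lambda>s. (s powr (\<beta> - 1) - d powr (\<beta> - 1)) * (d - s) powr (- 1 - \<beta>)"
  have A: "(?F \<longlongrightarrow> - 1 / (\<beta> * d)) (at_right 0)"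
  proof -
    have "(?F \<longlongrightarrow> (0 powr \<beta> - d powr \<beta>) * (d - 0) powr (- \<beta>) / (\<beta> * d)) (at_right 0)"
      using assms by (intro tendsto_intros tendsto_powr') (auto simp: eventually_at_right_field intro!: exI[of _ 1])
    moreover have "(0 powr \<beta> - d powr \<beta>) * (d - 0) powr (- \<beta>) / (\<beta> * d) = - 1 / (\<beta> * d)"
      using assms by (simp add: powr_minus)
    ultimately show ?thesis by (simp only:)
  qed
  have B: "(?F \<longlongrightarrow> 0) (at_left d)"
  proof (rule Lim_null_comparison)
    show "\<forall>\<^sub>F s in at_left d. norm (?F s) \<le> d powr (\<beta> - 1) * (d - s) powr (1 - \<beta>) / (\<beta> * d)"
      unfolding eventually_at_left_field
    proof (intro exI[of _ 0] conjI allI impI)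
      fix s assume s: "0 < s" "s < d"
      have "\<bar>s powr \<beta> - d powr \<beta>\<bar> * (d - s) powr (- \<beta>) \<le> d powr (\<beta> - 1) * (d - s) * (d - s) powr (- \<beta>)"
        using powr_sub_le_linear[of s d \<beta>] s assms by (intro mult_right_mono) auto
      also have "\<dots> = d powr (\<beta> - 1) * (d - s) powr (1 - \<beta>)"
        using s by (simp add: powr_diff powr_minus field_simps)
      finally show "norm (?F s) \<le> d powr (\<beta> - 1) * (d - s) powr (1 - \<beta>) / (\<beta> * d)"
        using assms by (simp add: abs_mult divide_right_mono)
    qed (use assms in auto)
    have "((\<lambda>s. d powr (\<beta> - 1) * (d - s) powr (1 - \<beta>) / (\<beta> * d)) \<longlongrightarrow> d powr (\<beta> - 1) * (d - d) powr (1 - \<beta>) / (\<beta> * d)) (at_left d)"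
      using assms by (intro tendsto_intros tendsto_powr') (auto simp: eventually_at_left_field intro!: exI[of _ 0])
    then show "((\<lambda>s. d powr (\<beta> - 1) * (d - s) powr (1 - \<beta>) / (\<beta> * d)) \<longlongrightarrow> 0) (at_left d)"
      using assms by simp
  qed
  have nn: "AE s in lborel. ereal 0 < ereal s \<longrightarrow> ereal s < ereal d \<longrightarrow> 0 \<le> ?f s"
    using assms by (intro always_eventually) (auto intro!: mult_nonneg_nonneg powr_mono2')
  have prem1: "\<And>x. ereal 0 < ereal x \<Longrightarrow> ereal x < ereal d \<Longrightarrow> (?F has_real_derivative ?f x) (at x)"
    "\<And>x. ereal 0 < ereal x \<Longrightarrow> ereal x < ereal d \<Longrightarrow> isCont ?f x"
    "((?F \<circ> real_of_ereal) \<longlongrightarrow> - 1 / (\<beta> * d)) (at_right (ereal 0))"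
    "((?F \<circ> real_of_ereal) \<longlongrightarrow> 0) (at_left (ereal d))"
  proof -
    fix x assume x: "ereal 0 < ereal x" "ereal x < ereal d"
    show "(?F has_real_derivative ?f x) (at x)"
      using primitive_left[of x d \<beta>] assms x by simp
    show "isCont ?f x"
      using x assms by (intro continuous_intros) auto
  next
    show "((?F \<circ> real_of_ereal) \<longlongrightarrow> - 1 / (\<beta> * d)) (at_right (ereal 0))"
      using A by (simp only: ereal_tendsto_simps)
    show "((?F \<circ> real_of_ereal) \<longlongrightarrow> 0) (at_left (ereal d))"
      using B by (simp only: ereal_tendsto_simps)
  qed
  have *: "set_integrable lborel (einterval (ereal 0) (ereal d)) ?f"
    "(LBINT x=ereal 0..ereal d. ?f x) = 0 - (- 1 / (\<beta> * d))"
    by (rule interval_integral_FTC_nonneg[where F = ?F, OF _ prem1(1,2) nn prem1(3,4)]; use assms in simp)+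
  show "set_integrable lborel {0<..<d} ?f" using *(1) by simp
  show "(LINT s:{0<..<d}|lborel. ?f s) = 1 / (\<beta> * d)"
    using *(2) assms by (simp add: interval_lebesgue_integral_def)
qed

lemma integral_right:
  fixes d \<beta> :: real
  assumes "0 < d" "0 < \<beta>" "\<beta> < 1"
  shows "set_integrable lborel {d<..} (\<lambda>s. (d powr (\<beta> - 1) - s powr (\<beta> - 1)) * (s - d) powr (- 1 - \<beta>))"
    "(LINT s:{d<..}|lborel. (d powr (\<beta> - 1) - s powr (\<beta> - 1)) * (s - d) powr (- 1 - \<beta>)) = 1 / (\<beta> * d)"
proof -
  let ?F = "\<lambda>s. (s powr \<beta> - d powr \<beta>) * (s - d) powr (- \<beta>) / (\<beta> * d)"
  let ?f = "\<lambda>s. (d powr (\<beta> - 1) - s powr (\<beta> - 1)) * (s - d) powr (- 1 - \<beta>)"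
  have B: "(?F \<longlongrightarrow> 1 / (\<beta> * d)) at_top"
  proof -
    have 1: "((\<lambda>s. (1 / (1 - d / s)) powr \<beta>) \<longlongrightarrow> (1 / (1 - 0)) powr \<beta>) at_top"
      by (intro tendsto_intros tendsto_divide_0[OF tendsto_const] filterlim_at_top_imp_at_infinity filterlim_ident) auto
    have 3: "filterlim (\<lambda>s. s - d) at_top at_top"
      using filterlim_tendsto_add_at_top[OF tendsto_const[of "- d"] filterlim_ident] by simp
    have 2: "((\<lambda>s. d powr \<beta> * (s - d) powr (- \<beta>)) \<longlongrightarrow> d powr \<beta> * 0) at_top"
      using assms
      by (intro tendsto_intros tendsto_neg_powr 3) auto
    have "((\<lambda>s. ((1 / (1 - d / s)) powr \<beta> - d powr \<beta> * (s - d) powr (- \<beta>)) / (\<beta> * d)) \<longlongrightarrow> ((1 / (1 - 0)) powr \<beta> - d powr \<beta> * 0) / (\<beta> * d)) at_top"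
      by (intro tendsto_divide tendsto_diff 1 2 tendsto_const) (use assms in auto)
    moreover have "\<forall>\<^sub>F s in at_top. ((1 / (1 - d / s)) powr \<beta> - d powr \<beta> * (s - d) powr (- \<beta>)) / (\<beta> * d) = ?F s"
      using eventually_gt_at_top[of d]
    proof eventually_elim
      case (elim s)
      have "1 / (1 - d / s) = s / (s - d)" using elim assms by (simp add: field_simps)
      then have "(1 / (1 - d / s)) powr \<beta> = s powr \<beta> * (s - d) powr (- \<beta>)"
        using elim assms by (simp add: powr_divide powr_minus_divide)
      then show ?case by (simp add: left_diff_distrib)
    qed
    ultimately have "(?F \<longlongrightarrow> ((1 / (1 - 0)) powr \<beta> - d powr \<beta> * 0) / (\<beta> * d)) at_top"
      by (rule Lim_transform_eventually)
    then show ?thesis by simp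
  qed
  have A: "(?F \<longlongrightarrow> 0) (at_right d)"
  proof (rule Lim_null_comparison)
    show "\<forall>\<^sub>F s in at_right d. norm (?F s) \<le> d powr (\<beta> - 1) * (s - d) powr (1 - \<beta>) / (\<beta> * d)"
      unfolding eventually_at_right_field
    proof (intro exI[of _ "d + 1"] conjI allI impI)
      fix s assume s: "d < s" "s < d + 1"
      have "\<bar>s powr \<beta> - d powr \<beta>\<bar> * (s - d) powr (- \<beta>) \<le> d powr (\<beta> - 1) * (s - d) * (s - d) powr (- \<beta>)"
        using powr_sub_le_linear[of s d \<beta>] s assms by (intro mult_right_mono) auto
      also have "\<dots> = d powr (\<beta> - 1) * (s - d) powr (1 - \<beta>)"
        using s by (simp add: powr_diff powr_minus field_simps)
      finally show "norm (?F s) \<le> d powr (\<beta> - 1) * (s - d) powr (1 - \<beta>) / (\<beta> * d)"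
        using assms by (simp add: abs_mult divide_right_mono)
    qed (use assms in auto)
    have "((\<lambda>s. d powr (\<beta> - 1) * (s - d) powr (1 - \<beta>) / (\<beta> * d)) \<longlongrightarrow> d powr (\<beta> - 1) * (d - d) powr (1 - \<beta>) / (\<beta> * d)) (at_right d)"
      using assms by (intro tendsto_intros tendsto_powr') (auto simp: eventually_at_right_field intro!: exI[of _ "d + 1"])
    then show "((\<lambda>s. d powr (\<beta> - 1) * (s - d) powr (1 - \<beta>) / (\<beta> * d)) \<longlongrightarrow> 0) (at_right d)"
      using assms by simp
  qed
  have nn: "AE s in lborel. ereal d < ereal s \<longrightarrow> ereal s < \<infinity> \<longrightarrow> 0 \<le> ?f s"
    using assms by (intro always_eventually) (auto intro!: mult_nonneg_nonneg powr_mono2')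
  have prem2: "\<And>x. ereal d < ereal x \<Longrightarrow> ereal x < \<infinity> \<Longrightarrow> (?F has_real_derivative ?f x) (at x)"
    "\<And>x. ereal d < ereal x \<Longrightarrow> ereal x < \<infinity> \<Longrightarrow> isCont ?f x"
    "((?F \<circ> real_of_ereal) \<longlongrightarrow> 0) (at_right (ereal d))"
    "((?F \<circ> real_of_ereal) \<longlongrightarrow> 1 / (\<beta> * d)) (at_left \<infinity>)"
  proof -
    fix x assume x: "ereal d < ereal x" "ereal x < \<infinity>"
    show "(?F has_real_derivative ?f x) (at x)"
      using primitive_right[of d x \<beta>] assms x by simp
    show "isCont ?f x"
      using x assms by (intro continuous_intros) auto
  next
    show "((?F \<circ> real_of_ereal) \<longlongrightarrow> 0) (at_right (ereal d))"
      using A by (simp only: ereal_tendsto_simps)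
    show "((?F \<circ> real_of_ereal) \<longlongrightarrow> 1 / (\<beta> * d)) (at_left \<infinity>)"
      using B by (simp only: ereal_tendsto_simps)
  qed
  have *: "set_integrable lborel (einterval (ereal d) \<infinity>) ?f"
    "(LBINT x=ereal d..\<infinity>. ?f x) = 1 / (\<beta> * d) - 0"
    by (rule interval_integral_FTC_nonneg[where F = ?F, OF _ prem2(1,2) nn prem2(3,4)]; use assms in simp)+
  show "set_integrable lborel {d<..} ?f" using *(1) by simp
  show "(LINT s:{d<..}|lborel. ?f s) = 1 / (\<beta> * d)"
    using *(2) assms by (simp add: interval_lebesgue_integral_def)
qed

text \<open>
  Here \<open>e\<close> is the distance from the current position to the far edge of the interval that
  separates the two components of a vertical section of \<open>V\<close>; the integrals describe jumps to the other component.
\<close>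

lemma integral_other:
  fixes e \<beta> :: real
  assumes "0 < e" "0 < \<beta>" "\<beta> < 1"
  shows "set_integrable lborel {0<..} (\<lambda>s. s powr (\<beta> - 1) * (s + e) powr (- 1 - \<beta>))"
    "(LINT s:{0<..}|lborel. s powr (\<beta> - 1) * (s + e) powr (- 1 - \<beta>)) = 1 / (\<beta> * e)"
    "set_integrable lborel {0<..} (\<lambda>s. (s + e) powr (- 1 - \<beta>))"
    "(LINT s:{0<..}|lborel. (s + e) powr (- 1 - \<beta>)) = e powr (- \<beta>) / \<beta>"
proof -
  let ?F = "\<lambda>s. s powr \<beta> * (s + e) powr (- \<beta>) / (\<beta> * e)"
  let ?f = "\<lambda>s. s powr (\<beta> - 1) * (s + e) powr (- 1 - \<beta>)"
  let ?G = "\<lambda>s. - ((s + e) powr (- \<beta>)) / \<beta>"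
  let ?g = "\<lambda>s. (s + e) powr (- 1 - \<beta>)"
  have B: "(?F \<longlongrightarrow> 1 / (\<beta> * e)) at_top"
  proof -
    have 1: "((\<lambda>s. (1 / (1 + e / s)) powr \<beta>) \<longlongrightarrow> (1 / (1 + 0)) powr \<beta>) at_top"
      by (intro tendsto_intros tendsto_divide_0[OF tendsto_const] filterlim_at_top_imp_at_infinity filterlim_ident) auto
    have "((\<lambda>s. (1 / (1 + e / s)) powr \<beta> / (\<beta> * e)) \<longlongrightarrow> (1 / (1 + 0)) powr \<beta> / (\<beta> * e)) at_top"
      by (intro tendsto_divide 1 tendsto_const) (use assms in auto)
    moreover have "\<forall>\<^sub>F s in at_top. (1 / (1 + e / s)) powr \<beta> / (\<beta> * e) = ?F s"
      using eventually_gt_at_top[of 0]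
    proof eventually_elim
      case (elim s)
      have "1 / (1 + e / s) = s / (s + e)" using elim assms by (simp add: field_simps)
      then show ?case
        using elim assms by (simp add: powr_divide powr_minus_divide)
    qed
    ultimately have "(?F \<longlongrightarrow> (1 / (1 + 0)) powr \<beta> / (\<beta> * e)) at_top"
      by (rule Lim_transform_eventually)
    then show ?thesis by simp
  qed
  have A: "(?F \<longlongrightarrow> 0) (at_right 0)"
  proof -
    have "(?F \<longlongrightarrow> 0 powr \<beta> * (0 + e) powr (- \<beta>) / (\<beta> * e)) (at_right 0)"
      using assms by (intro tendsto_intros tendsto_powr') (auto simp: eventually_at_right_field intro!: exI[of _ 1])
    then show ?thesis by simp
  qed
  have C: "(?G \<longlongrightarrow> 0) at_top"
  proof -
    have "(?G \<longlongrightarrow> - 0 / \<beta>) at_top"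
      using assms
      by (intro tendsto_intros tendsto_neg_powr filterlim_tendsto_add_at_top[OF tendsto_const[of e] filterlim_ident, simplified add.commute[of e]]) auto
    then show ?thesis by simp
  qed
  have D: "(?G \<longlongrightarrow> - (e powr (- \<beta>)) / \<beta>) (at_right 0)"
  proof -
    have "(?G \<longlongrightarrow> - ((0 + e) powr (- \<beta>)) / \<beta>) (at_right 0)"
      using assms by (intro tendsto_intros) auto
    then show ?thesis by simp
  qed
  have nn: "AE s in lborel. 0 < ereal s \<longrightarrow> ereal s < \<infinity> \<longrightarrow> 0 \<le> ?f s"
    "AE s in lborel. 0 < ereal s \<longrightarrow> ereal s < \<infinity> \<longrightarrow> 0 \<le> ?g s"
    by auto
  have prem3: "\<And>x. 0 < ereal x \<Longrightarrow> ereal x < \<infinity> \<Longrightarrow> (?F has_real_derivative ?f x) (at x)"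
    "\<And>x. 0 < ereal x \<Longrightarrow> ereal x < \<infinity> \<Longrightarrow> isCont ?f x"
    "((?F \<circ> real_of_ereal) \<longlongrightarrow> 0) (at_right 0)"
    "((?F \<circ> real_of_ereal) \<longlongrightarrow> 1 / (\<beta> * e)) (at_left \<infinity>)"
  proof -
    fix x assume x: "0 < ereal x" "ereal x < \<infinity>"
    then show "(?F has_real_derivative ?f x) (at x)"
      using primitive_other(1)[of x e \<beta>] assms x by simp
    show "isCont ?f x"
      using x assms by (intro continuous_intros) auto
  next
    show "((?F \<circ> real_of_ereal) \<longlongrightarrow> 0) (at_right 0)"
      unfolding zero_ereal_def using A by (simp only: ereal_tendsto_simps)
    show "((?F \<circ> real_of_ereal) \<longlongrightarrow> 1 / (\<beta> * e)) (at_left \<infinity>)"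
      using B by (simp only: ereal_tendsto_simps)
  qed
  have *: "set_integrable lborel (einterval 0 \<infinity>) ?f"
    "(LBINT x=0..\<infinity>. ?f x) = 1 / (\<beta> * e) - 0"
    by (rule interval_integral_FTC_nonneg[where F = ?F, OF _ prem3(1,2) nn(1) prem3(3,4)]; use assms in simp)+
  have einf: "einterval 0 \<infinity> = {0::real<..}" by (auto simp: einterval_def)
  have prem4: "\<And>x. 0 < ereal x \<Longrightarrow> ereal x < \<infinity> \<Longrightarrow> (?G has_real_derivative ?g x) (at x)"
    "\<And>x. 0 < ereal x \<Longrightarrow> ereal x < \<infinity> \<Longrightarrow> isCont ?g x"
    "((?G \<circ> real_of_ereal) \<longlongrightarrow> - (e powr (- \<beta>)) / \<beta>) (at_right 0)"
    "((?G \<circ> real_of_ereal) \<longlongrightarrow> 0) (at_left \<infinity>)"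
  proof -
    fix x assume x: "0 < ereal x" "ereal x < \<infinity>"
    then show "(?G has_real_derivative ?g x) (at x)"
      using primitive_other(2)[of x e \<beta>] assms x by simp
    show "isCont ?g x"
      using x assms by (intro continuous_intros) auto
  next
    show "((?G \<circ> real_of_ereal) \<longlongrightarrow> - (e powr (- \<beta>)) / \<beta>) (at_right 0)"
      unfolding zero_ereal_def using D by (simp only: ereal_tendsto_simps)
    show "((?G \<circ> real_of_ereal) \<longlongrightarrow> 0) (at_left \<infinity>)"
      using C by (simp only: ereal_tendsto_simps)
  qed
  have **: "set_integrable lborel (einterval 0 \<infinity>) ?g"
    "(LBINT x=0..\<infinity>. ?g x) = 0 - (- (e powr (- \<beta>)) / \<beta>)"
    by (rule interval_integral_FTC_nonneg[where F = ?G, OF _ prem4(1,2) nn(2) prem4(3,4)]; use assms in simp)+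
  show "set_integrable lborel {0<..} ?f" "set_integrable lborel {0<..} ?g"
    using *(1) **(1) by (simp_all add: einf)
  show "(LINT s:{0<..}|lborel. ?f s) = 1 / (\<beta> * e)" "(LINT s:{0<..}|lborel. ?g s) = e powr (- \<beta>) / \<beta>"
    using *(2) **(2) by (simp_all add: interval_lebesgue_integral_def einf)
qed

lemma set_integrable_powr_near_0:
  fixes p :: real assumes "p < 1"
  shows "set_integrable lborel {0<..<1} (\<lambda>t. t powr (- p))"
proof -
  let ?F = "\<lambda>t. t powr (1 - p) / (1 - p)"
  have "set_integrable lborel (einterval (ereal 0) (ereal 1)) (\<lambda>t. t powr (- p))"
  proof (rule interval_integral_FTC_nonneg(1)[where F = ?F])
    fix x assume x: "ereal 0 < ereal x" "ereal x < ereal 1"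
    show "(?F has_real_derivative x powr (- p)) (at x)"
      using x assms by (auto intro!: derivative_eq_intros)
    show "isCont (\<lambda>t. t powr - p) x" using x by (intro continuous_intros) auto
  next
    have "(?F \<longlongrightarrow> 0 powr (1 - p) / (1 - p)) (at_right 0)"
      using assms by (intro tendsto_intros tendsto_powr') (auto simp: eventually_at_right_field intro!: exI[of _ 1])
    then have "(?F \<longlongrightarrow> 0) (at_right 0)" by simp
    then show "((?F \<circ> real_of_ereal) \<longlongrightarrow> 0) (at_right (ereal 0))"
      by (simp only: ereal_tendsto_simps)
    have "(?F \<longlongrightarrow> 1 powr (1 - p) / (1 - p)) (at_left 1)"
      using assms by (intro tendsto_intros) auto
    then show "((?F \<circ> real_of_ereal) \<longlongrightarrow> 1 powr (1 - p) / (1 - p)) (at_left (ereal 1))"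
      by (simp only: ereal_tendsto_simps)
  qed auto
  then show ?thesis by simp
qed

lemma set_integrable_powr_near_inf:
  fixes p :: real assumes "1 < p"
  shows "set_integrable lborel {1<..} (\<lambda>t. t powr (- p))"
proof -
  let ?F = "\<lambda>t. t powr (1 - p) / (1 - p)"
  have "set_integrable lborel (einterval (ereal 1) \<infinity>) (\<lambda>t. t powr (- p))"
  proof (rule interval_integral_FTC_nonneg(1)[where F = ?F])
    fix x assume x: "ereal 1 < ereal x" "ereal x < \<infinity>"
    then show "(?F has_real_derivative x powr (- p)) (at x)"
      using assms by (auto intro!: derivative_eq_intros)
    show "isCont (\<lambda>t. t powr - p) x" using x by (intro continuous_intros) auto
  next
    have "(?F \<longlongrightarrow> 1 powr (1 - p) / (1 - p)) (at_right 1)"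
      using assms by (intro tendsto_intros) auto
    then show "((?F \<circ> real_of_ereal) \<longlongrightarrow> 1 powr (1 - p) / (1 - p)) (at_right (ereal 1))"
      by (simp only: ereal_tendsto_simps)
    have "(?F \<longlongrightarrow> 0 / (1 - p)) at_top"
      using assms by (intro tendsto_divide tendsto_const tendsto_neg_powr filterlim_ident) auto
    then have "(?F \<longlongrightarrow> 0) at_top" by simp
    then show "((?F \<circ> real_of_ereal) \<longlongrightarrow> 0) (at_left \<infinity>)"
      by (simp only: ereal_tendsto_simps)
  qed auto
  then show ?thesis by simp
qed

lemma integrable_even:
  fixes f :: "real \<Rightarrow> real"
  assumes "set_integrable lborel {0<..} f"
  shows "integrable lborel (\<lambda>t. if t = 0 then 0 else f \<bar>t\<bar>)"
proof -
  have 1: "integrable lborel (\<lambda>t. indicator {0<..} t *\<^sub>R f t)"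
    using assms by (simp add: set_integrable_def)
  have "integrable lborel (\<lambda>t. indicator {0<..} (0 + -1 * t) *\<^sub>R f (0 + -1 * t))"
    using lborel_integrable_real_affine[OF 1, of "-1" 0] by simp
  from Bochner_Integration.integrable_add[OF 1 this] show ?thesis
    by (rule Bochner_Integration.integrable_cong[THEN iffD1, rotated 2])
       (auto simp: indicator_def)
qed

lemma integrable_powr_box:
  fixes p :: real assumes "p < 1"
  shows "integrable lborel (\<lambda>t. indicator {-1<..<1} t * \<bar>t\<bar> powr (- p))"
proof -
  have "set_integrable lborel {0<..} (\<lambda>t. indicator {-1<..<1} t * t powr (- p))"
    using set_integrable_powr_near_0[OF assms] unfolding set_integrable_def
    by (rule Bochner_Integration.integrable_cong[THEN iffD1, rotated 2]) (auto simp: indicator_def)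
  from integrable_even[OF this] show ?thesis
    by (rule Bochner_Integration.integrable_cong[THEN iffD1, rotated 2]) (auto simp: indicator_def)
qed

lemma integrable_powr_outside:
  fixes p r :: real assumes "1 < p" "0 < r"
  shows "integrable lborel (\<lambda>t. indicator {t. r \<le> \<bar>t\<bar>} t * \<bar>t\<bar> powr (- p))"
proof -
  have "set_integrable lborel {0<..} (\<lambda>t. indicator {1<..} t * t powr (- p))"
    using set_integrable_powr_near_inf[OF assms(1)] unfolding set_integrable_def
    by (rule Bochner_Integration.integrable_cong[THEN iffD1, rotated 2]) (auto simp: indicator_def)
  from integrable_even[OF this]
  have 1: "integrable lborel (\<lambda>t. indicator {1<..} \<bar>t\<bar> * \<bar>t\<bar> powr (- p))"
    by (rule Bochner_Integration.integrable_cong[THEN iffD1, rotated 2]) (auto simp: indicator_def)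
  have 2: "integrable lborel (\<lambda>t::real. indicator {-1..1} t * r powr (- p))"
    by (intro integrable_mult_left integrable_real_indicator) (auto simp: emeasure_lborel_Icc)
  show ?thesis
  proof (rule Bochner_Integration.integrable_bound[OF Bochner_Integration.integrable_add[OF 1 2]])
    show "AE t in lborel. norm (indicator {t. r \<le> \<bar>t\<bar>} t * \<bar>t\<bar> powr (- p))
      \<le> norm (indicator {1<..} \<bar>t\<bar> * \<bar>t\<bar> powr (- p) + indicator {-1..1} t * r powr (- p))"
      using assms by (intro always_eventually allI) (auto simp: indicator_def intro!: powr_mono2')
  qed measurable
qed

text \<open>
  The weight under which a bounded Lipschitz increment is integrable against a stable kernel of
  index below one.
\<close>

lemma integrable_min_powr:
  fixes \<delta> \<beta> :: real assumes "0 < \<beta>" "\<beta> < 1" "0 < \<delta>"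
  shows "integrable lborel (\<lambda>t. min 1 (\<bar>t\<bar> / \<delta>) * \<bar>t\<bar> powr (- 1 - \<beta>))"
proof -
  have 1: "integrable lborel (\<lambda>t. (indicator {-1<..<1} t * \<bar>t\<bar> powr (- \<beta>)) / \<delta>)"
    using integrable_powr_box[of \<beta>] assms by auto
  have 2: "integrable lborel (\<lambda>t. indicator {t. 1 \<le> \<bar>t\<bar>} t * \<bar>t\<bar> powr (- (1 + \<beta>)))"
    using integrable_powr_outside[of "1 + \<beta>" 1] assms by auto
  show ?thesis
  proof (rule Bochner_Integration.integrable_bound[OF Bochner_Integration.integrable_add[OF 1 2]], goal_cases)
    case 2
    show ?case
    proof (intro always_eventually allI)
      fix t :: real
      have e: "\<bar>t\<bar> * \<bar>t\<bar> powr (- 1 - \<beta>) = \<bar>t\<bar> powr (- \<beta>)"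
        using powr_mult_base[of "\<bar>t\<bar>" "- 1 - \<beta>"] by simp
      show "norm (min 1 (\<bar>t\<bar> / \<delta>) * \<bar>t\<bar> powr (- 1 - \<beta>))
         \<le> norm (indicator {-1<..<1} t * \<bar>t\<bar> powr (- \<beta>) / \<delta> + indicator {t. 1 \<le> \<bar>t\<bar>} t * \<bar>t\<bar> powr (- (1 + \<beta>)))"
      proof (cases "\<bar>t\<bar> < 1")
        case True
        have "min 1 (\<bar>t\<bar> / \<delta>) * \<bar>t\<bar> powr (- 1 - \<beta>) \<le> \<bar>t\<bar> / \<delta> * \<bar>t\<bar> powr (- 1 - \<beta>)"
          by (intro mult_right_mono) auto
        also have "\<dots> = \<bar>t\<bar> powr (- \<beta>) / \<delta>" using e by simp
        finally show ?thesis using True assms by (auto simp: indicator_def)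
      next
        case False
        then have "- 1 - \<beta> = - (1 + \<beta>)" by simp
        then show ?thesis using False assms mult_right_mono[of "min 1 (\<bar>t\<bar> / \<delta>)" 1 "\<bar>t\<bar> powr (- (1 + \<beta>))"]
          by (auto simp: indicator_def)
      qed
    qed
  qed simp
qed

definition barrier :: "real \<Rightarrow> real \<Rightarrow> real \<Rightarrow> real" where
  "barrier \<beta> \<delta> s = (if s \<le> \<delta> then 0 else 1 - (\<delta> / s) powr (1 - \<beta>))"

lemma barrier_measurable [measurable]: "barrier \<beta> \<delta> \<in> borel_measurable borel"
  unfolding barrier_def[abs_def] by measurable

context
  fixes \<beta> \<delta> :: real
  assumes \<beta>: "0 < \<beta>" "\<beta> < 1" and \<delta>: "0 < \<delta>"
begin

lemma barrier_bounds: "0 \<le> barrier \<beta> \<delta> s" "barrier \<beta> \<delta> s \<le> 1"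
  using \<beta> \<delta> by (auto simp: barrier_def intro!: powr_le1)

lemma barrier_lipschitz_aux:
  assumes "s \<le> t" shows "0 \<le> barrier \<beta> \<delta> t - barrier \<beta> \<delta> s \<and> barrier \<beta> \<delta> t - barrier \<beta> \<delta> s \<le> (t - s) / \<delta>"
proof -
  have *: "0 \<le> (\<delta> / u) powr (1 - \<beta>) - (\<delta> / t) powr (1 - \<beta>) \<and>
      (\<delta> / u) powr (1 - \<beta>) - (\<delta> / t) powr (1 - \<beta>) \<le> (t - u) / \<delta>" if "\<delta> \<le> u" "u \<le> t" for u
  proof
    show "0 \<le> (\<delta> / u) powr (1 - \<beta>) - (\<delta> / t) powr (1 - \<beta>)"
      using that \<beta> \<delta> by (auto intro!: powr_mono2 divide_left_mono)
    have e: "(\<delta> / t) powr (1 - \<beta>) = (\<delta> / u) powr (1 - \<beta>) * (u / t) powr (1 - \<beta>)"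
      using that \<delta> by (subst powr_mult[symmetric]) auto
    have "(u / t) powr 1 \<le> (u / t) powr (1 - \<beta>)"
      using that \<beta> \<delta> by (intro powr_mono') auto
    then have "1 - (u / t) powr (1 - \<beta>) \<le> 1 - u / t" using that \<delta> by simp
    moreover have "0 \<le> 1 - (u / t) powr (1 - \<beta>)" using that \<beta> \<delta> by (simp add: powr_le1)
    moreover have "(\<delta> / u) powr (1 - \<beta>) \<le> 1" using that \<beta> \<delta> by (intro powr_le1) auto
    ultimately have "(\<delta> / u) powr (1 - \<beta>) * (1 - (u / t) powr (1 - \<beta>)) \<le> 1 * (1 - u / t)"
      by (intro mult_mono) auto
    also have "\<dots> = (t - u) / t" using that \<delta> by (simp add: field_simps)
    also have "\<dots> \<le> (t - u) / \<delta>" using that \<delta> by (intro divide_left_mono) auto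
    finally show "(\<delta> / u) powr (1 - \<beta>) - (\<delta> / t) powr (1 - \<beta>) \<le> (t - u) / \<delta>"
      by (simp add: e algebra_simps)
  qed
  consider "t \<le> \<delta>" | "s \<le> \<delta>" "\<delta> < t" | "\<delta> < s" using assms by linarith
  then show ?thesis
  proof cases
    case 2
    have "(t - \<delta>) / \<delta> \<le> (t - s) / \<delta>" using 2 \<delta> by (intro divide_right_mono) auto
    then show ?thesis using *[of \<delta>] 2 \<delta> by (auto simp: barrier_def)
  qed (use assms * \<delta> in \<open>auto simp: barrier_def\<close>)
qed

lemma barrier_lipschitz: "\<bar>barrier \<beta> \<delta> s - barrier \<beta> \<delta> t\<bar> \<le> \<bar>s - t\<bar> / \<delta>"
  using barrier_lipschitz_aux[of s t] barrier_lipschitz_aux[of t s]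
  by (cases "s \<le> t") (auto simp: abs_minus_commute)

lemma barrier_diff_bound: "\<bar>barrier \<beta> \<delta> s - barrier \<beta> \<delta> t\<bar> \<le> min 1 (\<bar>s - t\<bar> / \<delta>)"
  using barrier_lipschitz[of s t] barrier_bounds[of s] barrier_bounds[of t] by auto

text \<open>
  The truncation at \<open>0\<close> is free: the barrier dominates the harmonic profile \<open>1 - (\<delta> / s)\<^sup>1\<^sup>-\<^sup>\<beta>\<close> everywhere and
  agrees with it to the right of \<open>\<delta>\<close>, so it gains at least as much at each jump from \<open>d \<ge> \<delta>\<close>.
\<close>

lemma barrier_lower:
  assumes "0 < s" "\<delta> \<le> d"
  shows "\<delta> powr (1 - \<beta>) * (d powr (\<beta> - 1) - s powr (\<beta> - 1)) \<le> barrier \<beta> \<delta> s - barrier \<beta> \<delta> d"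
proof -
  have e: "(\<delta> / u) powr (1 - \<beta>) = \<delta> powr (1 - \<beta>) * u powr (\<beta> - 1)" if "0 < u" for u
    using that \<delta> powr_minus_divide[of u "1 - \<beta>"] by (simp add: powr_divide)
  have 1: "barrier \<beta> \<delta> d = 1 - (\<delta> / d) powr (1 - \<beta>)" using assms \<delta> by (auto simp: barrier_def)
  have 2: "1 - (\<delta> / s) powr (1 - \<beta>) \<le> barrier \<beta> \<delta> s"
    using assms \<delta> \<beta> ge_one_powr_ge_zero[of "\<delta> / s" "1 - \<beta>"] by (auto simp: barrier_def)
  show ?thesis using 1 2 e[of s] e[of d] assms \<delta> by (simp add: algebra_simps)
qed

lemma barrier_integrable:
  shows "integrable lborel (\<lambda>s. (barrier \<beta> \<delta> s - barrier \<beta> \<delta> d) * \<bar>s - d\<bar> powr (- 1 - \<beta>))"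
proof (rule Bochner_Integration.integrable_bound)
  show "integrable lborel (\<lambda>s. min 1 (\<bar>s - d\<bar> / \<delta>) * \<bar>s - d\<bar> powr (- 1 - \<beta>))"
    using lborel_integrable_real_affine[OF integrable_min_powr[OF \<beta> \<delta>], of 1 "-d"] by simp
  show "AE s in lborel. norm ((barrier \<beta> \<delta> s - barrier \<beta> \<delta> d) * \<bar>s - d\<bar> powr (- 1 - \<beta>))
      \<le> norm (min 1 (\<bar>s - d\<bar> / \<delta>) * \<bar>s - d\<bar> powr (- 1 - \<beta>))"
    using barrier_diff_bound \<delta> by (intro always_eventually allI) (auto simp: abs_mult intro!: mult_right_mono)
qed measurable

text \<open>
  Up to the common factor \<open>\<delta>\<^sup>1\<^sup>-\<^sup>\<beta>\<close>, the harmonic comparison function contributes \<open>- 1 / (\<beta> d)\<close> from the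
  left of \<open>d\<close> and \<open>1 / (\<beta> d)\<close> from the right.
\<close>

lemma barrier_same_component:
  assumes d: "\<delta> < d"
  shows "0 \<le> (LINT s:{0<..}|lborel. (barrier \<beta> \<delta> s - barrier \<beta> \<delta> d) * \<bar>s - d\<bar> powr (- 1 - \<beta>))"
proof -
  let ?c = "\<delta> powr (1 - \<beta>)"
  let ?f = "\<lambda>s. (barrier \<beta> \<delta> s - barrier \<beta> \<delta> d) * \<bar>s - d\<bar> powr (- 1 - \<beta>)"
  have d0: "0 < d" using d \<delta> by simp
  have si: "set_integrable lborel A ?f" if "A \<in> sets borel" for A
    using barrier_integrable that unfolding set_integrable_def
    by (intro integrable_mult_indicator) auto
  have ineq: "?c * ((d powr (\<beta> - 1) - s powr (\<beta> - 1)) * \<bar>s - d\<bar> powr (- 1 - \<beta>)) \<le> ?f s" if "0 < s" for s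
    using mult_right_mono[OF barrier_lower[OF that, of d], of "\<bar>s - d\<bar> powr (- 1 - \<beta>)"] d by (simp add: mult.assoc)
  have "(LINT s:{0<..<d}|lborel. - ?c * ((s powr (\<beta> - 1) - d powr (\<beta> - 1)) * (d - s) powr (- 1 - \<beta>))) \<le> (LINT s:{0<..<d}|lborel. ?f s)"
  proof (rule set_integral_mono)
    show "set_integrable lborel {0<..<d} (\<lambda>s. - ?c * ((s powr (\<beta> - 1) - d powr (\<beta> - 1)) * (d - s) powr (- 1 - \<beta>)))"
      using integral_left(1)[OF d0 \<beta>] by (intro set_integrable_mult_right) auto
  next
    fix s assume "s \<in> {0<..<d}"
    then show "- ?c * ((s powr (\<beta> - 1) - d powr (\<beta> - 1)) * (d - s) powr (- 1 - \<beta>)) \<le> ?f s"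
      using ineq[of s] by (simp add: abs_minus_commute algebra_simps)
  qed (auto intro!: si)
  moreover have "(LINT s:{d<..}|lborel. ?c * ((d powr (\<beta> - 1) - s powr (\<beta> - 1)) * (s - d) powr (- 1 - \<beta>))) \<le> (LINT s:{d<..}|lborel. ?f s)"
  proof (rule set_integral_mono)
    show "set_integrable lborel {d<..} (\<lambda>s. ?c * ((d powr (\<beta> - 1) - s powr (\<beta> - 1)) * (s - d) powr (- 1 - \<beta>)))"
      using integral_right(1)[OF d0 \<beta>] by (intro set_integrable_mult_right) auto
  next
    fix s assume "s \<in> {d<..}"
    then show "?c * ((d powr (\<beta> - 1) - s powr (\<beta> - 1)) * (s - d) powr (- 1 - \<beta>)) \<le> ?f s"
      using ineq[of s] d0 by (simp add: algebra_simps)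
  qed (auto intro!: si)
  moreover have "(LINT s:{0<..}|lborel. ?f s) = (LINT s:{0<..<d} \<union> {d<..}|lborel. ?f s)"
    unfolding set_lebesgue_integral_def
    by (rule integral_cong_AE) (use AE_lborel_singleton[of d] d0 in \<open>auto simp: indicator_def elim!: eventually_mono\<close>)
  moreover have "\<dots> = (LINT s:{0<..<d}|lborel. ?f s) + (LINT s:{d<..}|lborel. ?f s)"
    by (rule set_integral_Un) (auto intro!: si)
  ultimately show ?thesis
    unfolding set_integral_mult_right
    unfolding integral_left(2)[OF d0 \<beta>] integral_right(2)[OF d0 \<beta>] by simp
qed

text \<open>
  A jump to the other component covers at least the distance \<open>e \<ge> d\<close>, and the two closed forms of
  \<open>integral_other\<close> compare in the right direction because \<open>e\<^sup>\<beta>\<^sup>-\<^sup>1 \<le> d\<^sup>\<beta>\<^sup>-\<^sup>1\<close>.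
\<close>

lemma barrier_other_component:
  assumes d: "\<delta> < d" "d \<le> e"
  shows "set_integrable lborel {0<..} (\<lambda>s. (barrier \<beta> \<delta> s - barrier \<beta> \<delta> d) * (s + e) powr (- 1 - \<beta>))"
    "0 \<le> (LINT s:{0<..}|lborel. (barrier \<beta> \<delta> s - barrier \<beta> \<delta> d) * (s + e) powr (- 1 - \<beta>))"
proof -
  let ?c = "\<delta> powr (1 - \<beta>)"
  let ?f = "\<lambda>s. (barrier \<beta> \<delta> s - barrier \<beta> \<delta> d) * (s + e) powr (- 1 - \<beta>)"
  have d0: "0 < d" "0 < e" using d \<delta> by simp_all
  note I = integral_other[OF d0(2) \<beta>]
  show si: "set_integrable lborel {0<..} ?f"
    unfolding set_integrable_def
  proof (rule Bochner_Integration.integrable_bound[OF I(3)[unfolded set_integrable_def]])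
    have "\<bar>barrier \<beta> \<delta> s - barrier \<beta> \<delta> d\<bar> \<le> 1" for s
      using barrier_bounds[of s] barrier_bounds[of d] by linarith
    then show "AE s in lborel. norm (indicator {0<..} s *\<^sub>R ?f s) \<le> norm (indicator {0<..} s *\<^sub>R (s + e) powr (- 1 - \<beta>))"
      by (intro always_eventually allI) (auto simp: indicator_def abs_mult intro!: mult_left_le_one_le)
  qed measurable
  have "(LINT s:{0<..}|lborel. ?c * (d powr (\<beta> - 1) * (s + e) powr (- 1 - \<beta>) - s powr (\<beta> - 1) * (s + e) powr (- 1 - \<beta>))) \<le> (LINT s:{0<..}|lborel. ?f s)"
  proof (rule set_integral_mono[OF _ si])
    show "set_integrable lborel {0<..} (\<lambda>s. ?c * (d powr (\<beta> - 1) * (s + e) powr (- 1 - \<beta>) - s powr (\<beta> - 1) * (s + e) powr (- 1 - \<beta>)))"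
      using I by (intro set_integrable_mult_right set_integral_diff) auto
    fix s :: real assume "s \<in> {0<..}"
    then show "?c * (d powr (\<beta> - 1) * (s + e) powr (- 1 - \<beta>) - s powr (\<beta> - 1) * (s + e) powr (- 1 - \<beta>)) \<le> ?f s"
      using mult_right_mono[OF barrier_lower[of s d], of "(s + e) powr (- 1 - \<beta>)"] d
      by (simp add: algebra_simps)
  qed
  moreover have "(LINT s:{0<..}|lborel. ?c * (d powr (\<beta> - 1) * (s + e) powr (- 1 - \<beta>) - s powr (\<beta> - 1) * (s + e) powr (- 1 - \<beta>)))
      = ?c * (d powr (\<beta> - 1) * (e powr (- \<beta>) / \<beta>) - 1 / (\<beta> * e))"
    using I by (simp add: set_integral_diff)
  moreover have "0 \<le> ?c * (d powr (\<beta> - 1) * (e powr (- \<beta>) / \<beta>) - 1 / (\<beta> * e))"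
  proof -
    have "e powr (\<beta> - 1) \<le> d powr (\<beta> - 1)" using d d0 \<beta> by (intro powr_mono2') auto
    then have "e powr (\<beta> - 1) * (e powr (- \<beta>) / \<beta>) \<le> d powr (\<beta> - 1) * (e powr (- \<beta>) / \<beta>)"
      using \<beta> by (intro mult_right_mono) auto
    moreover have "e powr (\<beta> - 1) * (e powr (- \<beta>) / \<beta>) = 1 / (\<beta> * e)"
      using d0 by (simp add: powr_diff powr_minus field_simps)
    ultimately show ?thesis by simp
  qed
  ultimately show "0 \<le> (LINT s:{0<..}|lborel. ?f s)" by linarith
qed

end

section \<open>Jump kernels and their moments\<close>

lemma measurable_fst_snd_borel [measurable]:
  "fst \<in> borel_measurable (borel :: ('a::second_countable_topology \<times> 'b::second_countable_topology) measure)"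
  "snd \<in> borel_measurable (borel :: ('a \<times> 'b) measure)"
  by (auto intro!: borel_measurable_continuous_onI continuous_on_fst continuous_on_snd continuous_on_id)

lemma sets_ball [measurable]: "ball (x::'a::metric_space) r \<in> sets borel"
  by simp

lemma AE_lborel_fst_snd_nonzero: "AE h::real \<times> real in lborel. fst h \<noteq> 0 \<and> snd h \<noteq> 0"
proof -
  have 1: "AE h in lborel \<Otimes>\<^sub>M lborel. fst h \<noteq> (0::real) \<and> snd h \<noteq> (0::real)"
  proof (rule lborel_pair.AE_pair_measure)
    show "{x \<in> space (lborel \<Otimes>\<^sub>M lborel). fst x \<noteq> (0::real) \<and> snd x \<noteq> (0::real)} \<in> sets (lborel \<Otimes>\<^sub>M lborel)"
      by measurable
    show "AE x in lborel. AE y in lborel. fst (x, y) \<noteq> (0::real) \<and> snd (x, y) \<noteq> (0::real)"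
      using AE_lborel_singleton[of 0] by (auto elim!: eventually_mono)
  qed
  then show ?thesis unfolding lborel_prod .
qed

lemma integrable_fst_times_snd:
  fixes f g :: "real \<Rightarrow> real"
  assumes "integrable lborel f" "integrable lborel g"
  shows "integrable lborel (\<lambda>h. f (fst h) * g (snd h))"
proof -
  have [measurable]: "f \<in> borel_measurable borel" "g \<in> borel_measurable borel" using assms by auto
  have "integrable (lborel \<Otimes>\<^sub>M lborel) (\<lambda>h. f (fst h) * g (snd h))"
  proof (rule lborel_pair.Fubini_integrable)
    show "integrable lborel (\<lambda>x. LINT y|lborel. norm (f (fst (x, y)) * g (snd (x, y))))"
      using assms by (simp add: abs_mult)
  qed (use assms in auto)
  then show ?thesis by (simp add: lborel_prod)
qed

text \<open>
  Interpolation replaces the minimum of two powers by a product, so that double integrals of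
  the kernels factor into one-dimensional power integrals.
\<close>

lemma min_le_geometric_mean:
  fixes A B \<eta> :: real
  assumes "0 \<le> A" "0 \<le> B" "0 \<le> \<eta>" "\<eta> \<le> 1"
  shows "min A B \<le> A powr (1 - \<eta>) * B powr \<eta>"
proof (cases "min A B = 0")
  case False
  then have p: "0 < min A B" using assms by auto
  have "min A B = min A B powr ((1 - \<eta>) + \<eta>)" using p by simp
  also have "\<dots> = min A B powr (1 - \<eta>) * min A B powr \<eta>" by (rule powr_add)
  also have "\<dots> \<le> A powr (1 - \<eta>) * B powr \<eta>"
    using p assms by (intro mult_mono powr_mono2) auto
  finally show ?thesis .
qed auto

lemma norm_less_one_coords: "h \<in> ball 0 1 \<Longrightarrow> \<bar>fst h\<bar> < 1 \<and> \<bar>snd (h::real \<times> real)\<bar> < 1"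
  using norm_fst_le[of "fst h" "snd h"] norm_snd_le[of "snd h" "fst h"] by auto

locale jump_exponents =
  fixes a b :: real
  assumes exponents: "0 < a" "a < b" "b < 2" "a < (2 - b) / b"
begin

definition \<beta> :: real where "\<beta> = (a * b + a + b) / (a + 2)"
definition \<kappa> :: real where "\<kappa> = (b + 2) / (a + 2)"
text \<open>
  The jump density inside \<open>V\<close>, as a real function. It is \<open>0\<close>, not \<open>\<infinity>\<close>, on the coordinate axes since
  \<open>0 powr _ = 0\<close>; the axes are a null set.
\<close>

definition vertical_kernel :: "real \<times> real \<Rightarrow> real" where
  "vertical_kernel h = min (\<bar>fst h\<bar> powr (- (a + 2))) (\<bar>snd h\<bar> powr (- (b + 2)))"
definition cross_kernel :: "real \<times> real \<Rightarrow> real" where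
  "cross_kernel h = min (\<bar>fst h\<bar> powr (- (a + 2))) (\<bar>snd h\<bar> powr (- (a + 2)))"

lemma ab_small: "a * b + b < 2"
  using exponents by (auto simp: field_simps)

lemma \<beta>_bounds: "0 < \<beta>" "\<beta> < 1"
  using exponents ab_small by (auto simp: \<beta>_def divide_less_eq intro!: divide_pos_pos add_pos_pos)

lemma \<kappa>_ge_1: "1 \<le> \<kappa>" using exponents by (simp add: \<kappa>_def)

lemma \<kappa>_\<beta>: "\<kappa> * (a + 2) = b + 2" "\<beta> = b + 1 - \<kappa>"
  using exponents by (auto simp: \<kappa>_def \<beta>_def field_simps)

lemma vertical_kernel_measurable [measurable]: "vertical_kernel \<in> borel_measurable borel"
  "cross_kernel \<in> borel_measurable borel"
  unfolding vertical_kernel_def[abs_def] cross_kernel_def[abs_def] borel_prod[symmetric] by measurable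

lemma vertical_kernel_nonneg [simp]: "0 \<le> vertical_kernel h" "0 \<le> cross_kernel h"
  by (auto simp: vertical_kernel_def cross_kernel_def)

lemma vertical_kernel_interpolation:
  assumes "0 \<le> \<eta>" "\<eta> \<le> 1"
  shows "vertical_kernel h \<le> \<bar>fst h\<bar> powr (- ((a + 2) * (1 - \<eta>))) * \<bar>snd h\<bar> powr (- ((b + 2) * \<eta>))"
proof -
  have "vertical_kernel h \<le> (\<bar>fst h\<bar> powr (- (a + 2))) powr (1 - \<eta>) * (\<bar>snd h\<bar> powr (- (b + 2))) powr \<eta>"
    unfolding vertical_kernel_def using assms by (intro min_le_geometric_mean) auto
  also have "\<dots> = \<bar>fst h\<bar> powr (- ((a + 2) * (1 - \<eta>))) * \<bar>snd h\<bar> powr (- ((b + 2) * \<eta>))"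
    by (simp only: powr_powr mult_minus_left)
  finally show ?thesis .
qed

text \<open>
  The value \<open>0\<close> of the profile at \<open>s = 0\<close> matches the convention \<open>0 powr _ = 0\<close>, so that
  \<open>vertical_kernel_scaling\<close> holds pointwise.
\<close>

definition profile_mass :: real where "profile_mass = (LINT s|lborel. min (\<bar>s\<bar> powr (- (a + 2))) (if s = 0 then 0 else 1))"

lemma profile_integrable: "integrable lborel (\<lambda>s::real. min (\<bar>s\<bar> powr (- (a + 2))) (if s = 0 then 0 else 1))"
proof (rule Bochner_Integration.integrable_bound)
  show "integrable lborel (\<lambda>s::real. indicator {s. 1 \<le> \<bar>s\<bar>} s * \<bar>s\<bar> powr (- (a + 2)) + indicator {-1..1} s)"
    using integrable_powr_outside[of "a + 2" 1] exponents by (intro Bochner_Integration.integrable_add integrable_real_indicator) auto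
  show "AE s::real in lborel. norm (min (\<bar>s\<bar> powr - (a + 2)) (if s = 0 then 0 else 1))
    \<le> norm (indicator {s. 1 \<le> \<bar>s\<bar>} s * \<bar>s\<bar> powr - (a + 2) + indicator {- 1..1} s :: real)"
    by (intro always_eventually allI) (auto simp: indicator_def)
qed measurable

lemma profile_mass_nonneg: "0 \<le> profile_mass" unfolding profile_mass_def by (intro Bochner_Integration.integral_nonneg) auto

lemma vertical_kernel_scaling:
  assumes "z \<noteq> 0"
  shows "vertical_kernel (t, z) = \<bar>z\<bar> powr (- (b + 2)) *
    min (\<bar>0 + \<bar>z\<bar> powr (- \<kappa>) * t\<bar> powr (- (a + 2))) (if 0 + \<bar>z\<bar> powr (- \<kappa>) * t = 0 then 0 else 1)"
proof (cases "t = 0")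
  case False
  have "(\<bar>z\<bar> powr (- \<kappa>) * \<bar>t\<bar>) powr (- (a + 2)) = \<bar>z\<bar> powr (\<kappa> * (a + 2)) * \<bar>t\<bar> powr (- (a + 2))"
    by (simp only: powr_mult powr_powr minus_mult_minus)
  then have "\<bar>z\<bar> powr (- (b + 2)) * (\<bar>z\<bar> powr (- \<kappa>) * \<bar>t\<bar>) powr (- (a + 2)) = (\<bar>z\<bar> powr (- (b + 2)) * \<bar>z\<bar> powr (b + 2)) * \<bar>t\<bar> powr (- (a + 2))"
    by (simp only: \<kappa>_\<beta>(1) mult.assoc)
  also have "\<dots> = \<bar>t\<bar> powr (- (a + 2))"
    using assms by (subst powr_add[symmetric]) simp
  finally have "\<bar>z\<bar> powr (- (b + 2)) * (\<bar>z\<bar> powr (- \<kappa>) * \<bar>t\<bar>) powr (- (a + 2)) = \<bar>t\<bar> powr (- (a + 2))" .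
  moreover have "\<bar>z\<bar> powr (- (b + 2)) * min A 1 = min (\<bar>z\<bar> powr (- (b + 2)) * A) (\<bar>z\<bar> powr (- (b + 2)))" for A
    by (simp add: min_mult_distrib_left)
  ultimately show ?thesis using False assms by (simp add: vertical_kernel_def abs_mult)
qed (simp add: vertical_kernel_def)

text \<open>
  The substitution \<open>t = \<bar>z\<bar>\<^sup>\<kappa> s\<close> turns the kernel into \<open>\<bar>z\<bar>\<^sup>-\<^sup>b\<^sup>-\<^sup>2\<close> times a fixed profile; this is where
  the index \<open>\<beta>\<close> comes from.
\<close>

lemma vertical_kernel_marginal:
  assumes "z \<noteq> 0"
  shows "integrable lborel (\<lambda>t. vertical_kernel (t, z))"
    "(LINT t|lborel. vertical_kernel (t, z)) = profile_mass * \<bar>z\<bar> powr (- 1 - \<beta>)"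
proof -
  let ?c = "\<bar>z\<bar> powr (- \<kappa>)"
  have c: "?c \<noteq> 0" using assms by simp
  show "integrable lborel (\<lambda>t. vertical_kernel (t, z))"
    unfolding vertical_kernel_scaling[OF assms]
    using lborel_integrable_real_affine[OF profile_integrable c, of 0] by (rule integrable_mult_right)
  have "(LINT t|lborel. vertical_kernel (t, z)) = \<bar>z\<bar> powr (- (b + 2)) * (profile_mass / ?c)"
    unfolding vertical_kernel_scaling[OF assms] profile_mass_def
    using c by (subst (2) lborel_integral_real_affine[OF c, of _ 0]) simp
  also have "\<dots> = profile_mass * (\<bar>z\<bar> powr (- (b + 2)) * \<bar>z\<bar> powr \<kappa>)"
    by (simp add: powr_minus divide_inverse mult_ac)
  also have "\<bar>z\<bar> powr (- (b + 2)) * \<bar>z\<bar> powr \<kappa> = \<bar>z\<bar> powr (- 1 - \<beta>)"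
    by (simp add: powr_add[symmetric] \<kappa>_\<beta>(2) algebra_simps)
  finally show "(LINT t|lborel. vertical_kernel (t, z)) = profile_mass * \<bar>z\<bar> powr (- 1 - \<beta>)" .
qed

lemma vertical_kernel_integrate_out_fst:
  fixes R :: "real \<Rightarrow> real"
  assumes [measurable]: "R \<in> borel_measurable borel"
    and int: "integrable lborel (\<lambda>t. R t * \<bar>t\<bar> powr (- 1 - \<beta>))"
  shows "integrable lborel (\<lambda>h. R (snd h) * vertical_kernel h)"
    "(LINT h|lborel. R (snd h) * vertical_kernel h) = profile_mass * (LINT t|lborel. R t * \<bar>t\<bar> powr (- 1 - \<beta>))"
proof -
  let ?f = "\<lambda>s t. R t * vertical_kernel (s, t)"
  have [measurable]: "(\<lambda>(s, t). vertical_kernel (s, t)) \<in> borel_measurable (lborel \<Otimes>\<^sub>M lborel)"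
    unfolding lborel_prod by simp
  have int': "integrable lborel (\<lambda>y. LINT x|lborel. norm (?f x y))"
  proof (rule Bochner_Integration.integrable_cong_AE[THEN iffD1])
    show "integrable lborel (\<lambda>t. profile_mass * \<bar>R t * \<bar>t\<bar> powr (- 1 - \<beta>)\<bar>)"
      using int by (intro integrable_mult_right integrable_abs)
    show "AE y in lborel. profile_mass * \<bar>R y * \<bar>y\<bar> powr (- 1 - \<beta>)\<bar> = (LINT x|lborel. norm (?f x y))"
      using AE_lborel_singleton[of 0]
      by eventually_elim (simp add: abs_mult vertical_kernel_marginal)
  qed measurable
  have "integrable (lborel \<Otimes>\<^sub>M lborel) (\<lambda>(y, x). ?f x y)"
  proof (rule lborel_pair.Fubini_integrable)
    show "AE x in lborel. integrable lborel (\<lambda>y. case (x, y) of (y, x) \<Rightarrow> ?f x y)"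
      using AE_lborel_singleton[of 0]
      by eventually_elim (auto intro!: integrable_mult_right vertical_kernel_marginal)
  qed (use int' in auto)
  then have "integrable (lborel \<Otimes>\<^sub>M lborel) (\<lambda>(y, x). (\<lambda>(y, x). ?f x y) (x, y))"
    by (rule lborel_pair.integrable_product_swap)
  then have *: "integrable (lborel \<Otimes>\<^sub>M lborel) (case_prod ?f)" by simp
  then show "integrable lborel (\<lambda>h. R (snd h) * vertical_kernel h)"
    by (simp add: lborel_prod split_beta')
  have "(LINT h|lborel. R (snd h) * vertical_kernel h) = (LINT h|(lborel \<Otimes>\<^sub>M lborel). case_prod ?f h)"
    by (simp add: lborel_prod split_beta')
  also have "\<dots> = (LINT y|lborel. LINT x|lborel. ?f x y)"
    using lborel_pair.integral_snd[OF *] by simp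
  also have "\<dots> = (LINT y|lborel. profile_mass * (R y * \<bar>y\<bar> powr (- 1 - \<beta>)))"
    using AE_lborel_singleton[of 0]
    by (intro integral_cong_AE) (auto elim!: eventually_mono simp: vertical_kernel_marginal)
  finally show "(LINT h|lborel. R (snd h) * vertical_kernel h) = profile_mass * (LINT t|lborel. R t * \<bar>t\<bar> powr (- 1 - \<beta>))"
    by simp
qed

end

lemma lborel_swap:
  fixes f :: "real \<times> real \<Rightarrow> real"
  shows "integrable lborel f \<Longrightarrow> integrable lborel (\<lambda>h. f (prod.swap h))"
    "f \<in> borel_measurable borel \<Longrightarrow> (LINT h|lborel. f (prod.swap h)) = (LINT h|lborel. f h)"
proof -
  show "integrable lborel (\<lambda>h. f (prod.swap h))" if "integrable lborel f"
    using lborel_pair.integrable_product_swap[of f] that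
    by (simp add: lborel_prod prod.swap_def split_beta')
  show "(LINT h|lborel. f (prod.swap h)) = (LINT h|lborel. f h)" if "f \<in> borel_measurable borel"
    using lborel_pair.integral_product_swap[of f] that
    by (simp add: lborel_prod prod.swap_def split_beta')
qed

lemma emeasure_band:
  fixes u v t :: real
  shows "emeasure lborel {y. \<bar>u\<bar> - \<bar>t\<bar> < \<bar>v + y\<bar> \<and> \<bar>v + y\<bar> \<le> \<bar>u\<bar>} \<le> ennreal (2 * \<bar>t\<bar>)"
proof -
  have "{y. \<bar>u\<bar> - \<bar>t\<bar> < \<bar>v + y\<bar> \<and> \<bar>v + y\<bar> \<le> \<bar>u\<bar>} \<subseteq>
      {\<bar>u\<bar> - \<bar>t\<bar> - v .. \<bar>u\<bar> - v} \<union> {- \<bar>u\<bar> - v .. - \<bar>u\<bar> + \<bar>t\<bar> - v}" by auto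
  then have "emeasure lborel {y. \<bar>u\<bar> - \<bar>t\<bar> < \<bar>v + y\<bar> \<and> \<bar>v + y\<bar> \<le> \<bar>u\<bar>} \<le>
     emeasure lborel ({\<bar>u\<bar> - \<bar>t\<bar> - v .. \<bar>u\<bar> - v} \<union> {- \<bar>u\<bar> - v .. - \<bar>u\<bar> + \<bar>t\<bar> - v})"
    by (intro emeasure_mono) auto
  also have "\<dots> \<le> emeasure lborel {\<bar>u\<bar> - \<bar>t\<bar> - v .. \<bar>u\<bar> - v} + emeasure lborel {- \<bar>u\<bar> - v .. - \<bar>u\<bar> + \<bar>t\<bar> - v}"
    by (rule emeasure_subadditive) auto
  also have "\<dots> = ennreal (2 * \<bar>t\<bar>)"
    by (simp flip: ennreal_plus)
  finally show ?thesis .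
qed

context jump_exponents
begin

text \<open>
  The interpolation parameter \<open>\<eta>\<close> distributes the singularity over the two coordinates; each
  moment bound below is a choice of \<open>\<eta>\<close>.
\<close>

lemma vertical_kernel_weight_integrable:
  assumes "0 \<le> \<eta>" "\<eta> \<le> 1" "(a + 2) * (1 - \<eta>) - s < 1" "(b + 2) * \<eta> - t < 1"
  shows "integrable lborel (\<lambda>h. indicator (ball 0 1) h * (\<bar>fst h\<bar> powr s * \<bar>snd h\<bar> powr t * vertical_kernel h))"
proof (rule Bochner_Integration.integrable_bound[OF integrable_fst_times_snd[OF
      integrable_powr_box[OF assms(3)] integrable_powr_box[OF assms(4)]]])
  show "AE h in lborel. norm (indicator (ball 0 1) h * (\<bar>fst h\<bar> powr s * \<bar>snd h\<bar> powr t * vertical_kernel h)) \<le>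
     norm (indicator {- 1<..<1} (fst h) * \<bar>fst h\<bar> powr (- ((a + 2) * (1 - \<eta>) - s)) *
      (indicator {- 1<..<1} (snd h) * \<bar>snd h\<bar> powr (- ((b + 2) * \<eta> - t))))"
  proof (intro always_eventually allI)
    fix h :: "real \<times> real"
    have "\<bar>fst h\<bar> powr s * \<bar>snd h\<bar> powr t * vertical_kernel h \<le> \<bar>fst h\<bar> powr s * \<bar>snd h\<bar> powr t *
       (\<bar>fst h\<bar> powr (- ((a + 2) * (1 - \<eta>))) * \<bar>snd h\<bar> powr (- ((b + 2) * \<eta>)))"
      using vertical_kernel_interpolation[OF assms(1,2), of h] by (intro mult_left_mono) auto
    also have "\<dots> = (\<bar>fst h\<bar> powr s * \<bar>fst h\<bar> powr (- ((a + 2) * (1 - \<eta>)))) * (\<bar>snd h\<bar> powr t * \<bar>snd h\<bar> powr (- ((b + 2) * \<eta>)))"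
      by (simp only: mult_ac)
    also have "\<dots> = \<bar>fst h\<bar> powr (- ((a + 2) * (1 - \<eta>) - s)) * \<bar>snd h\<bar> powr (- ((b + 2) * \<eta> - t))"
      unfolding powr_add[symmetric] by simp
    finally show "norm (indicator (ball 0 1) h * (\<bar>fst h\<bar> powr s * \<bar>snd h\<bar> powr t * vertical_kernel h)) \<le>
     norm (indicator {- 1<..<1} (fst h) * \<bar>fst h\<bar> powr (- ((a + 2) * (1 - \<eta>) - s)) *
      (indicator {- 1<..<1} (snd h) * \<bar>snd h\<bar> powr (- ((b + 2) * \<eta> - t))))"
      using norm_less_one_coords[of h] by (auto simp: indicator_def abs_mult)
  qed
qed measurable

text \<open>
  The threshold \<open>(a b + a + b) / (b + 2)\<close> is the index of the horizontal jumps; it is smaller than \<open>\<beta>\<close>.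
\<close>

lemma vertical_kernel_fst_integrable:
  assumes "(a * b + a + b) / (b + 2) < \<theta>" "\<theta> \<le> 1"
  shows "integrable lborel (\<lambda>h. indicator (ball 0 1) h * (\<bar>fst h\<bar> powr \<theta> * vertical_kernel h))"
proof -
  have "1 - (1 + \<theta>) / (a + 2) < 1 / (b + 2)"
    using assms exponents by (simp add: field_simps)
  then obtain \<eta> where \<eta>: "1 - (1 + \<theta>) / (a + 2) < \<eta>" "\<eta> < 1 / (b + 2)"
    using dense by blast
  have 1: "1 - (1 + \<theta>) / (a + 2) \<ge> 0" using assms exponents by (simp add: field_simps)
  have 2: "1 / (b + 2) \<le> 1" using exponents by simp
  have "0 \<le> \<eta>" "\<eta> \<le> 1" using \<eta> 1 2 by linarith+
  then have "integrable lborel (\<lambda>h. indicator (ball 0 1) h * (\<bar>fst h\<bar> powr \<theta> * \<bar>snd h\<bar> powr 0 * vertical_kernel h))"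
    using \<eta> exponents by (intro vertical_kernel_weight_integrable[of \<eta>]) (auto simp: field_simps)
  then show ?thesis
    by (rule Bochner_Integration.integrable_cong_AE[THEN iffD1, rotated 3])
       (use AE_lborel_fst_snd_nonzero in \<open>auto elim!: eventually_mono simp: vertical_kernel_def\<close>)
qed

text \<open>
  A finite first moment of the vertical jumps amounts to \<open>\<beta> < 1\<close>. This makes the uncompensated
  operator well defined on Lipschitz functions.
\<close>

lemma vertical_kernel_snd_integrable:
  "integrable lborel (\<lambda>h. indicator (ball 0 1) h * (\<bar>snd h\<bar> * vertical_kernel h))"
proof -
  have "(a + 1) / (a + 2) < 2 / (b + 2)"
    using ab_small exponents by (simp add: field_simps)
  then obtain \<eta> where \<eta>: "(a + 1) / (a + 2) < \<eta>" "\<eta> < 2 / (b + 2)"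
    using dense by blast
  have 1: "(a + 1) / (a + 2) \<ge> 0" using exponents by (simp add: field_simps)
  have 2: "2 / (b + 2) \<le> 1" using exponents by simp
  have "0 \<le> \<eta>" "\<eta> \<le> 1" using \<eta> 1 2 by linarith+
  then have "integrable lborel (\<lambda>h. indicator (ball 0 1) h * (\<bar>fst h\<bar> powr 0 * \<bar>snd h\<bar> powr 1 * vertical_kernel h))"
    using \<eta> exponents by (intro vertical_kernel_weight_integrable[of \<eta>]) (auto simp: field_simps)
  then show ?thesis
    by (rule Bochner_Integration.integrable_cong_AE[THEN iffD1, rotated 3])
       (use AE_lborel_fst_snd_nonzero in \<open>auto elim!: eventually_mono simp: vertical_kernel_def\<close>)
qed

lemma vertical_kernel_fst_integrable_1:
  "integrable lborel (\<lambda>h. indicator (ball 0 1) h * (\<bar>fst h\<bar> * vertical_kernel h))"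
proof -
  have "integrable lborel (\<lambda>h. indicator (ball 0 1) h * (\<bar>fst h\<bar> powr 1 * vertical_kernel h))"
    using exponents ab_small by (intro vertical_kernel_fst_integrable) (auto simp: field_simps)
  then show ?thesis by simp
qed

lemma vertical_kernel_outside_ball_integrable:
  "integrable lborel (\<lambda>h. (1 - indicator (ball 0 1) h) * vertical_kernel h)"
proof -
  let ?P = "\<lambda>p t::real. indicator {t. 1/2 \<le> \<bar>t\<bar>} t * \<bar>t\<bar> powr (- p)"
  let ?Q = "\<lambda>t::real. indicator {-1/2..1/2} t :: real"
  have P: "integrable lborel (?P p)" if "1 < p" for p
    using integrable_powr_outside[OF that, of "1/2"] by simp
  have Q: "integrable lborel ?Q" by (intro integrable_real_indicator) auto
  have "integrable lborel (\<lambda>h. ?P (a + 2) (fst h) * ?Q (snd h) + ?Q (fst h) * ?P (b + 2) (snd h)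
      + ?P ((a + 2) * (1 - 1/2)) (fst h) * ?P ((b + 2) * (1/2)) (snd h))"
    using exponents by (intro Bochner_Integration.integrable_add integrable_fst_times_snd P Q) auto
  then show ?thesis
  proof (rule Bochner_Integration.integrable_bound)
    show "AE h in lborel. norm ((1 - indicator (ball 0 1) h) * vertical_kernel h) \<le>
      norm (?P (a + 2) (fst h) * ?Q (snd h) + ?Q (fst h) * ?P (b + 2) (snd h)
      + ?P ((a + 2) * (1 - 1/2)) (fst h) * ?P ((b + 2) * (1/2)) (snd h))"
    proof (intro always_eventually allI)
      fix h :: "real \<times> real"
      have n: "norm h \<le> \<bar>fst h\<bar> + \<bar>snd h\<bar>" using norm_Pair_le[of "fst h" "snd h"] by simp
      have d1: "vertical_kernel h \<le> \<bar>fst h\<bar> powr (- (a + 2))" "vertical_kernel h \<le> \<bar>snd h\<bar> powr (- (b + 2))"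
        by (auto simp: vertical_kernel_def)
      have d3: "vertical_kernel h \<le> \<bar>fst h\<bar> powr (- ((a + 2) * (1 - 1/2))) * \<bar>snd h\<bar> powr (- ((b + 2) * (1/2)))"
        by (rule vertical_kernel_interpolation) auto
      show "norm ((1 - indicator (ball 0 1) h) * vertical_kernel h) \<le>
        norm (?P (a + 2) (fst h) * ?Q (snd h) + ?Q (fst h) * ?P (b + 2) (snd h)
        + ?P ((a + 2) * (1 - 1/2)) (fst h) * ?P ((b + 2) * (1/2)) (snd h))"
      proof (cases "h \<in> ball 0 1")
        case False
        then consider "1/2 \<le> \<bar>fst h\<bar>" "\<bar>snd h\<bar> < 1/2" | "\<bar>fst h\<bar> < 1/2" "1/2 \<le> \<bar>snd h\<bar>" | "1/2 \<le> \<bar>fst h\<bar>" "1/2 \<le> \<bar>snd h\<bar>"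
          using n by fastforce
        then show ?thesis
        proof cases
          case 1 then show ?thesis using d1 by (auto simp: indicator_def)
        next
          case 2 then show ?thesis using d1 by (auto simp: indicator_def)
        next
          case 3
          have "vertical_kernel h \<le> ?P ((a + 2) * (1 - 1/2)) (fst h) * ?P ((b + 2) * (1/2)) (snd h)"
            using d3 3 by (simp add: indicator_def)
          moreover have "0 \<le> ?P (a + 2) (fst h) * ?Q (snd h)" "0 \<le> ?Q (fst h) * ?P (b + 2) (snd h)"
            by auto
          ultimately have "vertical_kernel h \<le> ?P (a + 2) (fst h) * ?Q (snd h) + ?Q (fst h) * ?P (b + 2) (snd h)
              + ?P ((a + 2) * (1 - 1/2)) (fst h) * ?P ((b + 2) * (1/2)) (snd h)" by linarith
          then have "vertical_kernel h \<le> norm (?P (a + 2) (fst h) * ?Q (snd h) + ?Q (fst h) * ?P (b + 2) (snd h)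
              + ?P ((a + 2) * (1 - 1/2)) (fst h) * ?P ((b + 2) * (1/2)) (snd h))"
            by (rule order_trans) (simp only: real_norm_def abs_ge_self)
          then show ?thesis using False by (simp only: indicator_simps real_norm_def abs_mult) (simp add: indicator_def)
        qed
      qed auto
    qed
  qed measurable
qed

lemma cross_kernel_le: "h \<in> ball 0 1 \<Longrightarrow> cross_kernel h \<le> vertical_kernel h"
proof -
  assume "h \<in> ball 0 1"
  then have "\<bar>snd h\<bar> < 1" using norm_less_one_coords by blast
  then have "\<bar>snd h\<bar> powr (- (a + 2)) \<le> \<bar>snd h\<bar> powr (- (b + 2))"
    using exponents by (intro powr_mono') auto
  then show ?thesis by (auto simp: vertical_kernel_def cross_kernel_def)
qed

lemma cross_kernel_swap: "cross_kernel (prod.swap h) = cross_kernel h"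
  by (simp add: cross_kernel_def min.commute)

lemma ball_swap: "prod.swap h \<in> ball 0 1 \<longleftrightarrow> (h::real\<times>real) \<in> ball 0 1"
  by (simp add: norm_prod_def add.commute)

lemma cross_kernel_integrable:
  assumes "(a * b + a + b) / (b + 2) < \<theta>" "\<theta> \<le> 1"
  shows "integrable lborel (\<lambda>h. indicator (ball 0 1) h * (\<bar>fst h\<bar> powr \<theta> * cross_kernel h))"
    "integrable lborel (\<lambda>h. indicator (ball 0 1) h * (\<bar>snd h\<bar> powr \<theta> * cross_kernel h))"
proof -
  show *: "integrable lborel (\<lambda>h. indicator (ball 0 1) h * (\<bar>fst h\<bar> powr \<theta> * cross_kernel h))"
  proof (rule Bochner_Integration.integrable_bound[OF vertical_kernel_fst_integrable[OF assms]])
    show "AE h in lborel. norm (indicator (ball 0 1) h * (\<bar>fst h\<bar> powr \<theta> * cross_kernel h))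
      \<le> norm (indicator (ball 0 1) h * (\<bar>fst h\<bar> powr \<theta> * vertical_kernel h))"
      using cross_kernel_le by (intro always_eventually allI) (auto simp: indicator_def abs_mult intro!: mult_left_mono)
  qed measurable
  have "(indicator (ball 0 1) (prod.swap h) :: real) = indicator (ball 0 1) h" for h :: "real \<times> real"
    using ball_swap[of h] by (simp add: indicator_def del: mem_ball)
  with lborel_swap(1)[OF *] show "integrable lborel (\<lambda>h. indicator (ball 0 1) h * (\<bar>snd h\<bar> powr \<theta> * cross_kernel h))"
    by (simp add: cross_kernel_swap)
qed

text \<open>
  The jumps counted here stay in \<open>V\<close> but end at a height below \<open>\<bar>x\<^sub>1\<bar>\<close>, where the vertical section through
  \<open>x\<close> has already left \<open>V\<close>. For a given horizontal displacement \<open>t\<close> the admissible heights form a set of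
  measure at most \<open>2 \<bar>t\<bar>\<close>, which lowers the index of these jumps to \<open>a \<kappa>\<close>.
\<close>

lemma band_integral_bound:
  assumes "a * \<kappa> < \<theta>" "\<theta> \<le> 1"
  obtains C where "0 \<le> C" "\<And>x1 x2 \<delta>. 0 < \<delta> \<Longrightarrow> \<delta> < \<bar>x2\<bar> - \<bar>x1\<bar> \<Longrightarrow>
    (\<integral>\<^sup>+h. ennreal (indicator (ball 0 1) h * indicator {h. \<bar>x1 + fst h\<bar> < \<bar>x2 + snd h\<bar> \<and> \<bar>x2 + snd h\<bar> \<le> \<bar>x1\<bar>} h * vertical_kernel h) \<partial>lborel)
      \<le> ennreal (C * \<delta> powr (- \<theta>))"
proof -
  define \<eta> where "\<eta> = \<theta> / (b + 2)"
  define p where "p = (a + 2) * (1 - \<eta>)"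
  have "0 \<le> a * \<kappa>" using exponents \<kappa>_ge_1 by simp
  then have \<eta>: "0 \<le> \<eta>" "\<eta> \<le> 1" "(b + 2) * \<eta> = \<theta>" using assms exponents by (auto simp: \<eta>_def)
  have "a * (b + 2) < \<theta> * (a + 2)" using assms(1) exponents by (simp add: \<kappa>_def field_simps)
  then have "p - 1 < 1" unfolding p_def \<eta>_def using exponents by (simp add: field_simps)
  note int = integrable_powr_box[OF this]
  define C where "C = 2 * (LINT t|lborel. indicator {- 1<..<1} t * \<bar>t\<bar> powr (- (p - 1)))"
  show ?thesis
  proof
    show "0 \<le> C" unfolding C_def by (intro mult_nonneg_nonneg Bochner_Integration.integral_nonneg) auto
  next
    fix x1 x2 \<delta> :: real assume \<delta>: "0 < \<delta>" "\<delta> < \<bar>x2\<bar> - \<bar>x1\<bar>"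
    let ?S = "{h. \<bar>x1 + fst h\<bar> < \<bar>x2 + snd h\<bar> \<and> \<bar>x2 + snd h\<bar> \<le> \<bar>x1\<bar>}"
    let ?T = "\<lambda>t. {y. \<bar>x1\<bar> - \<bar>t\<bar> < \<bar>x2 + y\<bar> \<and> \<bar>x2 + y\<bar> \<le> \<bar>x1\<bar>}"
    let ?g = "\<lambda>t. indicator {- 1<..<1} t * \<bar>t\<bar> powr (- p) * \<delta> powr (- \<theta>)"
    have "(\<integral>\<^sup>+h. ennreal (indicator (ball 0 1) h * indicator ?S h * vertical_kernel h) \<partial>lborel)
      \<le> (\<integral>\<^sup>+h. ennreal (?g (fst h)) * indicator {h. snd h \<in> ?T (fst h)} h \<partial>lborel)"
    proof (intro nn_integral_mono)
      fix h :: "real \<times> real"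
      show "ennreal (indicator (ball 0 1) h * indicator ?S h * vertical_kernel h) \<le> ennreal (?g (fst h)) * indicator {h. snd h \<in> ?T (fst h)} h"
      proof (cases "h \<in> ball 0 1 \<and> h \<in> ?S")
        case True
        then have "\<bar>fst h\<bar> < 1" using norm_less_one_coords by blast
        have "\<delta> \<le> \<bar>snd h\<bar>" using True \<delta> by auto
        have "vertical_kernel h \<le> \<bar>fst h\<bar> powr (- p) * \<bar>snd h\<bar> powr (- \<theta>)"
          using vertical_kernel_interpolation[OF \<eta>(1,2), of h] by (simp add: p_def \<eta>(3))
        also have "\<dots> \<le> \<bar>fst h\<bar> powr (- p) * \<delta> powr (- \<theta>)"
          using \<delta> \<open>\<delta> \<le> \<bar>snd h\<bar>\<close> assms \<open>0 \<le> a * \<kappa>\<close> by (intro mult_left_mono powr_mono2') auto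
        finally have "vertical_kernel h \<le> \<bar>fst h\<bar> powr (- p) * \<delta> powr (- \<theta>)" .
        moreover have "snd h \<in> ?T (fst h)" using True by auto
        ultimately show ?thesis using True \<open>\<bar>fst h\<bar> < 1\<close>
          by (auto simp: indicator_def intro!: ennreal_leI)
      qed (auto simp: indicator_def)
    qed
    also have "\<dots> = (\<integral>\<^sup>+h. ennreal (?g (fst h)) * indicator {h. snd h \<in> ?T (fst h)} h \<partial>(lborel \<Otimes>\<^sub>M lborel))"
      by (simp only: lborel_prod)
    also have "\<dots> = (\<integral>\<^sup>+t. \<integral>\<^sup>+y. ennreal (?g t) * indicator (?T t) y \<partial>lborel \<partial>lborel)"
      by (subst lborel.nn_integral_fst[symmetric]) (auto simp: indicator_def)
    also have "\<dots> = (\<integral>\<^sup>+t. ennreal (?g t) * emeasure lborel (?T t) \<partial>lborel)"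
      by (intro nn_integral_cong) (simp add: nn_integral_cmult_indicator)
    also have "\<dots> \<le> (\<integral>\<^sup>+t. ennreal (?g t) * ennreal (2 * \<bar>t\<bar>) \<partial>lborel)"
      by (intro nn_integral_mono mult_left_mono emeasure_band) auto
    also have "\<dots> = (\<integral>\<^sup>+t. ennreal (2 * \<delta> powr (- \<theta>) * (indicator {- 1<..<1} t * \<bar>t\<bar> powr (- (p - 1)))) \<partial>lborel)"
    proof (intro nn_integral_cong)
      fix t :: real
      have "\<bar>t\<bar> * \<bar>t\<bar> powr (- p) = \<bar>t\<bar> powr (- (p - 1))" using powr_mult_base[of "\<bar>t\<bar>" "- p"] by simp
      then have "?g t * (2 * \<bar>t\<bar>) = 2 * \<delta> powr (- \<theta>) * (indicator {- 1<..<1} t * \<bar>t\<bar> powr (- (p - 1)))"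
        by (simp only: flip: \<open>\<bar>t\<bar> * \<bar>t\<bar> powr (- p) = _\<close>) (simp only: mult_ac)
      then show "ennreal (?g t) * ennreal (2 * \<bar>t\<bar>) = ennreal (2 * \<delta> powr (- \<theta>) * (indicator {- 1<..<1} t * \<bar>t\<bar> powr (- (p - 1))))"
        by (subst ennreal_mult'[symmetric]) auto
    qed
    also have "\<dots> = ennreal (LINT t|lborel. 2 * \<delta> powr (- \<theta>) * (indicator {- 1<..<1} t * \<bar>t\<bar> powr (- (p - 1))))"
      by (intro nn_integral_eq_integral integrable_mult_right int) auto
    also have "\<dots> = ennreal (C * \<delta> powr (- \<theta>))" by (simp add: C_def mult_ac)
    finally show "(\<integral>\<^sup>+h. ennreal (indicator (ball 0 1) h * indicator ?S h * vertical_kernel h) \<partial>lborel) \<le> ennreal (C * \<delta> powr (- \<theta>))" .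
  qed
qed

end

section \<open>The barrier as an almost subharmonic function\<close>

context jump_exponents
begin

text \<open>
  The increment of the barrier in a vertical jump of size \<open>t\<close>, restricted to jumps that stay in the
  vertical section of \<open>V\<close> through \<open>x\<close>.
\<close>

definition vertical_gain :: "real \<Rightarrow> real \<Rightarrow> real \<Rightarrow> real \<Rightarrow> real" where
  "vertical_gain \<delta> x1 x2 t = indicator {t. \<bar>x1\<bar> < \<bar>x2 + t\<bar>} t *
     (barrier \<beta> \<delta> (\<bar>x2 + t\<bar> - \<bar>x1\<bar>) - barrier \<beta> \<delta> (\<bar>x2\<bar> - \<bar>x1\<bar>))"

lemma vertical_gain_measurable [measurable]: "vertical_gain \<delta> x1 x2 \<in> borel_measurable borel"
  unfolding vertical_gain_def[abs_def] by measurable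

lemma vertical_gain_bound:
  assumes "0 < \<delta>"
  shows "\<bar>vertical_gain \<delta> x1 x2 t\<bar> \<le> min 1 (\<bar>t\<bar> / \<delta>)"
proof -
  have "\<bar>(\<bar>x2 + t\<bar> - \<bar>x1\<bar>) - (\<bar>x2\<bar> - \<bar>x1\<bar>)\<bar> / \<delta> \<le> \<bar>t\<bar> / \<delta>"
    using assms by (intro divide_right_mono) auto
  then show ?thesis
    using barrier_diff_bound[OF \<beta>_bounds assms, of "\<bar>x2 + t\<bar> - \<bar>x1\<bar>" "\<bar>x2\<bar> - \<bar>x1\<bar>"] assms
    by (auto simp: vertical_gain_def indicator_def)
qed

lemma vertical_gain_integrable:
  assumes "0 < \<delta>"
  shows "integrable lborel (\<lambda>t. vertical_gain \<delta> x1 x2 t * \<bar>t\<bar> powr (- 1 - \<beta>))"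
proof (rule Bochner_Integration.integrable_bound[OF integrable_min_powr[OF \<beta>_bounds assms]])
  show "AE t in lborel. norm (vertical_gain \<delta> x1 x2 t * \<bar>t\<bar> powr (- 1 - \<beta>)) \<le> norm (min 1 (\<bar>t\<bar> / \<delta>) * \<bar>t\<bar> powr (- 1 - \<beta>))"
    using vertical_gain_bound[OF assms] assms
    by (intro always_eventually allI) (auto simp: abs_mult intro!: mult_right_mono)
qed measurable

text \<open>
  The section of \<open>V\<close> through \<open>x\<close> consists of two half-lines; on each of them the barrier is a function of
  the distance to the end point, which reduces the claim to the two half-line inequalities.
\<close>

lemma vertical_gain_integral_pos:
  assumes \<delta>: "0 < \<delta>" "\<delta> < x2 - \<bar>x1\<bar>"
  shows "0 \<le> (LINT t|lborel. vertical_gain \<delta> x1 x2 t * \<bar>t\<bar> powr (- 1 - \<beta>))"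
proof -
  define d e where "d = x2 - \<bar>x1\<bar>" and "e = x2 + \<bar>x1\<bar>"
  have de: "\<delta> < d" "d \<le> e" "0 < d" "0 < e" using \<delta> by (auto simp: d_def e_def)
  let ?B = "barrier \<beta> \<delta>"
  let ?f1 = "\<lambda>t. indicator {- d<..} t * ((?B (d + t) - ?B d) * \<bar>t\<bar> powr (- 1 - \<beta>))"
  let ?f2 = "\<lambda>t. indicator {..<- e} t * ((?B (- t - e) - ?B d) * \<bar>t\<bar> powr (- 1 - \<beta>))"
  have eq: "vertical_gain \<delta> x1 x2 t * \<bar>t\<bar> powr (- 1 - \<beta>) = ?f1 t + ?f2 t" for t
  proof -
    consider "- d < t" | "t < - e" | "t \<le> - d" "- e \<le> t" by linarith
    then show ?thesis
    proof cases
      case 1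
      then have "\<bar>x2 + t\<bar> - \<bar>x1\<bar> = d + t" "\<bar>x1\<bar> < \<bar>x2 + t\<bar>" "\<not> t < - e" "\<bar>x2\<bar> - \<bar>x1\<bar> = d"
        using de by (auto simp: d_def e_def)
      then show ?thesis using 1 by (simp add: vertical_gain_def)
    next
      case 2
      then have *: "\<bar>x2 + t\<bar> - \<bar>x1\<bar> = - t - e" "\<bar>x2\<bar> - \<bar>x1\<bar> = d" and "\<bar>x1\<bar> < \<bar>x2 + t\<bar>" "\<not> - d < t"
        using de by (auto simp: d_def e_def)
      then show ?thesis unfolding vertical_gain_def * using 2 by simp
    next
      case 3
      then have "\<not> \<bar>x1\<bar> < \<bar>x2 + t\<bar>" "\<not> - d < t" "\<not> t < - e"
        using de by (auto simp: d_def e_def)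
      then show ?thesis by (simp add: vertical_gain_def)
    qed
  qed
  have g1: "?f1 (- d + 1 * s) = indicator {0<..} s *\<^sub>R ((?B s - ?B d) * \<bar>s - d\<bar> powr (- 1 - \<beta>))" for s
    by (auto simp: indicator_def)
  have g2: "?f2 (- e + (- 1) * s) = indicator {0<..} s *\<^sub>R ((?B s - ?B d) * (s + e) powr (- 1 - \<beta>))" for s
    using de by (auto simp: indicator_def abs_if add.commute)
  have "integrable lborel (\<lambda>s. indicator {0<..} s *\<^sub>R ((?B s - ?B d) * \<bar>s - d\<bar> powr (- 1 - \<beta>)))"
    by (intro integrable_mult_indicator barrier_integrable \<beta>_bounds \<delta>) auto
  then have i1: "integrable lborel ?f1"
    unfolding g1[symmetric] by (subst (asm) lborel_integrable_real_affine_iff) auto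
  have "integrable lborel (\<lambda>s. indicator {0<..} s *\<^sub>R ((?B s - ?B d) * (s + e) powr (- 1 - \<beta>)))"
    using barrier_other_component(1)[OF \<beta>_bounds \<delta>(1) de(1,2)] unfolding set_integrable_def .
  then have i2: "integrable lborel ?f2"
    unfolding g2[symmetric] by (subst (asm) lborel_integrable_real_affine_iff) auto
  have "(LINT t|lborel. ?f1 t) = (LINT s:{0<..}|lborel. (?B s - ?B d) * \<bar>s - d\<bar> powr (- 1 - \<beta>))"
    unfolding set_lebesgue_integral_def g1[symmetric]
    by (subst lborel_integral_real_affine[of 1 _ "- d"]) auto
  then have p1: "0 \<le> (LINT t|lborel. ?f1 t)"
    using barrier_same_component[OF \<beta>_bounds \<delta>(1) de(1)] by simp
  have "(LINT t|lborel. ?f2 t) = (LINT s:{0<..}|lborel. (?B s - ?B d) * (s + e) powr (- 1 - \<beta>))"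
    unfolding set_lebesgue_integral_def g2[symmetric]
    by (subst lborel_integral_real_affine[of "-1" _ "- e"]) auto
  then have p2: "0 \<le> (LINT t|lborel. ?f2 t)"
    using barrier_other_component(2)[OF \<beta>_bounds \<delta>(1) de(1,2)] by simp
  show ?thesis unfolding eq using i1 i2 p1 p2 by simp
qed

lemma vertical_gain_integral:
  assumes \<delta>: "0 < \<delta>" "\<delta> < \<bar>x2\<bar> - \<bar>x1\<bar>"
  shows "0 \<le> (LINT t|lborel. vertical_gain \<delta> x1 x2 t * \<bar>t\<bar> powr (- 1 - \<beta>))"
proof (cases "0 < x2")
  case True
  then show ?thesis using vertical_gain_integral_pos[of \<delta> x2 x1] \<delta> by simp
next
  case False
  have "vertical_gain \<delta> x1 x2 (0 + -1 * t) = vertical_gain \<delta> x1 (- x2) t" for t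
  proof -
    have "\<bar>x2 - t\<bar> = \<bar>- x2 + t\<bar>" by simp
    then show ?thesis by (simp add: vertical_gain_def indicator_def)
  qed
  then have "(LINT t|lborel. vertical_gain \<delta> x1 x2 t * \<bar>t\<bar> powr (- 1 - \<beta>)) =
      (LINT t|lborel. vertical_gain \<delta> x1 (- x2) t * \<bar>t\<bar> powr (- 1 - \<beta>))"
    by (subst lborel_integral_real_affine[of "-1" _ 0]) auto
  then show ?thesis using vertical_gain_integral_pos[of \<delta> "- x2" x1] \<delta> False by simp
qed

lemma vertical_gain_kernel:
  assumes \<delta>: "0 < \<delta>" "\<delta> < \<bar>x2\<bar> - \<bar>x1\<bar>"
  shows "integrable lborel (\<lambda>h. vertical_gain \<delta> x1 x2 (snd h) * vertical_kernel h)"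
    "0 \<le> (LINT h|lborel. vertical_gain \<delta> x1 x2 (snd h) * vertical_kernel h)"
  using vertical_kernel_integrate_out_fst[OF _ vertical_gain_integrable[OF \<delta>(1), of x1 x2]]
    vertical_gain_integral[OF \<delta>] profile_mass_nonneg by auto

text \<open>
  What the estimates need to know about the jump density \<open>j\<close> out of the point \<open>x\<close>. Working with an abstract
  \<open>j\<close> covers starting points in \<open>V\<close> and, after the swap, starting points outside \<open>V\<close>.
\<close>

definition admissible :: "real \<times> real \<Rightarrow> (real \<times> real \<Rightarrow> real) \<Rightarrow> bool" where
  "admissible x j \<longleftrightarrow> j \<in> borel_measurable borel \<and> \<bar>fst x\<bar> \<le> \<bar>snd x\<bar> \<and> (AE h in lborel. 0 \<le> j h \<and>
     (if x + h \<in> V then j h = indicator (ball 0 1) h * vertical_kernel h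
      else j h \<le> indicator (ball 0 1) h * cross_kernel h))"

definition gap :: "real \<times> real \<Rightarrow> real" where "gap x = \<bar>snd x\<bar> - \<bar>fst x\<bar>"

lemma gap_measurable [measurable]: "gap \<in> borel_measurable borel"
  unfolding gap_def[abs_def] by measurable

lemma V_iff_gap: "x \<in> V \<longleftrightarrow> 0 < gap x"
  by (auto simp: V_def gap_def)

lemma gap_diff: "\<bar>gap (x + h) - gap x\<bar> \<le> \<bar>fst h\<bar> + \<bar>snd h\<bar>"
  unfolding gap_def fst_add snd_add by arith

lemma admissible_le:
  assumes "admissible x j"
  shows "AE h in lborel. 0 \<le> j h \<and> j h \<le> indicator (ball 0 1) h * vertical_kernel h"
proof -
  have "AE h in lborel. 0 \<le> j h \<and> (if x + h \<in> V then j h = indicator (ball 0 1) h * vertical_kernel h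
      else j h \<le> indicator (ball 0 1) h * cross_kernel h)"
    using assms by (auto simp: admissible_def)
  then show ?thesis
  proof eventually_elim
    case (elim h)
    then show ?case
      using cross_kernel_le[of h] by (cases "x + h \<in> V"; cases "h \<in> ball 0 1") (auto simp: indicator_def simp del: mem_ball)
  qed
qed

lemma vertical_kernel_l1_integrable:
  "integrable lborel (\<lambda>h. indicator (ball 0 1) h * ((\<bar>fst h\<bar> + \<bar>snd h\<bar>) * vertical_kernel h))"
  using Bochner_Integration.integrable_add[OF vertical_kernel_fst_integrable_1 vertical_kernel_snd_integrable]
  by (simp add: algebra_simps)

lemma admissible_integrable:
  assumes j: "admissible x j" and \<delta>: "0 < \<delta>"
  shows "integrable lborel (\<lambda>h. (barrier \<beta> \<delta> (gap (x + h)) - barrier \<beta> \<delta> (gap x)) * j h)"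
proof (rule Bochner_Integration.integrable_bound)
  show "integrable lborel (\<lambda>h. (indicator (ball 0 1) h * ((\<bar>fst h\<bar> + \<bar>snd h\<bar>) * vertical_kernel h)) / \<delta>)"
    using vertical_kernel_l1_integrable by auto
  have [measurable]: "j \<in> borel_measurable borel" using j by (simp add: admissible_def)
  show "(\<lambda>h. (barrier \<beta> \<delta> (gap (x + h)) - barrier \<beta> \<delta> (gap x)) * j h) \<in> borel_measurable lborel"
    by measurable
  show "AE h in lborel. norm ((barrier \<beta> \<delta> (gap (x + h)) - barrier \<beta> \<delta> (gap x)) * j h) \<le>
     norm (indicator (ball 0 1) h * ((\<bar>fst h\<bar> + \<bar>snd h\<bar>) * vertical_kernel h) / \<delta>)"
    using admissible_le[OF j]
  proof eventually_elim
    case (elim h)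
    have "\<bar>barrier \<beta> \<delta> (gap (x + h)) - barrier \<beta> \<delta> (gap x)\<bar> \<le> (\<bar>fst h\<bar> + \<bar>snd h\<bar>) / \<delta>"
      using barrier_lipschitz[OF \<beta>_bounds \<delta>, of "gap (x + h)" "gap x"] gap_diff[of x h] \<delta>
      by (meson divide_right_mono less_eq_real_def order_trans)
    then have "\<bar>barrier \<beta> \<delta> (gap (x + h)) - barrier \<beta> \<delta> (gap x)\<bar> * j h \<le> (\<bar>fst h\<bar> + \<bar>snd h\<bar>) / \<delta> * (indicator (ball 0 1) h * vertical_kernel h)"
      using elim by (intro mult_mono) auto
    then show ?case using elim \<delta> by (simp add: abs_mult mult_ac)
  qed
qed

end

lemma min_one_le_powr:
  fixes u \<theta> :: real
  assumes "0 \<le> u" "0 \<le> \<theta>" "\<theta> \<le> 1"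
  shows "min 1 u \<le> u powr \<theta>"
proof (cases "1 \<le> u")
  case True
  then show ?thesis using assms by (simp add: ge_one_powr_ge_zero min.coboundedI1)
next
  case False
  then show ?thesis using powr_mono'[of \<theta> 1 u] assms by auto
qed

context jump_exponents
begin

lemma crossing_weight:
  fixes \<delta> \<theta> :: real and h :: "real \<times> real"
  assumes "0 < \<delta>" "\<delta> \<le> \<bar>fst h\<bar> + \<bar>snd h\<bar>" "0 \<le> \<theta>" "\<theta> \<le> 1"
  shows "1 \<le> 2 * \<delta> powr (- \<theta>) * (\<bar>fst h\<bar> powr \<theta> + \<bar>snd h\<bar> powr \<theta>)"
proof -
  have half: "1 / 2 \<le> \<delta> powr (- \<theta>) * u powr \<theta>" if "\<delta> / 2 \<le> u" for u
  proof -
    have "(1 / 2) powr 1 \<le> (1 / 2 :: real) powr \<theta>" using assms by (intro powr_mono') auto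
    also have "\<dots> \<le> (u / \<delta>) powr \<theta>" using that assms by (intro powr_mono2) (auto simp: field_simps)
    also have "\<dots> = \<delta> powr (- \<theta>) * u powr \<theta>" using that assms by (simp add: powr_divide powr_minus field_simps)
    finally show ?thesis by simp
  qed
  have nn: "0 \<le> \<delta> powr (- \<theta>) * \<bar>fst h\<bar> powr \<theta>" "0 \<le> \<delta> powr (- \<theta>) * \<bar>snd h\<bar> powr \<theta>" by auto
  consider "\<delta> / 2 \<le> \<bar>fst h\<bar>" | "\<delta> / 2 \<le> \<bar>snd h\<bar>" using assms by linarith
  then have "1 / 2 \<le> \<delta> powr (- \<theta>) * \<bar>fst h\<bar> powr \<theta> + \<delta> powr (- \<theta>) * \<bar>snd h\<bar> powr \<theta>"
    using nn half[of "\<bar>fst h\<bar>"] half[of "\<bar>snd h\<bar>"] by cases linarith+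
  then show ?thesis by (simp add: algebra_simps)
qed

text \<open>
  The increment of the barrier is compared with its increment along the vertical line through \<open>x\<close>, whose
  integral against the full kernel is nonnegative. Four errors remain: the part of the
  kernel outside the unit ball, the horizontal displacement (the barrier is \<open>1/\<delta>\<close>-Lipschitz), the jumps
  of \<open>band_integral_bound\<close>, and the jumps out of \<open>V\<close>, which cover at least the distance \<open>\<delta>\<close>. The
  first error is bounded, and the indices of the other jumps lie below \<open>\<theta>\<close>.
\<close>

lemma drift_lower_bound:
  assumes \<theta>: "(a * b + a + b) / (b + 2) < \<theta>" "a * \<kappa> < \<theta>" "\<theta> \<le> 1"
  obtains C where "0 \<le> C"
    "\<And>\<delta> x j. 0 < \<delta> \<Longrightarrow> \<delta> \<le> 1 \<Longrightarrow> admissible x j \<Longrightarrow>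
      - C * \<delta> powr (- \<theta>) \<le> (LINT h|lborel. (barrier \<beta> \<delta> (gap (x + h)) - barrier \<beta> \<delta> (gap x)) * j h)"
proof -
  obtain Cb where Cb: "0 \<le> Cb" "\<And>x1 x2 \<delta>. 0 < \<delta> \<Longrightarrow> \<delta> < \<bar>x2\<bar> - \<bar>x1\<bar> \<Longrightarrow>
    (\<integral>\<^sup>+h. ennreal (indicator (ball 0 1) h * indicator {h. \<bar>x1 + fst h\<bar> < \<bar>x2 + snd h\<bar> \<and> \<bar>x2 + snd h\<bar> \<le> \<bar>x1\<bar>} h * vertical_kernel h) \<partial>lborel)
      \<le> ennreal (Cb * \<delta> powr (- \<theta>))"
    using band_integral_bound[OF \<theta>(2,3)] by blast
  have "0 \<le> a * \<kappa>" using exponents \<kappa>_ge_1 by simp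
  then have \<theta>0: "0 \<le> \<theta>" using \<theta> by linarith
  let ?h1 = "\<lambda>h. indicator (ball 0 1) h * (\<bar>fst h\<bar> powr \<theta> * vertical_kernel h)"
  let ?c1 = "\<lambda>h. indicator (ball 0 1) h * (\<bar>fst h\<bar> powr \<theta> * cross_kernel h)"
  let ?c2 = "\<lambda>h. indicator (ball 0 1) h * (\<bar>snd h\<bar> powr \<theta> * cross_kernel h)"
  let ?o = "\<lambda>h. (1 - indicator (ball 0 1) h) * vertical_kernel h"
  note ih1 = vertical_kernel_fst_integrable[OF \<theta>(1,3)]
  note ic = cross_kernel_integrable[OF \<theta>(1,3)]
  note io = vertical_kernel_outside_ball_integrable
  have nonneg: "0 \<le> integral\<^sup>L lborel ?h1" "0 \<le> integral\<^sup>L lborel ?c1" "0 \<le> integral\<^sup>L lborel ?c2" "0 \<le> integral\<^sup>L lborel ?o"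
    by (intro Bochner_Integration.integral_nonneg mult_nonneg_nonneg; simp add: indicator_def)+
  define C where "C = integral\<^sup>L lborel ?o + integral\<^sup>L lborel ?h1 + Cb + 2 * (integral\<^sup>L lborel ?c1 + integral\<^sup>L lborel ?c2)"
  have C0: "0 \<le> C" using nonneg Cb by (simp add: C_def)
  show ?thesis
  proof
    show "0 \<le> C" by (rule C0)
  next
    fix \<delta> :: real and x j assume \<delta>: "0 < \<delta>" "\<delta> \<le> 1" and j: "admissible x j"
    let ?G = "\<lambda>h. (barrier \<beta> \<delta> (gap (x + h)) - barrier \<beta> \<delta> (gap x)) * j h"
    show "- C * \<delta> powr (- \<theta>) \<le> integral\<^sup>L lborel ?G"
    proof (cases "gap x \<le> \<delta>")
      case True
      then have "barrier \<beta> \<delta> (gap x) = 0" by (simp add: barrier_def)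
      then have "0 \<le> integral\<^sup>L lborel ?G"
        using admissible_le[OF j] barrier_bounds[OF \<beta>_bounds \<delta>(1)]
        by (intro integral_nonneg_AE) (auto elim!: eventually_mono)
      moreover have "- C * \<delta> powr (- \<theta>) \<le> 0" using C0 by simp
      ultimately show ?thesis by linarith
    next
      case False
      define x1 x2 where "x1 = fst x" and "x2 = snd x"
      have gx: "\<delta> < \<bar>x2\<bar> - \<bar>x1\<bar>" using False by (simp add: gap_def x1_def x2_def)
      let ?S = "{h. \<bar>x1 + fst h\<bar> < \<bar>x2 + snd h\<bar> \<and> \<bar>x2 + snd h\<bar> \<le> \<bar>x1\<bar>}"
      let ?s = "\<lambda>h. indicator (ball 0 1) h * indicator ?S h * vertical_kernel h"
      let ?vg = "\<lambda>h. vertical_gain \<delta> x1 x2 (snd h) * vertical_kernel h"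
      note vg = vertical_gain_kernel[OF \<delta>(1) gx]
      have iS: "integrable lborel ?s"
      proof (rule integrableI_nonneg)
        have "{h \<in> space borel. h \<in> ?S} \<in> sets borel" by measurable
        then have [measurable]: "?S \<in> sets borel" by simp
        show "?s \<in> borel_measurable lborel" by measurable
        show "AE h in lborel. 0 \<le> ?s h" by simp
        show "(\<integral>\<^sup>+h. ennreal (?s h) \<partial>lborel) < \<infinity>"
          using Cb(2)[OF \<delta>(1) gx] by (simp add: le_less_trans[OF _ ennreal_less_top])
      qed
      have bs: "integral\<^sup>L lborel ?s \<le> Cb * \<delta> powr (- \<theta>)"
        using Cb(1) by (intro integral_real_bounded Cb(2)[OF \<delta>(1) gx]) auto
      let ?L = "\<lambda>h. ?vg h - ?o h - \<delta> powr (- \<theta>) * ?h1 h - ?s h - 2 * \<delta> powr (- \<theta>) * (?c1 h + ?c2 h)"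
      have iL: "integrable lborel ?L"
        by (intro Bochner_Integration.integrable_diff Bochner_Integration.integrable_add integrable_mult_right vg io ih1 iS ic)
      have "AE h in lborel. ?L h \<le> ?G h"
      proof -
        have "AE h in lborel. 0 \<le> j h \<and> (if x + h \<in> V then j h = indicator (ball 0 1) h * vertical_kernel h
            else j h \<le> indicator (ball 0 1) h * cross_kernel h)"
          using j by (simp add: admissible_def)
        then show ?thesis
        proof eventually_elim
          case (elim h)
          define Y X K where "Y = barrier \<beta> \<delta> (gap (x + h))" and "X = barrier \<beta> \<delta> (gap x)" and "K = vertical_kernel h"
          define v where "v = vertical_gain \<delta> x1 x2 (snd h)"
          define CR where "CR = 2 * \<delta> powr (- \<theta>) * (\<bar>fst h\<bar> powr \<theta> + \<bar>snd h\<bar> powr \<theta>) * cross_kernel h"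
          define hz where "hz = \<delta> powr (- \<theta>) * \<bar>fst h\<bar> powr \<theta>"
          have K: "0 \<le> K" and hz: "0 \<le> hz" by (auto simp: K_def hz_def)
          have X: "0 \<le> X" "X \<le> 1" and Y: "0 \<le> Y" "Y \<le> 1"
            using barrier_bounds[OF \<beta>_bounds \<delta>(1)] by (auto simp: X_def Y_def)
          have v1: "\<bar>v\<bar> \<le> 1" using vertical_gain_bound[OF \<delta>(1), of x1 x2 "snd h"] by (simp add: v_def)
          show "?L h \<le> ?G h"
          proof (cases "h \<in> ball 0 1")
            case False
            then have "j h = 0" using elim by (auto simp: indicator_def split: if_splits)
            moreover have "v * K \<le> K" using mult_right_mono[of v 1 K] v1 K by simp
            ultimately show ?thesis using False by (simp add: v_def K_def)
          next
            case True
            \<comment> \<open>The horizontal displacement costs at most \<open>hz\<close> on top of the vertical increment.\<close>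
            have main: "v - hz \<le> Y - X" if "\<bar>x1\<bar> < \<bar>x2 + snd h\<bar>"
            proof -
              define Z where "Z = barrier \<beta> \<delta> (\<bar>x2 + snd h\<bar> - \<bar>x1\<bar>)"
              have "\<bar>Z - Y\<bar> \<le> min 1 (\<bar>\<bar>x2 + snd h\<bar> - \<bar>x1\<bar> - gap (x + h)\<bar> / \<delta>)"
                unfolding Z_def Y_def by (rule barrier_diff_bound[OF \<beta>_bounds \<delta>(1)])
              also have "\<dots> \<le> min 1 (\<bar>fst h\<bar> / \<delta>)"
                using \<delta> by (intro min.mono divide_right_mono) (auto simp: gap_def x1_def x2_def)
              also have "\<dots> \<le> (\<bar>fst h\<bar> / \<delta>) powr \<theta>"
                using \<delta> \<theta> \<theta>0 by (intro min_one_le_powr) auto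
              also have "\<dots> = hz" using \<delta> by (simp add: hz_def powr_divide powr_minus field_simps)
              finally have "\<bar>Z - Y\<bar> \<le> hz" .
              moreover have "v = Z - X"
                using that by (simp add: v_def vertical_gain_def Z_def X_def gap_def x1_def x2_def)
              ultimately show ?thesis by linarith
            qed
            have v0: "v = 0" if "\<not> \<bar>x1\<bar> < \<bar>x2 + snd h\<bar>" using that by (simp add: v_def vertical_gain_def)
            have "v * K - hz * K - indicator ?S h * K - CR \<le> (Y - X) * j h"
            proof (cases "x + h \<in> V")
              case inV: True
              have cr: "0 \<le> CR" by (simp add: CR_def)
              have jK: "j h = K" using elim inV True by (simp add: K_def)
              show ?thesis
              proof (cases "\<bar>x1\<bar> < \<bar>x2 + snd h\<bar>")
                case t: True
                have "(v - hz) * K \<le> (Y - X) * K" using main[OF t] K by (rule mult_right_mono)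
                moreover have "0 \<le> indicator ?S h * K" using K by auto
                ultimately show ?thesis using cr unfolding jK left_diff_distrib[of v hz K] by linarith
              next
                case f: False
                have "h \<in> ?S" using inV f by (auto simp: V_iff_gap gap_def x1_def x2_def)
                moreover have "(- 1) * K \<le> (Y - X) * K" using X Y K by (intro mult_right_mono) auto
                moreover have "0 \<le> hz * K" using hz K by simp
                ultimately show ?thesis using cr unfolding jK v0[OF f] by simp
              qed
            next
              case notV: False
              then have gy: "gap (x + h) \<le> 0" by (simp add: V_iff_gap)
              then have Y0: "Y = 0" using \<delta> by (simp add: Y_def barrier_def)
              have "\<delta> \<le> \<bar>fst h\<bar> + \<bar>snd h\<bar>" using gap_diff[of x h] gy False by linarith
              then have "1 \<le> 2 * \<delta> powr (- \<theta>) * (\<bar>fst h\<bar> powr \<theta> + \<bar>snd h\<bar> powr \<theta>)"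
                using crossing_weight[of \<delta> h \<theta>] \<delta> \<theta> \<theta>0 by simp
              then have c: "1 * cross_kernel h \<le> CR"
                unfolding CR_def by (intro mult_right_mono) auto
              have "X * j h \<le> 1 * j h" using X elim by (intro mult_right_mono) auto
              also have "\<dots> \<le> cross_kernel h" using elim notV True by (simp add: indicator_def split: if_splits)
              finally have Xj: "X * j h \<le> cross_kernel h" .
              \<comment> \<open>Off \<open>V\<close> the barrier has dropped to \<open>0\<close>, so the vertical increment is itself at most \<open>hz\<close>.\<close>
              have "v * K - hz * K \<le> 0"
              proof (cases "\<bar>x1\<bar> < \<bar>x2 + snd h\<bar>")
                case True
                then have "v - hz \<le> 0" using main X Y0 by force
                then show ?thesis using K by (simp add: left_diff_distrib[symmetric] mult_nonpos_nonneg)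
              qed (use v0 hz K in auto)
              moreover have "0 \<le> indicator ?S h * K" using K by auto
              ultimately show ?thesis using c Xj Y0 by simp
            qed
            then show ?thesis using True by (simp add: v_def K_def hz_def X_def Y_def CR_def algebra_simps)
          qed
        qed
      qed
      then have "integral\<^sup>L lborel ?L \<le> integral\<^sup>L lborel ?G"
        by (rule integral_mono_AE[OF iL admissible_integrable[OF j \<delta>(1)]])
      moreover have "integral\<^sup>L lborel ?L = integral\<^sup>L lborel ?vg - integral\<^sup>L lborel ?o - \<delta> powr (- \<theta>) * integral\<^sup>L lborel ?h1
          - integral\<^sup>L lborel ?s - 2 * \<delta> powr (- \<theta>) * (integral\<^sup>L lborel ?c1 + integral\<^sup>L lborel ?c2)"
        using vg(1) io ih1 iS ic
        by (simp only: Bochner_Integration.integral_diff Bochner_Integration.integral_add Bochner_Integration.integrable_diff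
            Bochner_Integration.integrable_add integrable_mult_right integral_mult_right_zero)
      moreover have "integral\<^sup>L lborel ?o \<le> \<delta> powr (- \<theta>) * integral\<^sup>L lborel ?o"
      proof -
        have "1 \<le> \<delta> powr (- \<theta>)" using \<delta> \<theta>0 by (simp add: powr_minus powr_le1 one_le_inverse)
        then show ?thesis using mult_right_mono[of 1 "\<delta> powr (- \<theta>)" "integral\<^sup>L lborel ?o"] nonneg by simp
      qed
      ultimately show ?thesis using vg(2) bs by (simp add: C_def algebra_simps)
    qed
  qed
qed

text \<open>
  Where the barrier vanishes, every jump is a gain. Vertical jumps of size between \<open>3 \<delta>\<close> and \<open>4 \<delta>\<close>
  away from the horizontal axis, with horizontal displacement up to \<open>\<delta>\<^sup>\<kappa> \<le> \<delta>\<close>, end at a point with \<open>w \<ge> 2 \<delta>\<close>, and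
  their rate is of order \<open>\<delta>\<^sup>-\<^sup>\<beta>\<close>.
\<close>

lemma strip_lower_bound:
  obtains c where "0 < c"
    "\<And>\<delta> x j. 0 < \<delta> \<Longrightarrow> \<delta> \<le> 1/8 \<Longrightarrow> admissible x j \<Longrightarrow> gap x \<le> \<delta> \<Longrightarrow>
      c * \<delta> powr (- \<beta>) \<le> (LINT h|lborel. (barrier \<beta> \<delta> (gap (x + h)) - barrier \<beta> \<delta> (gap x)) * j h)"
proof -
  define g where "g = 1 - (1/2::real) powr (1 - \<beta>)"
  have g: "0 < g" using powr_less_mono2[of "1 - \<beta>" "1/2" 1] \<beta>_bounds by (simp add: g_def)
  define c where "c = g * 4 powr (- (b + 2)) * 2"
  show ?thesis
  proof
    show "0 < c" using g by (simp add: c_def)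
  next
    fix \<delta> :: real and x j assume \<delta>: "0 < \<delta>" "\<delta> \<le> 1/8" and j: "admissible x j" and gx: "gap x \<le> \<delta>"
    let ?G = "\<lambda>h. (barrier \<beta> \<delta> (gap (x + h)) - barrier \<beta> \<delta> (gap x)) * j h"
    \<comment> \<open>Jumps away from the horizontal axis: upwards if \<open>x\<^sub>2 \<ge> 0\<close>, downwards otherwise.\<close>
    define I2 where "I2 = (if 0 \<le> snd x then {3 * \<delta> .. 4 * \<delta>} else {- (4 * \<delta>) .. - (3 * \<delta>)})"
    define Q where "Q = {- (\<delta> powr \<kappa>) .. \<delta> powr \<kappa>} \<times> I2"
    have I2: "emeasure lborel I2 = ennreal \<delta>" "I2 \<in> sets borel" using \<delta> by (auto simp: I2_def)
    have "emeasure (lborel \<Otimes>\<^sub>M lborel) Q = emeasure lborel {- (\<delta> powr \<kappa>) .. \<delta> powr \<kappa>} * emeasure lborel I2"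
      unfolding Q_def using I2 by (intro lborel.emeasure_pair_measure_Times) auto
    then have eQ: "emeasure lborel Q = ennreal (2 * \<delta> powr \<kappa> * \<delta>)"
      using I2 \<delta> by (simp add: lborel_prod ennreal_mult')
    have Qs: "Q \<in> sets lborel"
      unfolding lborel_prod[symmetric] Q_def using I2 by (intro pair_measureI) auto
    let ?k = "g * (4 * \<delta>) powr (- (b + 2))"
    have "AE h in lborel. ?k * indicator Q h \<le> ?G h"
    proof -
      have "AE h in lborel. 0 \<le> j h \<and> (if x + h \<in> V then j h = indicator (ball 0 1) h * vertical_kernel h
          else j h \<le> indicator (ball 0 1) h * cross_kernel h)"
        using j by (simp add: admissible_def)
      with AE_lborel_fst_snd_nonzero show ?thesis
      proof eventually_elim
        case (elim h)
        have X0: "barrier \<beta> \<delta> (gap x) = 0" using gx by (simp add: barrier_def)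
        show "?k * indicator Q h \<le> ?G h"
        proof (cases "h \<in> Q")
          case True
          have h1: "\<bar>fst h\<bar> \<le> \<delta> powr \<kappa>" using True by (auto simp: Q_def abs_le_iff)
          have "\<delta> powr \<kappa> \<le> \<delta> powr 1" using \<delta> \<kappa>_ge_1 by (intro powr_mono') auto
          then have h1': "\<bar>fst h\<bar> \<le> \<delta>" using h1 \<delta> by simp
          have h2: "\<bar>snd h\<bar> \<le> 4 * \<delta>" "3 * \<delta> \<le> \<bar>snd h\<bar>" "\<bar>snd x + snd h\<bar> = \<bar>snd x\<bar> + \<bar>snd h\<bar>"
            using True \<delta> by (auto simp: Q_def I2_def split: if_splits)
          have "\<bar>fst x\<bar> \<le> \<bar>snd x\<bar>" using j by (simp add: admissible_def)
          then have gy: "2 * \<delta> \<le> gap (x + h)" using h1' h2 by (simp add: gap_def) (use h1' h2 in arith)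
          have "norm h < 1" using norm_Pair_le[of "fst h" "snd h"] h1' h2 \<delta> by simp
          then have j': "j h = vertical_kernel h" using elim gy \<delta> by (auto simp: V_iff_gap)
          have "(4 * \<delta>) powr (- (b + 2)) \<le> \<bar>fst h\<bar> powr (- (a + 2))"
          proof -
            have "(\<delta> powr \<kappa>) powr (- (a + 2)) \<le> \<bar>fst h\<bar> powr (- (a + 2))"
              using h1 elim exponents by (intro powr_mono2') auto
            moreover have "(\<delta> powr \<kappa>) powr (- (a + 2)) = \<delta> powr (- (b + 2))"
              by (simp only: powr_powr mult_minus_right \<kappa>_\<beta>(1))
            moreover have "(4 * \<delta>) powr (- (b + 2)) \<le> \<delta> powr (- (b + 2))"
              using \<delta> exponents by (intro powr_mono2') auto
            ultimately show ?thesis by linarith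
          qed
          moreover have "(4 * \<delta>) powr (- (b + 2)) \<le> \<bar>snd h\<bar> powr (- (b + 2))"
            using h2 \<delta> exponents by (intro powr_mono2') auto
          ultimately have K: "(4 * \<delta>) powr (- (b + 2)) \<le> vertical_kernel h" by (simp add: vertical_kernel_def)
          have "g \<le> barrier \<beta> \<delta> (gap (x + h))"
          proof -
            have "(\<delta> / gap (x + h)) powr (1 - \<beta>) \<le> (1 / 2) powr (1 - \<beta>)"
              using gy \<delta> \<beta>_bounds by (intro powr_mono2) (auto simp: field_simps)
            then show ?thesis using gy \<delta> by (simp add: barrier_def g_def)
          qed
          then have "?k \<le> barrier \<beta> \<delta> (gap (x + h)) * vertical_kernel h"
            using K g by (intro mult_mono) auto
          then show ?thesis using True X0 j' by simp
        next
          case False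
          then show ?thesis using X0 elim barrier_bounds[OF \<beta>_bounds \<delta>(1)] by simp
        qed
      qed
    qed
    moreover have iQ: "integrable lborel (\<lambda>h. ?k * indicator Q h)"
      using eQ Qs by (intro integrable_mult_right integrable_real_indicator) auto
    ultimately have "(LINT h|lborel. ?k * indicator Q h) \<le> integral\<^sup>L lborel ?G"
      using admissible_integrable[OF j \<delta>(1)] by (intro integral_mono_AE)
    moreover have "(LINT h|lborel. ?k * indicator Q h) = ?k * (2 * \<delta> powr \<kappa> * \<delta>)"
      using eQ Qs \<delta> by (simp add: measure_def)
    moreover have "?k * (2 * \<delta> powr \<kappa> * \<delta>) = c * \<delta> powr (- \<beta>)"
    proof -
      have "\<delta> powr (- (b + 2)) * (\<delta> powr \<kappa> * \<delta> powr 1) = \<delta> powr (- \<beta>)"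
        unfolding powr_add[symmetric] \<kappa>_\<beta>(2) by (simp add: algebra_simps)
      then have "\<delta> powr (- (b + 2)) * (\<delta> powr \<kappa> * \<delta>) = \<delta> powr (- \<beta>)" using \<delta> by simp
      moreover have "(4 * \<delta>) powr (- (b + 2)) = 4 powr (- (b + 2)) * \<delta> powr (- (b + 2))"
        using \<delta> by (intro powr_mult)
      ultimately show ?thesis by (simp add: c_def mult_ac)
    qed
    ultimately show "c * \<delta> powr (- \<beta>) \<le> integral\<^sup>L lborel ?G" by (simp only:)
  qed
qed

end

section \<open>The jump operator on Lipschitz functions\<close>

lemma swap_measurable [measurable]: "prod.swap \<in> borel_measurable (borel :: (real \<times> real) measure)"
  by (auto intro!: borel_measurable_continuous_onI continuous_intros simp: prod.swap_def)

lemma V_sets [measurable]: "V \<in> sets borel"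
proof -
  have "V = {x. \<bar>fst x\<bar> < \<bar>snd x\<bar>}" by (auto simp: V_def)
  moreover have "open {x::real\<times>real. \<bar>fst x\<bar> < \<bar>snd x\<bar>}"
    by (intro open_Collect_less continuous_intros)
  ultimately show ?thesis by simp
qed

lemma neg_power_measurable [measurable (raw)]:
  assumes [measurable]: "f \<in> borel_measurable M"
  shows "(\<lambda>x. neg_power (f x) s) \<in> borel_measurable M"
  unfolding neg_power_def by measurable

lemma J1_measurable [measurable (raw)]:
  assumes [measurable]: "f \<in> borel_measurable M" "g \<in> borel_measurable M"
  shows "(\<lambda>x. J1 a b (f x) (g x)) \<in> borel_measurable M"
proof -
  have [measurable]: "Measurable.pred M (\<lambda>x. f x \<in> V)" "Measurable.pred M (\<lambda>x. g x \<in> V)"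
    by measurable
  have [measurable]: "(\<lambda>x. fst (f x)) \<in> borel_measurable M" "(\<lambda>x. snd (f x)) \<in> borel_measurable M"
    "(\<lambda>x. fst (g x)) \<in> borel_measurable M" "(\<lambda>x. snd (g x)) \<in> borel_measurable M"
    by measurable
  have [measurable]: "(\<lambda>x. J1_ext a b (f x) (g x)) \<in> borel_measurable M"
    unfolding J1_ext_def m_kernel_def by measurable
  show ?thesis unfolding J1_def by measurable
qed

lemma enn2real_min_ennreal: "0 \<le> u \<Longrightarrow> 0 \<le> v \<Longrightarrow> enn2real (min (ennreal u) (ennreal v)) = min u v"
  by (auto simp: min_def ennreal_le_iff)

lemma J1_nonneg: "0 \<le> J1 a b x y"
  by (simp add: J1_def)

definition lipschitz_fun :: "real \<Rightarrow> (real \<times> real \<Rightarrow> real) \<Rightarrow> bool" where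
  "lipschitz_fun K f \<longleftrightarrow> (\<forall>x y. \<bar>f x - f y\<bar> \<le> K * norm (x - y))"

lemma lipschitz_funD: "lipschitz_fun K f \<Longrightarrow> \<bar>f x - f y\<bar> \<le> K * norm (x - y)"
  unfolding lipschitz_fun_def by blast

lemma lipschitz_fun_nonneg: "lipschitz_fun K f \<Longrightarrow> 0 \<le> K"
  using lipschitz_funD[of K f "(1, 0)" 0] by (auto simp: norm_prod_def)

lemma lipschitz_fun_continuous: "lipschitz_fun K f \<Longrightarrow> continuous_on UNIV f"
proof (rule lipschitz_on_continuous_on)
  assume f: "lipschitz_fun K f"
  show "K-lipschitz_on UNIV f"
    using lipschitz_fun_nonneg[OF f] lipschitz_funD[OF f] by (intro lipschitz_onI) (simp_all only: dist_norm real_norm_def)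
qed

lemma lipschitz_fun_measurable: "lipschitz_fun K f \<Longrightarrow> f \<in> borel_measurable borel"
  by (intro borel_measurable_continuous_onI lipschitz_fun_continuous)

context jump_exponents
begin

lemma gap_swap: "gap (prod.swap x) = - gap x"
  by (simp add: gap_def)

lemma swap_add: "prod.swap (x + h) = prod.swap x + prod.swap (h :: real \<times> real)"
  by (simp add: prod_eq_iff)

lemma J1_vertical:
  assumes "x \<in> V" "x + h \<in> V" "fst h \<noteq> 0" "snd h \<noteq> 0"
  shows "J1 a b x (x + h) = indicator (ball 0 1) h * vertical_kernel h"
proof (cases "h \<in> ball 0 1")
  case True
  then show ?thesis using assms norm_less_one_coords[OF True]
    by (simp add: J1_def J1_ext_def m_kernel_def neg_power_def enn2real_min_ennreal vertical_kernel_def indicator_def add.commute)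
qed (simp add: J1_def indicator_def)

lemma J1_horizontal:
  assumes "x \<notin> V" "x + h \<notin> V" "fst h \<noteq> 0" "snd h \<noteq> 0"
  shows "J1 a b x (x + h) = indicator (ball 0 1) h * vertical_kernel (prod.swap h)"
proof (cases "h \<in> ball 0 1")
  case True
  then show ?thesis using assms norm_less_one_coords[OF True]
    by (simp add: J1_def J1_ext_def m_kernel_def neg_power_def enn2real_min_ennreal vertical_kernel_def indicator_def add.commute)
qed (simp add: J1_def indicator_def)

lemma J1_crossing:
  assumes "x \<in> V \<longleftrightarrow> x + h \<notin> V" "fst h \<noteq> 0" "snd h \<noteq> 0"
  shows "J1 a b x (x + h) = indicator (ball 0 1) h * cross_kernel h"
proof (cases "h \<in> ball 0 1")
  case True
  then show ?thesis using assms
    by (simp add: J1_def J1_ext_def neg_power_def enn2real_min_ennreal cross_kernel_def indicator_def add.commute)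
qed (simp add: J1_def indicator_def)

lemma indicator_ball_swap: "(indicator (ball 0 1) (prod.swap h) :: real) = indicator (ball 0 1) (h :: real \<times> real)"
  using ball_swap[of h] by (simp add: indicator_def del: mem_ball)

definition majorant :: "real \<times> real \<Rightarrow> real" where
  "majorant h = indicator (ball 0 1) h * (vertical_kernel h + vertical_kernel (prod.swap h))"

lemma majorant_nonneg: "0 \<le> majorant h"
  by (simp add: majorant_def)

lemma J1_le_majorant:
  assumes "fst h \<noteq> 0" "snd h \<noteq> 0"
  shows "J1 a b x (x + h) \<le> majorant h"
proof -
  consider "x \<in> V" "x + h \<in> V" | "x \<notin> V" "x + h \<notin> V" | "x \<in> V \<longleftrightarrow> x + h \<notin> V" by blast
  then show ?thesis
  proof cases
    case 1 then show ?thesis using J1_vertical[OF 1 assms] by (simp add: majorant_def mult_left_mono)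
  next
    case 2 then show ?thesis using J1_horizontal[OF 2 assms] by (simp add: majorant_def mult_left_mono)
  next
    case 3
    have "cross_kernel h \<le> vertical_kernel h + vertical_kernel (prod.swap h)" if "h \<in> ball 0 1"
      using cross_kernel_le[OF that] by (simp add: add_increasing2)
    then show ?thesis using J1_crossing[OF 3 assms] by (auto simp: majorant_def indicator_def)
  qed
qed

lemma majorant_first_moment: "integrable lborel (\<lambda>h. norm h * majorant h)"
proof -
  let ?f = "\<lambda>h. indicator (ball 0 1) h * ((\<bar>fst h\<bar> + \<bar>snd h\<bar>) * vertical_kernel h)"
  have "integrable lborel (\<lambda>h. ?f h + ?f (prod.swap h))"
    by (intro Bochner_Integration.integrable_add lborel_swap vertical_kernel_l1_integrable)
  then show ?thesis
  proof (rule Bochner_Integration.integrable_bound)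
    show "AE h in lborel. norm (norm h * majorant h) \<le> norm (?f h + ?f (prod.swap h))"
    proof (intro always_eventually allI)
      fix h :: "real \<times> real"
      have "norm h \<le> \<bar>fst h\<bar> + \<bar>snd h\<bar>" using norm_Pair_le[of "fst h" "snd h"] by simp
      then have "norm h * majorant h \<le> (\<bar>fst h\<bar> + \<bar>snd h\<bar>) * majorant h"
        by (intro mult_right_mono majorant_nonneg)
      also have "\<dots> = ?f h + ?f (prod.swap h)"
        unfolding indicator_ball_swap by (simp add: majorant_def algebra_simps)
      finally show "norm (norm h * majorant h) \<le> norm (?f h + ?f (prod.swap h))"
        using majorant_nonneg[of h] by simp
    qed
    show "(\<lambda>h. norm h * majorant h) \<in> borel_measurable lborel"
      unfolding majorant_def[abs_def] by measurable
  qed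
qed

definition moment :: real where "moment = (LINT h|lborel. norm h * majorant h)"

lemma moment_nonneg: "0 \<le> moment"
  unfolding moment_def by (intro Bochner_Integration.integral_nonneg mult_nonneg_nonneg majorant_nonneg) auto

abbreviation "L \<equiv> jump_operator (J1 a b)"

lemma L_integrand_bound:
  assumes "lipschitz_fun K f" "fst h \<noteq> 0" "snd h \<noteq> 0"
  shows "norm ((f (x + h) - f x) * J1 a b x (x + h)) \<le> K * (norm h * majorant h)"
proof -
  have "\<bar>f (x + h) - f x\<bar> * J1 a b x (x + h) \<le> K * norm h * majorant h"
    using lipschitz_funD[OF assms(1), of "x + h" x] J1_le_majorant[OF assms(2,3), of x] J1_nonneg[of a b x "x + h"]
      lipschitz_fun_nonneg[OF assms(1)]
    by (intro mult_mono) auto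
  then show ?thesis using J1_nonneg[of a b x "x + h"] by (simp add: abs_mult mult.assoc)
qed

lemma L_integrand_AE:
  assumes "lipschitz_fun K f"
  shows "AE h in lborel. norm ((f (x + h) - f x) * J1 a b x (x + h)) \<le> K * (norm h * majorant h)"
  using AE_lborel_fst_snd_nonzero
proof eventually_elim
  case (elim h)
  then show ?case using L_integrand_bound[OF assms] by blast
qed

lemma L_integrable:
  assumes f: "lipschitz_fun K f"
  shows "integrable lborel (\<lambda>h. (f (x + h) - f x) * J1 a b x (x + h))"
proof (rule Bochner_Integration.integrable_bound)
  have [measurable]: "f \<in> borel_measurable borel" using f by (rule lipschitz_fun_measurable)
  show "integrable lborel (\<lambda>h. K * (norm h * majorant h))"
    by (intro integrable_mult_right majorant_first_moment)
  show "(\<lambda>h. (f (x + h) - f x) * J1 a b x (x + h)) \<in> borel_measurable lborel" by measurable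
  show "AE h in lborel. norm ((f (x + h) - f x) * J1 a b x (x + h)) \<le> norm (K * (norm h * majorant h))"
    using AE_lborel_fst_snd_nonzero
  proof eventually_elim
    case (elim h)
    have "norm ((f (x + h) - f x) * J1 a b x (x + h)) \<le> K * (norm h * majorant h)"
      using L_integrand_bound[OF f] elim by blast
    then show ?case by (rule order_trans) (simp only: real_norm_def abs_ge_self)
  qed
qed

lemma L_bound:
  assumes f: "lipschitz_fun K f"
  shows "\<bar>L f x\<bar> \<le> K * moment"
proof -
  have "\<bar>L f x\<bar> \<le> (LINT h|lborel. norm ((f (x + h) - f x) * J1 a b x (x + h)))"
    unfolding jump_operator_def using integral_norm_bound[of lborel "\<lambda>h. (f (x + h) - f x) * J1 a b x (x + h)"] by simp
  also have "\<dots> \<le> (LINT h|lborel. K * (norm h * majorant h))"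
    by (intro integral_mono_AE integrable_norm L_integrable[OF f] integrable_mult_right majorant_first_moment L_integrand_AE[OF f])
  finally show ?thesis by (simp add: moment_def)
qed

lemma L_measurable:
  assumes [measurable]: "f \<in> borel_measurable borel"
  shows "L f \<in> borel_measurable borel"
  unfolding jump_operator_def[abs_def]
  by (rule lborel.borel_measurable_lebesgue_integral) measurable

text \<open>
  Pointwise convergence suffices under a common Lipschitz constant, although the kernel is discontinuous
  in \<open>x\<close>: the increments are dominated by a multiple of the first moment of the majorant.
\<close>

lemma L_tendsto:
  assumes "\<And>n. lipschitz_fun K (f n)" "\<And>x. (\<lambda>n. f n x) \<longlonglongrightarrow> g x"
  shows "(\<lambda>n. L (f n) x) \<longlonglongrightarrow> L g x"
  unfolding jump_operator_def
proof (rule integral_dominated_convergence)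
  have [measurable]: "f n \<in> borel_measurable borel" for n using assms(1) by (rule lipschitz_fun_measurable)
  have [measurable]: "g \<in> borel_measurable borel"
    by (rule borel_measurable_LIMSEQ_real[OF assms(2)]) measurable
  show "(\<lambda>h. (g (x + h) - g x) * J1 a b x (x + h)) \<in> borel_measurable lborel" by measurable
  show "(\<lambda>h. (f i (x + h) - f i x) * J1 a b x (x + h)) \<in> borel_measurable lborel" for i by measurable
  show "integrable lborel (\<lambda>h. K * (norm h * majorant h))"
    by (intro integrable_mult_right majorant_first_moment)
  show "AE h in lborel. (\<lambda>i. (f i (x + h) - f i x) * J1 a b x (x + h)) \<longlonglongrightarrow> (g (x + h) - g x) * J1 a b x (x + h)"
    by (intro always_eventually allI tendsto_intros assms)
  show "AE h in lborel. norm ((f i (x + h) - f i x) * J1 a b x (x + h)) \<le> K * (norm h * majorant h)" for i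
    by (intro L_integrand_AE assms)
qed

lemma AE_gap_nonzero: "AE h in lborel. gap (x + h) \<noteq> 0"
proof -
  have "AE h in lborel \<Otimes>\<^sub>M lborel. gap (x + h) \<noteq> 0"
  proof (rule lborel_pair.AE_pair_measure)
    have "{h \<in> space borel. gap (x + h) \<noteq> 0} \<in> sets borel" by measurable
    then show "{h \<in> space (lborel \<Otimes>\<^sub>M lborel). gap (x + h) \<noteq> 0} \<in> sets (lborel \<Otimes>\<^sub>M lborel)"
      unfolding lborel_prod by simp
    show "AE s in lborel. AE t in lborel. gap (x + (s, t)) \<noteq> 0"
    proof (rule always_eventually, rule allI)
      fix s :: real
      show "AE t in lborel. gap (x + (s, t)) \<noteq> 0"
        using AE_lborel_singleton[of "\<bar>fst x + s\<bar> - snd x"] AE_lborel_singleton[of "- \<bar>fst x + s\<bar> - snd x"]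
        by eventually_elim (auto simp: gap_def)
    qed
  qed
  then show ?thesis unfolding lborel_prod .
qed

lemma AE_gap_nonzero_swap: "AE h in lborel. gap (x + prod.swap h) \<noteq> 0"
  using AE_gap_nonzero[of "prod.swap x"]
proof eventually_elim
  case (elim h)
  then show ?case using gap_swap[of "x + prod.swap h"] by (simp add: swap_add)
qed

lemma admissible_vertical:
  assumes "x \<in> V" shows "admissible x (\<lambda>h. J1 a b x (x + h))"
proof -
  have "AE h in lborel. 0 \<le> J1 a b x (x + h) \<and> (if x + h \<in> V then J1 a b x (x + h) = indicator (ball 0 1) h * vertical_kernel h
      else J1 a b x (x + h) \<le> indicator (ball 0 1) h * cross_kernel h)"
    using AE_lborel_fst_snd_nonzero
    by eventually_elim (auto simp: J1_nonneg J1_vertical J1_crossing assms)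
  then show ?thesis using assms by (auto simp: admissible_def V_iff_gap gap_def)
qed

text \<open>
  On the complement of \<open>V\<close>, diagonals included, the kernel seen through the swap has the form that it has
  on \<open>V\<close>; a jump that lands exactly on a diagonal has probability zero.
\<close>

lemma admissible_horizontal:
  assumes "x \<notin> V" shows "admissible (prod.swap x) (\<lambda>h. J1 a b x (x + prod.swap h))"
proof -
  have "AE h in lborel. 0 \<le> J1 a b x (x + prod.swap h) \<and>
     (if prod.swap x + h \<in> V then J1 a b x (x + prod.swap h) = indicator (ball 0 1) h * vertical_kernel h
      else J1 a b x (x + prod.swap h) \<le> indicator (ball 0 1) h * cross_kernel h)"
    using AE_lborel_fst_snd_nonzero AE_gap_nonzero_swap[of x]
  proof eventually_elim
    case (elim h)
    have g: "gap (prod.swap x + h) = - gap (x + prod.swap h)"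
      using gap_swap[of "x + prod.swap h"] by (simp add: swap_add)
    show ?case
    proof (cases "prod.swap x + h \<in> V")
      case True
      then have "x + prod.swap h \<notin> V" using g by (simp add: V_iff_gap)
      then show ?thesis using True J1_horizontal[OF assms, of "prod.swap h"] elim by (simp add: J1_nonneg indicator_ball_swap)
    next
      case False
      then have "x + prod.swap h \<in> V" using g elim by (simp add: V_iff_gap)
      then show ?thesis using False J1_crossing[of x "prod.swap h"] elim assms
        by (simp add: J1_nonneg indicator_ball_swap cross_kernel_swap)
    qed
  qed
  then show ?thesis using assms by (auto simp: admissible_def V_iff_gap gap_def)
qed

text \<open>
  The kernel is invariant under the swap except that the diagonals belong to the complement of \<open>V\<close> in both
  pictures. As end points of jumps they form a null set, so only a starting point on
  them has to be excluded.
\<close>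

lemma L_swap:
  assumes [measurable]: "f \<in> borel_measurable borel" and x: "gap x \<noteq> 0"
  shows "L f (prod.swap x) = L (\<lambda>y. f (prod.swap y)) x"
proof -
  have "L f (prod.swap x) = (LINT h|lborel. (f (prod.swap x + prod.swap h) - f (prod.swap x)) * J1 a b (prod.swap x) (prod.swap x + prod.swap h))"
    unfolding jump_operator_def by (subst lborel_swap(2)[symmetric]) auto
  also have "\<dots> = (LINT h|lborel. (f (prod.swap (x + h)) - f (prod.swap x)) * J1 a b x (x + h))"
  proof (rule integral_cong_AE)
    show "AE h in lborel. (f (prod.swap x + prod.swap h) - f (prod.swap x)) * J1 a b (prod.swap x) (prod.swap x + prod.swap h)
       = (f (prod.swap (x + h)) - f (prod.swap x)) * J1 a b x (x + h)"
      using AE_gap_nonzero[of x] AE_lborel_fst_snd_nonzero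
    proof eventually_elim
      case (elim h)
      have vx: "prod.swap x \<in> V \<longleftrightarrow> x \<notin> V" using x gap_swap[of x] by (auto simp: V_iff_gap)
      have vy: "prod.swap x + prod.swap h \<in> V \<longleftrightarrow> x + h \<notin> V"
        using elim gap_swap[of "x + h"] by (auto simp: V_iff_gap swap_add)
      consider "x \<in> V" "x + h \<in> V" | "x \<notin> V" "x + h \<notin> V" | "x \<in> V \<longleftrightarrow> x + h \<notin> V" by blast
      then have "J1 a b (prod.swap x) (prod.swap x + prod.swap h) = J1 a b x (x + h)"
      proof cases
        case 1 then show ?thesis
          using J1_vertical[OF 1] J1_horizontal[of "prod.swap x" "prod.swap h"] vx vy elim by (simp add: indicator_ball_swap)
      next
        case 2 then show ?thesis
          using J1_horizontal[OF 2] J1_vertical[of "prod.swap x" "prod.swap h"] vx vy elim by (simp add: indicator_ball_swap)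
      next
        case 3 then show ?thesis
          using J1_crossing[OF 3] J1_crossing[of "prod.swap x" "prod.swap h"] vx vy elim
          by (simp add: indicator_ball_swap cross_kernel_swap)
      qed
      then show ?case by (simp add: swap_add)
    qed
  qed measurable
  finally show ?thesis by (simp add: jump_operator_def)
qed

definition strip_barrier :: "real \<Rightarrow> real \<times> real \<Rightarrow> real" where
  "strip_barrier \<delta> x = barrier \<beta> \<delta> (gap x)"

lemma strip_barrier_lipschitz:
  assumes "0 < \<delta>"
  shows "lipschitz_fun (2 / \<delta>) (strip_barrier \<delta>)" "lipschitz_fun (2 / \<delta>) (\<lambda>x. strip_barrier \<delta> (prod.swap x))"
proof -
  have g: "\<bar>strip_barrier \<delta> x - strip_barrier \<delta> y\<bar> \<le> 2 / \<delta> * norm (x - y)" for x y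
  proof -
    have "\<bar>gap x - gap y\<bar> \<le> \<bar>fst (x - y)\<bar> + \<bar>snd (x - y)\<bar>" using gap_diff[of y "x - y"] by simp
    also have "\<dots> \<le> 2 * norm (x - y)"
      using norm_fst_le[of "fst (x - y)" "snd (x - y)"] norm_snd_le[of "snd (x - y)" "fst (x - y)"]
      unfolding prod.collapse real_norm_def by linarith
    finally have "\<bar>gap x - gap y\<bar> / \<delta> \<le> 2 * norm (x - y) / \<delta>" using assms by (intro divide_right_mono) auto
    then show ?thesis
      using barrier_lipschitz[OF \<beta>_bounds assms, of "gap x" "gap y"] by (simp add: strip_barrier_def)
  qed
  then show "lipschitz_fun (2 / \<delta>) (strip_barrier \<delta>)" unfolding lipschitz_fun_def by blast
  have "norm (prod.swap x - prod.swap y) = norm (x - y)" for x y :: "real \<times> real"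
    by (simp add: norm_prod_def add.commute)
  then show "lipschitz_fun (2 / \<delta>) (\<lambda>x. strip_barrier \<delta> (prod.swap x))"
    unfolding lipschitz_fun_def using g by metis
qed

lemma strip_barrier_bounds: "0 < \<delta> \<Longrightarrow> 0 \<le> strip_barrier \<delta> x" "0 < \<delta> \<Longrightarrow> strip_barrier \<delta> x \<le> 1"
  using barrier_bounds[OF \<beta>_bounds] by (auto simp: strip_barrier_def)

lemma strip_barrier_eq_0: "gap x \<le> 0 \<Longrightarrow> 0 < \<delta> \<Longrightarrow> strip_barrier \<delta> x = 0"
  by (simp add: strip_barrier_def barrier_def)

lemma L_nonneg_at_zero:
  assumes "\<And>y. 0 \<le> f y" "f x = 0" shows "0 \<le> L f x"
  unfolding jump_operator_def using assms J1_nonneg by (intro Bochner_Integration.integral_nonneg) auto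

lemma L_strip_barrier:
  "L (strip_barrier \<delta>) x = (LINT h|lborel. (barrier \<beta> \<delta> (gap (x + h)) - barrier \<beta> \<delta> (gap x)) * J1 a b x (x + h))"
  "L (\<lambda>x. strip_barrier \<delta> (prod.swap x)) x =
     (LINT h|lborel. (barrier \<beta> \<delta> (gap (prod.swap x + h)) - barrier \<beta> \<delta> (gap (prod.swap x))) * J1 a b x (x + prod.swap h))"
proof -
  show "L (strip_barrier \<delta>) x = (LINT h|lborel. (barrier \<beta> \<delta> (gap (x + h)) - barrier \<beta> \<delta> (gap x)) * J1 a b x (x + h))"
    by (simp add: jump_operator_def strip_barrier_def)
  have [measurable]: "strip_barrier \<delta> \<in> borel_measurable borel" unfolding strip_barrier_def[abs_def] by measurable
  show "L (\<lambda>x. strip_barrier \<delta> (prod.swap x)) x =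
     (LINT h|lborel. (barrier \<beta> \<delta> (gap (prod.swap x + h)) - barrier \<beta> \<delta> (gap (prod.swap x))) * J1 a b x (x + prod.swap h))"
    unfolding jump_operator_def
    by (subst lborel_swap(2)[symmetric]) (auto simp: strip_barrier_def swap_add)
qed

text \<open>
  An exponent above the indices of the horizontal jumps and of the jumps in \<open>band_integral_bound\<close>, and below the
  index \<open>\<beta>\<close> of the vertical jumps.
\<close>

definition good_exponent :: "real \<Rightarrow> bool" where
  "good_exponent \<theta> \<longleftrightarrow> (a * b + a + b) / (b + 2) < \<theta> \<and> a * \<kappa> < \<theta> \<and> \<theta> < \<beta>"

text \<open>
  Both competing indices lie strictly below \<open>\<beta>\<close> since \<open>a < b\<close>.
\<close>

lemma good_exponent_exists: "\<exists>\<theta>. good_exponent \<theta>"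
proof -
  have "(a * b + a + b) / (b + 2) < \<beta>"
    unfolding \<beta>_def using exponents by (intro divide_strict_left_mono) (auto intro!: add_pos_pos)
  moreover have "a * \<kappa> < \<beta>"
    unfolding \<beta>_def \<kappa>_def using exponents by (simp add: divide_strict_right_mono algebra_simps)
  ultimately have "max ((a * b + a + b) / (b + 2)) (a * \<kappa>) < \<beta>" by simp
  then obtain \<theta> where "max ((a * b + a + b) / (b + 2)) (a * \<kappa>) < \<theta>" "\<theta> < \<beta>" using dense by blast
  then show ?thesis by (auto simp: good_exponent_def)
qed

lemma L_strip_barrier_lower:
  assumes "good_exponent \<theta>"
  obtains C where "0 \<le> C"
    "\<And>\<delta> x. 0 < \<delta> \<Longrightarrow> \<delta> \<le> 1 \<Longrightarrow> - C * \<delta> powr (- \<theta>) \<le> L (strip_barrier \<delta>) x"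
    "\<And>\<delta> x. 0 < \<delta> \<Longrightarrow> \<delta> \<le> 1 \<Longrightarrow> - C * \<delta> powr (- \<theta>) \<le> L (\<lambda>x. strip_barrier \<delta> (prod.swap x)) x"
proof -
  obtain C where C: "0 \<le> C"
    "\<And>\<delta> x j. 0 < \<delta> \<Longrightarrow> \<delta> \<le> 1 \<Longrightarrow> admissible x j \<Longrightarrow>
      - C * \<delta> powr (- \<theta>) \<le> (LINT h|lborel. (barrier \<beta> \<delta> (gap (x + h)) - barrier \<beta> \<delta> (gap x)) * j h)"
    using drift_lower_bound[of \<theta>] assms \<beta>_bounds by (auto simp: good_exponent_def)
  have neg: "- C * \<delta> powr (- \<theta>) \<le> 0" for \<delta> using C(1) by simp
  show ?thesis
  proof
    show "0 \<le> C" by fact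
    fix \<delta> :: real and x assume \<delta>: "0 < \<delta>" "\<delta> \<le> 1"
    show "- C * \<delta> powr (- \<theta>) \<le> L (strip_barrier \<delta>) x"
    proof (cases "x \<in> V")
      case True
      then show ?thesis using C(2)[OF \<delta> admissible_vertical[OF True]] by (simp add: L_strip_barrier)
    next
      case False
      then have "0 \<le> L (strip_barrier \<delta>) x"
        using \<delta> by (intro L_nonneg_at_zero strip_barrier_bounds strip_barrier_eq_0) (auto simp: V_iff_gap)
      then show ?thesis using neg order_trans by blast
    qed
    show "- C * \<delta> powr (- \<theta>) \<le> L (\<lambda>x. strip_barrier \<delta> (prod.swap x)) x"
    proof (cases "x \<in> V")
      case False
      then show ?thesis using C(2)[OF \<delta> admissible_horizontal[OF False]] by (simp add: L_strip_barrier)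
    next
      case True
      then have "0 \<le> L (\<lambda>x. strip_barrier \<delta> (prod.swap x)) x"
        using \<delta> by (intro L_nonneg_at_zero strip_barrier_bounds strip_barrier_eq_0) (auto simp: V_iff_gap gap_swap)
      then show ?thesis using neg order_trans by blast
    qed
  qed
qed

lemma L_strip_barrier_strip:
  obtains c where "0 < c"
    "\<And>\<delta> x. 0 < \<delta> \<Longrightarrow> \<delta> \<le> 1/8 \<Longrightarrow> x \<in> V \<Longrightarrow> gap x \<le> \<delta> \<Longrightarrow> c * \<delta> powr (- \<beta>) \<le> L (strip_barrier \<delta>) x"
    "\<And>\<delta> x. 0 < \<delta> \<Longrightarrow> \<delta> \<le> 1/8 \<Longrightarrow> x \<notin> V \<Longrightarrow> - \<delta> \<le> gap x \<Longrightarrow> c * \<delta> powr (- \<beta>) \<le> L (\<lambda>x. strip_barrier \<delta> (prod.swap x)) x"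
proof -
  obtain c where c: "0 < c"
    "\<And>\<delta> x j. 0 < \<delta> \<Longrightarrow> \<delta> \<le> 1/8 \<Longrightarrow> admissible x j \<Longrightarrow> gap x \<le> \<delta> \<Longrightarrow>
      c * \<delta> powr (- \<beta>) \<le> (LINT h|lborel. (barrier \<beta> \<delta> (gap (x + h)) - barrier \<beta> \<delta> (gap x)) * j h)"
    using strip_lower_bound by blast
  show ?thesis
  proof
    show "0 < c" by fact
    fix \<delta> :: real and x assume \<delta>: "0 < \<delta>" "\<delta> \<le> 1/8"
    show "c * \<delta> powr (- \<beta>) \<le> L (strip_barrier \<delta>) x" if "x \<in> V" "gap x \<le> \<delta>"
      using c(2)[OF \<delta> admissible_vertical[OF that(1)] that(2)] by (simp add: L_strip_barrier)
    show "c * \<delta> powr (- \<beta>) \<le> L (\<lambda>x. strip_barrier \<delta> (prod.swap x)) x" if "x \<notin> V" "- \<delta> \<le> gap x"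
      using c(2)[OF \<delta> admissible_horizontal[OF that(1)]] that(2) by (simp add: L_strip_barrier gap_swap)
  qed
qed

end

section \<open>Smoothing of Lipschitz functions\<close>

lemma DERIV_pos_part_power:
  "((\<lambda>t::real. max 0 t ^ (k + 2)) has_real_derivative real (k + 2) * max 0 t ^ (k + 1)) (at t)"
proof -
  consider "t < 0" | "0 < t" | "t = 0" by linarith
  then show ?thesis
  proof cases
    case 1
    have "((\<lambda>t::real. 0) has_real_derivative real (k + 2) * max 0 t ^ (k + 1)) (at t)"
      using 1 by simp
    then show ?thesis
      by (rule has_field_derivative_transform_within_open[where S = "{..<0}"]) (use 1 in auto)
  next
    case 2
    have "((\<lambda>t::real. t ^ (k + 2)) has_real_derivative real (k + 2) * max 0 t ^ (k + 1)) (at t)"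
      using 2 DERIV_pow[of "k + 2" t] by simp
    then show ?thesis
      by (rule has_field_derivative_transform_within_open[where S = "{0<..}"]) (use 2 in auto)
  next
    case 3
    have "((\<lambda>h. (max 0 (0 + h) ^ (k + 2) - max 0 0 ^ (k + 2)) / h) \<longlongrightarrow> (0::real)) (at 0)"
    proof (rule Lim_null_comparison)
      show "\<forall>\<^sub>F h in at 0. norm ((max 0 (0 + h) ^ (k + 2) - max 0 0 ^ (k + 2)) / h) \<le> \<bar>h\<bar> ^ (k + 1)"
      proof (intro always_eventually allI)
        fix h :: real
        have "max 0 h ^ (k + 2) \<le> \<bar>h\<bar> ^ (k + 2)" by (intro power_mono) auto
        then show "norm ((max 0 (0 + h) ^ (k + 2) - max 0 0 ^ (k + 2)) / h) \<le> \<bar>h\<bar> ^ (k + 1)"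
          by (cases "h = 0") (auto simp: field_simps)
      qed
      have "((\<lambda>h::real. \<bar>h\<bar> ^ (k + 1)) \<longlongrightarrow> \<bar>0\<bar> ^ (k + 1)) (at 0)" by (intro tendsto_intros)
      then show "((\<lambda>h::real. \<bar>h\<bar> ^ (k + 1)) \<longlongrightarrow> 0) (at 0)" by simp
    qed
    then show ?thesis using 3 by (simp add: DERIV_def)
  qed
qed

lemma has_derivative_pos_part_power:
  fixes g :: "'a::real_normed_vector \<Rightarrow> real"
  assumes "(g has_derivative g') (at x)"
  shows "((\<lambda>x. max 0 (g x) ^ (k + 2)) has_derivative (\<lambda>h. real (k + 2) * max 0 (g x) ^ (k + 1) * g' h)) (at x)"
  using has_derivative_compose[OF assms DERIV_pos_part_power[where k = k, unfolded has_field_derivative_def]]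
  by simp

definition bump :: "real \<Rightarrow> 'a::euclidean_space \<Rightarrow> real" where
  "bump c z = max 0 (1 - c * (z \<bullet> z)) ^ 3"

definition bump_deriv :: "real \<Rightarrow> 'a::euclidean_space \<Rightarrow> 'a \<Rightarrow>\<^sub>L real" where
  "bump_deriv c z = (- 6 * c * max 0 (1 - c * (z \<bullet> z)) ^ 2) *\<^sub>R blinfun_inner_right z"

definition bump_deriv2 :: "real \<Rightarrow> 'a::euclidean_space \<Rightarrow> 'a \<Rightarrow>\<^sub>L ('a \<Rightarrow>\<^sub>L real)" where
  "bump_deriv2 c z = Blinfun (\<lambda>h. (24 * c\<^sup>2 * max 0 (1 - c * (z \<bullet> z)) * (z \<bullet> h)) *\<^sub>R blinfun_inner_right z
     + (- 6 * c * max 0 (1 - c * (z \<bullet> z)) ^ 2) *\<^sub>R blinfun_inner_right h)"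

lemma bump_has_derivative: "(bump c has_derivative blinfun_apply (bump_deriv c z)) (at z)"
proof -
  have "((\<lambda>z. 1 - c * (z \<bullet> z)) has_derivative (\<lambda>h. - (c * (z \<bullet> h + h \<bullet> z)))) (at z)"
    by (auto intro!: derivative_eq_intros)
  have "((\<lambda>z. max 0 (1 - c * (z \<bullet> z)) ^ 3) has_derivative
     (\<lambda>h. 3 * max 0 (1 - c * (z \<bullet> z)) ^ 2 * - (c * (z \<bullet> h + h \<bullet> z)))) (at z)"
    using has_derivative_pos_part_power[OF \<open>((\<lambda>z. 1 - c * (z \<bullet> z)) has_derivative _) _\<close>, of 1] by (simp add: eval_nat_numeral)
  then show ?thesis
    unfolding bump_def[abs_def] bump_deriv_def
    by (rule has_derivative_eq_rhs)
       (auto simp: fun_eq_iff blinfun.scaleR_left blinfun.minus_left inner_commute algebra_simps)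
qed

lemma bump_deriv2_apply:
  "blinfun_apply (bump_deriv2 c z) h = (24 * c\<^sup>2 * max 0 (1 - c * (z \<bullet> z)) * (z \<bullet> h)) *\<^sub>R blinfun_inner_right z
     + (- 6 * c * max 0 (1 - c * (z \<bullet> z)) ^ 2) *\<^sub>R blinfun_inner_right h"
  unfolding bump_deriv2_def
  by (subst bounded_linear_Blinfun_apply)
     (intro bounded_linear_add bounded_linear_scaleR_const bounded_linear_const_mult bounded_linear_inner_right
        bounded_linear_const_scaleR bounded_linear_blinfun_inner_right bounded_linear_ident refl)+

lemma bump_deriv_has_derivative: "(bump_deriv c has_derivative blinfun_apply (bump_deriv2 c z)) (at z)"
proof -
  have 1: "((\<lambda>z. 1 - c * (z \<bullet> z)) has_derivative (\<lambda>h. - (c * (z \<bullet> h + h \<bullet> z)))) (at z)"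
    by (auto intro!: derivative_eq_intros)
  note 2 = has_derivative_pos_part_power[OF 1, of 0, simplified]
  have 3: "((\<lambda>z. - 6 * c * max 0 (1 - c * (z \<bullet> z)) ^ 2) has_derivative
     (\<lambda>h. - 6 * c * (2 * max 0 (1 - c * (z \<bullet> z)) * - (c * (z \<bullet> h + h \<bullet> z))))) (at z)"
    using has_derivative_mult_right[OF 2, of "- 6 * c"] by (simp add: numeral_2_eq_2)
  have 4: "(blinfun_inner_right has_derivative blinfun_inner_right) (at z)"
    by (rule bounded_linear_imp_has_derivative[OF bounded_linear_blinfun_inner_right])
  show ?thesis
    unfolding bump_deriv_def[abs_def]
    by (rule has_derivative_eq_rhs[OF has_derivative_scaleR[OF 3 4]])
       (simp add: fun_eq_iff bump_deriv2_apply inner_commute power2_eq_square algebra_simps)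
qed

lemma bump_continuous: "continuous_on S (bump c)"
  unfolding bump_def[abs_def] by (intro continuous_intros)

lemma bump_deriv_continuous: "continuous_on S (bump_deriv c)"
  unfolding bump_deriv_def[abs_def]
  by (intro continuous_intros bounded_linear.continuous_on[OF bounded_linear_blinfun_inner_right])

lemma bump_deriv2_continuous: "continuous_on S (bump_deriv2 c)"
proof (rule continuous_on_blinfun_componentwise)
  fix i :: 'a
  show "continuous_on S (\<lambda>z. blinfun_apply (bump_deriv2 c z) i)"
    unfolding bump_deriv2_apply
    by (intro continuous_intros bounded_linear.continuous_on[OF bounded_linear_blinfun_inner_right])
qed

lemma bump_nonneg: "0 \<le> bump c z" by (simp add: bump_def)

lemma bump_eq_0: "1 \<le> c * (norm z)\<^sup>2 \<Longrightarrow> bump c z = 0"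
  by (simp add: bump_def power2_norm_eq_inner)

text \<open>
  Both derivatives fall on the bump function and are taken under the integral sign.
\<close>

lemma bump_convolution_C2c:
  fixes g :: "'a::euclidean_space \<Rightarrow> real"
  assumes g: "continuous_on UNIV g" and c: "0 < c"
  shows "(\<lambda>x. integral (cbox l u) (\<lambda>y. bump c (x - y) * g y)) \<in> C2c"
proof -
  let ?f = "\<lambda>x. integral (cbox l u) (\<lambda>y. bump c (x - y) * g y)"
  let ?D = "\<lambda>x. integral (cbox l u) (\<lambda>y. g y *\<^sub>R bump_deriv c (x - y))"
  let ?D2 = "\<lambda>x. integral (cbox l u) (\<lambda>y. g y *\<^sub>R bump_deriv2 c (x - y))"
  have g': "continuous_on S (\<lambda>z. g (s z))" if "continuous_on S s" for S and s :: "'b::topological_space \<Rightarrow> 'a"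
    by (rule continuous_on_compose2[OF g that]) auto
  have comp: "continuous_on S (\<lambda>z. F (s z))" if "continuous_on UNIV F" "continuous_on S s"
    for S and s :: "'b::topological_space \<Rightarrow> 'a" and F :: "'a \<Rightarrow> 'c::topological_space"
    by (rule continuous_on_compose2[OF that]) auto
  have "(?f has_derivative blinfun_apply (?D x)) (at x)" for x
  proof (rule leibniz_rule[where U = UNIV, simplified])
    fix x t :: 'a
    have s: "((\<lambda>x. x - t) has_derivative (\<lambda>h. h)) (at x)" by (auto intro!: derivative_eq_intros)
    show "((\<lambda>x. bump c (x - t) * g t) has_derivative blinfun_apply (g t *\<^sub>R bump_deriv c (x - t))) (at x)"
      using has_derivative_mult_left[OF has_derivative_compose[OF s bump_has_derivative], of c "g t"]
      by (rule has_derivative_eq_rhs) (auto simp: fun_eq_iff blinfun.scaleR_left)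
  next
    fix x :: 'a show "(\<lambda>y. bump c (x - y) * g y) integrable_on cbox l u"
      by (intro integrable_continuous continuous_intros comp[OF bump_continuous] g')
  next
    show "continuous_on (UNIV \<times> cbox l u) (\<lambda>(x, t). g t *\<^sub>R bump_deriv c (x - t))"
      unfolding split_beta' by (intro continuous_intros comp[OF bump_deriv_continuous] g')
  qed
  moreover have "(?D has_derivative blinfun_apply (?D2 x)) (at x)" for x
  proof (rule leibniz_rule[where U = UNIV, simplified])
    fix x t :: 'a
    have s: "((\<lambda>x. x - t) has_derivative (\<lambda>h. h)) (at x)" by (auto intro!: derivative_eq_intros)
    show "((\<lambda>x. g t *\<^sub>R bump_deriv c (x - t)) has_derivative blinfun_apply (g t *\<^sub>R bump_deriv2 c (x - t))) (at x)"
      using has_derivative_scaleR_right[OF has_derivative_compose[OF s bump_deriv_has_derivative], of "g t" c]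
      by (rule has_derivative_eq_rhs) (auto simp: fun_eq_iff blinfun.scaleR_left)
  next
    fix x :: 'a show "(\<lambda>y. g y *\<^sub>R bump_deriv c (x - y)) integrable_on cbox l u"
      by (intro integrable_continuous continuous_intros comp[OF bump_deriv_continuous] g')
  next
    show "continuous_on (UNIV \<times> cbox l u) (\<lambda>(x, t). g t *\<^sub>R bump_deriv2 c (x - t))"
      unfolding split_beta' by (intro continuous_intros comp[OF bump_deriv2_continuous] g')
  qed
  moreover have "continuous_on UNIV ?D2"
    by (rule integral_continuous_on_param)
       (unfold split_beta', intro continuous_intros comp[OF bump_deriv2_continuous] g')
  moreover have "compact (closure {x. ?f x \<noteq> 0})"
  proof -
    obtain B where B: "\<And>y. y \<in> cbox l u \<Longrightarrow> norm y \<le> B" using bounded_cbox[of l u] by (auto simp: bounded_iff)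
    have "norm x \<le> B + 1 / sqrt c" if "?f x \<noteq> 0" for x
    proof (rule ccontr)
      assume n: "\<not> norm x \<le> B + 1 / sqrt c"
      have "bump c (x - y) * g y = 0" if "y \<in> cbox l u" for y
      proof -
        have "1 / sqrt c \<le> norm (x - y)" using n B[OF that] norm_triangle_ineq2[of x y] by linarith
        then have "(1 / sqrt c)\<^sup>2 \<le> (norm (x - y))\<^sup>2" using c by (intro power_mono) auto
        then have "1 \<le> c * (norm (x - y))\<^sup>2" using c by (simp add: power_divide field_simps)
        then show ?thesis by (simp add: bump_eq_0)
      qed
      then have "?f x = integral (cbox l u) (\<lambda>y. 0)" by (intro integral_cong) auto
      then show False using that by simp
    qed
    then have "bounded {x. ?f x \<noteq> 0}" by (auto simp: bounded_iff)
    then show ?thesis by simp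
  qed
  ultimately show ?thesis
    unfolding C2c_def mem_Collect_eq by (intro conjI exI[of _ ?D] exI[of _ ?D2] allI)
qed

lemma lborel_reflect:
  fixes f :: "'a::euclidean_space \<Rightarrow> real"
  assumes [measurable]: "f \<in> borel_measurable borel"
  shows "(LINT y|lborel. f (x - y)) = (LINT y|lborel. f y)"
proof -
  have "lborel = distr lborel borel (\<lambda>y. x + (- 1) *\<^sub>R y)"
    using lborel_affine[of "- 1" x] by (simp add: density_1 del: scaleR_minus_left)
  then have "(LINT y|lborel. f y) = (LINT y|distr lborel borel (\<lambda>y. x + (- 1) *\<^sub>R y). f y)" by simp
  also have "\<dots> = (LINT y|lborel. f (x - y))" by (subst integral_distr) auto
  finally show ?thesis by simp
qed

lemma bump_integrable:
  assumes "0 < c"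
  shows "integrable lborel (bump c :: 'a::euclidean_space \<Rightarrow> real)" "0 < (LINT z|lborel. bump c (z::'a))"
proof -
  have z: "bump c z = 0" if "z \<notin> cball 0 (1 / sqrt c)" for z :: 'a
  proof -
    have "1 / sqrt c \<le> norm z" using that by (simp add: not_le less_imp_le)
    then have "(1 / sqrt c)\<^sup>2 \<le> (norm z)\<^sup>2" using assms by (intro power_mono) auto
    then show ?thesis using assms by (intro bump_eq_0) (simp add: power_divide field_simps)
  qed
  have "integrable lborel (\<lambda>z::'a. indicator (cball 0 (1 / sqrt c)) z *\<^sub>R bump c z)"
    by (intro borel_integrable_compact bump_continuous) auto
  then show int: "integrable lborel (bump c :: 'a \<Rightarrow> real)"
    by (rule Bochner_Integration.integrable_cong[THEN iffD1, rotated 2]) (use z in \<open>auto simp: indicator_def simp del: mem_cball\<close>)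
  have "(LINT z|lborel. bump c (z::'a)) \<noteq> 0"
  proof
    assume "(LINT z|lborel. bump c (z::'a)) = 0"
    then have "AE z in lborel. bump c (z::'a) = 0"
      using integral_nonneg_eq_0_iff_AE[OF int] bump_nonneg by auto
    then have "AE z in lebesgue. (z::'a) \<in> {z. bump c z = 0}" by (intro AE_completion) simp
    moreover have "closed {z::'a. bump c z = 0}"
      by (intro closed_Collect_eq bump_continuous continuous_on_const)
    ultimately have "(0::'a) \<in> {z. bump c z = 0}"
      by (intro mem_closed_if_AE_lebesgue)
    then have "bump c (0::'a) = 0" by blast
    then show False by (simp add: bump_def)
  qed
  moreover have "0 \<le> (LINT z|lborel. bump c (z::'a))"
    by (intro Bochner_Integration.integral_nonneg bump_nonneg)
  ultimately show "0 < (LINT z|lborel. bump c (z::'a))" by simp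
qed

text \<open>
  Averaging against a probability density preserves the Lipschitz constant and the bound, and moves the function by
  at most \<open>K\<close> times the radius of the support of the density.
\<close>

lemma lipschitz_compact_support_approx:
  fixes g :: "real \<times> real \<Rightarrow> real"
  assumes g: "lipschitz_fun K g" and supp: "\<And>x. R < norm x \<Longrightarrow> g x = 0" and bd: "\<And>x. \<bar>g x\<bar> \<le> B"
  obtains f where "\<And>n::nat. f n \<in> C2c" "\<And>n. lipschitz_fun K (f n)" "\<And>n x. \<bar>f n x\<bar> \<le> B"
    "\<And>x. (\<lambda>n. f n x) \<longlonglongrightarrow> g x"
proof -
  have K: "0 \<le> K" using lipschitz_fun_nonneg[OF g] .
  have gc: "continuous_on UNIV g" using lipschitz_fun_continuous[OF g] .
  have [measurable]: "g \<in> borel_measurable borel" using lipschitz_fun_measurable[OF g] .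
  have [measurable]: "bump c \<in> borel_measurable borel" for c :: real
    by (intro borel_measurable_continuous_onI bump_continuous)
  obtain u where u: "cball 0 R \<subseteq> cbox (- u) (u :: real \<times> real)"
    using bounded_subset_cbox_symmetric[OF bounded_cball] by metis
  define c where "c n = (real (Suc n))\<^sup>2" for n
  have c: "0 < c n" for n by (simp add: c_def)
  define N where "N n = (LINT z|lborel. bump (c n) (z::real\<times>real))" for n
  have N: "0 < N n" for n unfolding N_def by (rule bump_integrable(2)[OF c])
  note ib = bump_integrable(1)[OF c]
  define f where "f n x = integral (cbox (- u) u) (\<lambda>y. bump (c n) (x - y) * (g y / N n))" for n x
  have int: "integrable lborel (\<lambda>y. bump (c n) y * g (x - y))" for n x
  proof (rule Bochner_Integration.integrable_bound)
    show "integrable lborel (\<lambda>y::real\<times>real. bump (c n) y * B)" using ib by auto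
    show "AE y in lborel. norm (bump (c n) y * g (x - y)) \<le> norm (bump (c n) y * B)"
      using bd bump_nonneg[of "c n"] by (intro always_eventually allI) (auto simp: abs_mult intro!: mult_left_mono order_trans[OF bd])
  qed measurable
  have f_eq: "f n x = (LINT y|lborel. bump (c n) y * g (x - y)) / N n" for n x
  proof -
    have "set_integrable lborel (cbox (- u) u) (\<lambda>y. bump (c n) (x - y) * (g y / N n))"
      unfolding set_integrable_def
      by (intro borel_integrable_compact continuous_intros continuous_on_compose2[OF bump_continuous]
          continuous_on_subset[OF gc]) (use N[of n] in auto)
    then have "f n x = (LINT y:cbox (- u) u|lborel. bump (c n) (x - y) * (g y / N n))"
      unfolding f_def by (rule set_borel_integral_eq_integral(2)[symmetric])
    also have "\<dots> = (LINT y|lborel. bump (c n) (x - y) * g y / N n)"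
      unfolding set_lebesgue_integral_def
    proof (intro Bochner_Integration.integral_cong refl)
      fix y
      show "indicator (cbox (- u) u) y *\<^sub>R (bump (c n) (x - y) * (g y / N n)) = bump (c n) (x - y) * g y / N n"
      proof (cases "y \<in> cbox (- u) u")
        case False
        then have "y \<notin> cball 0 R" using u by blast
        then have "g y = 0" by (intro supp) simp
        then show ?thesis by simp
      qed simp
    qed
    also have "\<dots> = (LINT y|lborel. bump (c n) (x - y) * g y) / N n" by simp
    also have "(LINT y|lborel. bump (c n) (x - y) * g y) = (LINT y|lborel. bump (c n) y * g (x - y))"
      using lborel_reflect[of "\<lambda>y. bump (c n) y * g (x - y)" x] by simp
    finally show ?thesis .
  qed
  have avg: "\<bar>(LINT y|lborel. bump (c n) y * F y) / N n\<bar> \<le> M"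
    if F: "integrable lborel (\<lambda>y. bump (c n) y * F y)" "\<And>y. bump (c n) y \<noteq> 0 \<Longrightarrow> \<bar>F y\<bar> \<le> M" for n M and F :: "real \<times> real \<Rightarrow> real"
  proof -
    have "\<bar>LINT y|lborel. bump (c n) y * F y\<bar> \<le> (LINT y|lborel. norm (bump (c n) y * F y))"
      using integral_norm_bound[of lborel "\<lambda>y. bump (c n) y * F y"] by simp
    also have "\<dots> \<le> (LINT y|lborel. bump (c n) (y::real\<times>real) * M)"
    proof (rule integral_mono_AE)
      show "integrable lborel (\<lambda>y. norm (bump (c n) y * F y))" by (rule integrable_norm[OF F(1)])
      show "integrable lborel (\<lambda>y::real\<times>real. bump (c n) y * M)" by (rule integrable_mult_left[OF ib])
      have "norm (bump (c n) y * F y) \<le> bump (c n) y * M" for y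
        using F(2)[of y] bump_nonneg[of "c n" y] by (cases "bump (c n) y = 0") (auto simp: abs_mult)
      then show "AE y in lborel. norm (bump (c n) y * F y) \<le> bump (c n) y * M" by simp
    qed
    also have "\<dots> = M * N n" by (simp add: N_def)
    finally show ?thesis using N[of n] by (simp add: abs_divide pos_divide_le_eq)
  qed
  show ?thesis
  proof
    show "f n \<in> C2c" for n
      unfolding f_def using gc N[of n] by (intro bump_convolution_C2c c continuous_intros) auto
    show "\<bar>f n x\<bar> \<le> B" for n x unfolding f_eq by (rule avg[OF int bd])
    show "lipschitz_fun K (f n)" for n
      unfolding lipschitz_fun_def
    proof (intro allI)
      fix x x'
      have "f n x - f n x' = (LINT y|lborel. bump (c n) y * (g (x - y) - g (x' - y))) / N n"
        unfolding f_eq diff_divide_distrib[symmetric] right_diff_distrib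
        by (subst Bochner_Integration.integral_diff[OF int int]) simp
      also have "\<bar>\<dots>\<bar> \<le> K * norm (x - x')"
      proof (rule avg)
        show "integrable lborel (\<lambda>y. bump (c n) y * (g (x - y) - g (x' - y)))"
          unfolding right_diff_distrib by (rule Bochner_Integration.integrable_diff[OF int int])
        show "\<bar>g (x - y) - g (x' - y)\<bar> \<le> K * norm (x - x')" for y
          using lipschitz_funD[OF g, of "x - y" "x' - y"] by simp
      qed
      finally show "\<bar>f n x - f n x'\<bar> \<le> K * norm (x - x')" .
    qed
    show "(\<lambda>n. f n x) \<longlonglongrightarrow> g x" for x
    proof (rule LIM_zero_cancel, rule Lim_null_comparison)
      have "\<bar>f n x - g x\<bar> \<le> K * (1 / real (Suc n))" for n
      proof -
        have "g x = (LINT y|lborel. bump (c n) (y::real\<times>real) * g x) / N n" using N[of n] by (simp add: N_def)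
        then have "f n x - g x = (LINT y|lborel. bump (c n) y * (g (x - y) - g x)) / N n"
          unfolding f_eq right_diff_distrib
          by (subst Bochner_Integration.integral_diff[OF int integrable_mult_left[OF ib]])
             (simp add: diff_divide_distrib)
        also have "\<bar>\<dots>\<bar> \<le> K * (1 / real (Suc n))"
        proof (rule avg)
          show "integrable lborel (\<lambda>y. bump (c n) y * (g (x - y) - g x))"
            unfolding right_diff_distrib by (rule Bochner_Integration.integrable_diff[OF int integrable_mult_left[OF ib]])
          fix y :: "real \<times> real" assume "bump (c n) y \<noteq> 0"
          then have "c n * (norm y)\<^sup>2 < 1" using bump_eq_0[of "c n" y] by force
          then have "(real (Suc n) * norm y)\<^sup>2 < 1\<^sup>2" by (simp add: c_def power_mult_distrib)
          then have "real (Suc n) * norm y < 1" by (rule power_less_imp_less_base) simp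
          then have "norm y \<le> 1 / real (Suc n)" by (simp add: field_simps)
          then have "K * norm y \<le> K * (1 / real (Suc n))" using K by (intro mult_left_mono)
          then show "\<bar>g (x - y) - g x\<bar> \<le> K * (1 / real (Suc n))"
            using lipschitz_funD[OF g, of "x - y" x] by simp
        qed
        finally show ?thesis .
      qed
      then show "\<forall>\<^sub>F n in sequentially. norm (f n x - g x) \<le> K * (1 / real (Suc n))" by simp
      show "(\<lambda>n. K * (1 / real (Suc n))) \<longlonglongrightarrow> 0"
        using tendsto_mult[OF tendsto_const[of K] lim_inverse_n'[THEN LIMSEQ_Suc]] by simp
    qed
  qed
qed

definition cutoff :: "nat \<Rightarrow> real \<times> real \<Rightarrow> real" where
  "cutoff n x = max 0 (min 1 (real n + 1 - norm x))"

lemma cutoff_properties: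
  "0 \<le> cutoff n x" "cutoff n x \<le> 1" "real n + 1 < norm x \<Longrightarrow> cutoff n x = 0" "norm x \<le> real n \<Longrightarrow> cutoff n x = 1"
  "\<bar>cutoff n x - cutoff n y\<bar> \<le> norm (x - y)"
  using norm_triangle_ineq3[of x y] by (auto simp: cutoff_def)

lemma lipschitz_cutoff:
  assumes g: "lipschitz_fun K g" and bd: "\<And>x. \<bar>g x\<bar> \<le> B"
  shows "lipschitz_fun (K + B) (\<lambda>x. g x * cutoff n x)" "\<bar>g x * cutoff n x\<bar> \<le> B"
    "(\<lambda>n. g x * cutoff n x) \<longlonglongrightarrow> g x"
proof -
  have B: "0 \<le> B" using bd[of 0] by linarith
  show "lipschitz_fun (K + B) (\<lambda>x. g x * cutoff n x)"
    unfolding lipschitz_fun_def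
  proof (intro allI)
    fix x y
    have "g x * cutoff n x - g y * cutoff n y = (g x - g y) * cutoff n x + g y * (cutoff n x - cutoff n y)"
      by (simp add: algebra_simps)
    also have "\<bar>\<dots>\<bar> \<le> \<bar>g x - g y\<bar> * cutoff n x + \<bar>g y\<bar> * \<bar>cutoff n x - cutoff n y\<bar>"
      using abs_triangle_ineq[of "(g x - g y) * cutoff n x" "g y * (cutoff n x - cutoff n y)"] cutoff_properties(1)[of n x] by (simp add: abs_mult)
    also have "\<dots> \<le> (K * norm (x - y)) * 1 + B * norm (x - y)"
      using B lipschitz_fun_nonneg[OF g] by (intro add_mono mult_mono lipschitz_funD[OF g] bd cutoff_properties) auto
    finally show "\<bar>g x * cutoff n x - g y * cutoff n y\<bar> \<le> (K + B) * norm (x - y)" by (simp add: algebra_simps)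
  qed
  show "\<bar>g x * cutoff n x\<bar> \<le> B"
    using mult_mono[OF bd[of x] cutoff_properties(2)[of n x]] B cutoff_properties(1)[of n x] by (simp add: abs_mult)
  have "\<forall>\<^sub>F n in sequentially. g x * cutoff n x = g x"
    using eventually_ge_at_top[of "nat \<lceil>norm x\<rceil>"] by eventually_elim (simp add: cutoff_properties(4))
  then show "(\<lambda>n. g x * cutoff n x) \<longlonglongrightarrow> g x" by (rule tendsto_eventually)
qed

section \<open>Expectations along cadlag paths\<close>

lemma coord_measurable:
  "s \<in> T \<Longrightarrow> (\<lambda>\<omega>. \<omega> s) \<in> measurable (coord_sigma T) (borel :: 'a::euclidean_space measure)"
proof (rule measurableI)
  fix A :: "'a set" assume "s \<in> T" "A \<in> sets borel"
  then have "(\<lambda>\<omega>. \<omega> s) -` A \<inter> cadlag_paths \<in>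
      sigma_sets cadlag_paths {(\<lambda>\<omega>. \<omega> s) -` A \<inter> cadlag_paths | s A. s \<in> T \<and> A \<in> sets borel}"
    by (intro sigma_sets.Basic) auto
  then show "(\<lambda>\<omega>. \<omega> s) -` A \<inter> space (coord_sigma T) \<in> sets (coord_sigma T)"
    unfolding space_coord_sigma unfolding coord_sigma_def by (subst sets_measure_of) auto
qed simp

lemma cadlag_right_limit:
  assumes "\<omega> \<in> cadlag_paths" "0 \<le> u" "u_seq \<longlonglongrightarrow> u" "\<And>n. u < u_seq n"
  shows "(\<lambda>n::nat. \<omega> (u_seq n)) \<longlonglongrightarrow> \<omega> u"
proof -
  have "(\<omega> \<longlongrightarrow> \<omega> u) (at_right u)"
    using assms(1,2) by (simp add: cadlag_paths_def continuous_within)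
  moreover have "filterlim u_seq (at_right u) sequentially"
    using assms(3,4) by (simp add: filterlim_at less_imp_neq[OF assms(4), symmetric])
  ultimately show ?thesis by (rule filterlim_compose)
qed

lemma C2c_lipschitz_bounded:
  assumes "f \<in> C2c"
  obtains K B where "lipschitz_fun K f" "\<And>x. \<bar>f x\<bar> \<le> B"
proof -
  obtain D D2 where D: "\<And>x. (f has_derivative blinfun_apply (D x)) (at x)"
      "\<And>x. (D has_derivative blinfun_apply (D2 x)) (at x)" and K: "compact (closure {x. f x \<noteq> 0})"
    using assms unfolding C2c_def by blast
  let ?S = "closure {x. f x \<noteq> 0}"
  have contD: "continuous_on UNIV D"
    by (intro continuous_at_imp_continuous_on ballI has_derivative_continuous[OF D(2)])
  have contf: "continuous_on UNIV f"
    by (intro continuous_at_imp_continuous_on ballI has_derivative_continuous[OF D(1)])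
  have "bounded (D ` ?S)"
    by (intro compact_imp_bounded compact_continuous_image continuous_on_subset[OF contD] K) auto
  then obtain N where N: "\<And>x. x \<in> ?S \<Longrightarrow> norm (D x) \<le> N" by (auto simp: bounded_iff)
  have "bounded (f ` ?S)"
    by (intro compact_imp_bounded compact_continuous_image continuous_on_subset[OF contf] K) auto
  then obtain B where B: "\<And>x. x \<in> ?S \<Longrightarrow> norm (f x) \<le> B" by (auto simp: bounded_iff)
  have D0: "D x = 0" if "x \<notin> ?S" for x
  proof -
    have "((\<lambda>x. 0) has_derivative blinfun_apply (D x)) (at x)"
    proof (rule has_derivative_transform_within_open[OF D(1)])
      show "open (- ?S)" by (intro open_Compl closed_closure)
      show "x \<in> - ?S" using that by simp
      show "f y = 0" if "y \<in> - ?S" for y using that closure_subset[of "{x. f x \<noteq> 0}"] by auto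
    qed
    then have "blinfun_apply (D x) = (\<lambda>h. 0)"
      using has_derivative_unique[OF _ has_derivative_const] by blast
    then show ?thesis by (intro blinfun_eqI) simp
  qed
  have DN: "norm (D x) \<le> max 0 N" for x using N[of x] D0[of x] by (cases "x \<in> ?S") auto
  have "\<bar>f x - f y\<bar> \<le> max 0 N * norm (x - y)" for x y
  proof -
    have "norm (f x - f y) \<le> max 0 N * norm (x - y)"
      using D(1) DN by (intro differentiable_bound[where S = UNIV and f' = "\<lambda>x. blinfun_apply (D x)"])
        (auto simp: norm_blinfun.rep_eq[symmetric])
    then show ?thesis by simp
  qed
  then have "lipschitz_fun (max 0 N) f" unfolding lipschitz_fun_def by blast
  moreover have "\<bar>f x\<bar> \<le> max 0 B" for x
  proof (cases "f x = 0")
    case False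
    then have "x \<in> ?S" using closure_subset[of "{x. f x \<noteq> 0}"] by blast
    then show ?thesis using B[of x] by simp
  qed simp
  ultimately show ?thesis by (rule that)
qed

locale path_prob = prob_space P for P :: "(real \<Rightarrow> real \<times> real) measure" +
  assumes sets_P: "sets P = sets path_space"
begin

lemma space_P: "space P = cadlag_paths"
  using sets_eq_imp_space_eq[OF sets_P] by (simp add: path_space_def space_coord_sigma)

lemma coord_measurable_P [measurable]: "0 \<le> s \<Longrightarrow> (\<lambda>\<omega>. \<omega> s) \<in> borel_measurable P"
  using coord_measurable[of s "{0..}"] measurable_cong_sets[OF sets_P refl] by (auto simp: path_space_def)

lemma subalgebra_P: "subalgebra P (path_filtration t)"
  by (rule subalgebra_path_filtration[OF sets_P])

lemma filtration_sets: "A \<in> sets (path_filtration t) \<Longrightarrow> A \<in> sets P"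
  using subalgebra_P[of t] by (auto simp: subalgebra_def)

text \<open>
  By right continuity a path is the limit of its values at the next grid point to the right, and the
  discretised paths take only countably many coordinates into account. The maximum with \<open>0\<close>
  makes the map total in \<open>u\<close>.
\<close>

lemma jointly_measurable: "(\<lambda>(u, \<omega>). \<omega> (max 0 u)) \<in> borel_measurable (lborel \<Otimes>\<^sub>M P)"
proof (rule borel_measurable_LIMSEQ_metric)
  fix n :: nat
  have m: "(\<lambda>p. \<lfloor>real (Suc n) * fst p\<rfloor>) \<in> measurable (lborel \<Otimes>\<^sub>M P) (count_space UNIV)"
    by measurable
  have "(\<lambda>p. snd p (max 0 ((real_of_int i + 1) / real (Suc n)))) \<in> borel_measurable (lborel \<Otimes>\<^sub>M P)" for i
    by (rule measurable_compose[OF measurable_snd coord_measurable_P]) simp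
  then have "(\<lambda>p. snd p (max 0 ((real_of_int \<lfloor>real (Suc n) * fst p\<rfloor> + 1) / real (Suc n)))) \<in> borel_measurable (lborel \<Otimes>\<^sub>M P)"
    by (rule measurable_compose_countable[OF _ m])
  then show "(\<lambda>(u, \<omega>). \<omega> (max 0 ((real_of_int \<lfloor>real (Suc n) * u\<rfloor> + 1) / real (Suc n)))) \<in> borel_measurable (lborel \<Otimes>\<^sub>M P)"
    by (simp add: split_beta')
next
  fix p assume "p \<in> space ((lborel :: real measure) \<Otimes>\<^sub>M P)"
  then obtain u \<omega> where p: "p = (u, \<omega>)" and \<omega>: "\<omega> \<in> cadlag_paths" by (auto simp: space_pair_measure space_P)
  define t where "t n = (real_of_int \<lfloor>real (Suc n) * u\<rfloor> + 1) / real (Suc n)" for n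
  have t1: "u < t n" "t n \<le> u + 1 / real (Suc n)" for n
  proof -
    define y where "y = real (Suc n)"
    have "y * u < real_of_int \<lfloor>y * u\<rfloor> + 1" "real_of_int \<lfloor>y * u\<rfloor> \<le> y * u" "0 < y" by (simp_all add: y_def)
    then have "(y * u) / y < (real_of_int \<lfloor>y * u\<rfloor> + 1) / y" "(real_of_int \<lfloor>y * u\<rfloor> + 1) / y \<le> (y * u + 1) / y"
      by (intro divide_strict_right_mono divide_right_mono; linarith)+
    then have "u < (real_of_int \<lfloor>y * u\<rfloor> + 1) / y" "(real_of_int \<lfloor>y * u\<rfloor> + 1) / y \<le> u + 1 / y"
      using \<open>0 < y\<close> by (simp_all add: add_divide_distrib)
    then show "u < t n" "t n \<le> u + 1 / real (Suc n)" by (simp_all only: t_def y_def)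
  qed
  have tl: "t \<longlonglongrightarrow> u"
  proof (rule tendsto_sandwich[of "\<lambda>_. u" t _ "\<lambda>n. u + 1 / real (Suc n)"])
    show "\<forall>\<^sub>F n in sequentially. u \<le> t n" "\<forall>\<^sub>F n in sequentially. t n \<le> u + 1 / real (Suc n)"
      using t1 by (simp_all only: less_imp_le eventually_True)
    show "(\<lambda>n. u + 1 / real (Suc n)) \<longlonglongrightarrow> u"
      using tendsto_add[OF tendsto_const[of u] lim_inverse_n'[THEN LIMSEQ_Suc]] by simp
  qed (rule tendsto_const)
  have "(\<lambda>n. \<omega> (max 0 (t n))) \<longlonglongrightarrow> \<omega> (max 0 u)"
  proof (cases "0 \<le> u")
    case True
    then have "max 0 (t n) = t n" "max 0 u = u" for n using t1[of n] by auto
    then show ?thesis using cadlag_right_limit[OF \<omega> True tl] t1 by simp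
  next
    case False
    then have "\<forall>\<^sub>F n in sequentially. t n < 0" using tl by (intro order_tendstoD(2)) auto
    then have "\<forall>\<^sub>F n in sequentially. \<omega> (max 0 (t n)) = \<omega> (max 0 u)"
      by eventually_elim (use False in simp)
    then show ?thesis by (rule tendsto_eventually)
  qed
  then show "(\<lambda>n. case p of (u, \<omega>) \<Rightarrow> \<omega> (max 0 ((real_of_int \<lfloor>real (Suc n) * u\<rfloor> + 1) / real (Suc n)))) \<longlonglongrightarrow> (case p of (u, \<omega>) \<Rightarrow> \<omega> (max 0 u))"
    by (simp add: p t_def)
qed

context
  fixes g :: "real \<times> real \<Rightarrow> real" and B :: real
  assumes g [measurable]: "g \<in> borel_measurable borel" and bd: "\<And>x. \<bar>g x\<bar> \<le> B"
begin

lemma g_joint [measurable]: "(\<lambda>(u, \<omega>). g (\<omega> (max 0 u))) \<in> borel_measurable (lborel \<Otimes>\<^sub>M P)"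
  using measurable_compose[OF jointly_measurable g] by (simp add: split_beta')

lemma g_path_measurable: "\<omega> \<in> cadlag_paths \<Longrightarrow> (\<lambda>u. g (\<omega> (max 0 u))) \<in> borel_measurable lborel"
  using measurable_compose[OF measurable_Pair2'[of \<omega> P lborel] g_joint] by (simp add: space_P)

lemma bound_nonneg: "0 \<le> B" using bd[of 0] by linarith

lemma path_set_integrable:
  assumes "\<omega> \<in> cadlag_paths" "0 \<le> s" "S \<subseteq> {s..t}" "S \<in> sets borel"
  shows "set_integrable lborel S (\<lambda>u. g (\<omega> u))"
proof -
  have meas: "(\<lambda>u. g (\<omega> (max 0 u))) \<in> borel_measurable lborel"
    using g_path_measurable[OF assms(1)] .
  have fin: "emeasure lborel S < \<infinity>"
    using emeasure_mono[OF assms(3), of lborel] by (auto simp: le_less_trans emeasure_lborel_Icc_eq)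
  have "integrable lborel (\<lambda>u. indicator S u *\<^sub>R g (\<omega> (max 0 u)))"
  proof (rule integrableI_bounded_set_indicator[where B = B])
    show "AE u in lborel. u \<in> S \<longrightarrow> norm (g (\<omega> (max 0 u))) \<le> B" using bd by simp
    show "S \<in> sets lborel" using assms(4) by simp
  qed (fact fin meas)+
  then show ?thesis unfolding set_integrable_def
    by (rule Bochner_Integration.integrable_cong[THEN iffD1, rotated 2]) (use assms in \<open>auto simp: indicator_def max_def subset_eq\<close>)
qed

lemma path_integral_split:
  assumes "\<omega> \<in> cadlag_paths" "0 \<le> s" "s \<le> t"
  shows "(LINT u:{0..t}|lborel. g (\<omega> u)) = (LINT u:{0..s}|lborel. g (\<omega> u)) + (LINT u:{s..t}|lborel. g (\<omega> u))"
proof -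
  have "(LINT u:{0..t}|lborel. g (\<omega> u)) = (LINT u:{0..s} \<union> {s<..t}|lborel. g (\<omega> u))"
    using assms by (intro arg_cong[where f = "\<lambda>A. LINT u:A|lborel. g (\<omega> u)"]) auto
  also have "\<dots> = (LINT u:{0..s}|lborel. g (\<omega> u)) + (LINT u:{s<..t}|lborel. g (\<omega> u))"
    using assms by (intro set_integral_Un path_set_integrable[where s = 0 and t = t]) auto
  also have "(LINT u:{s<..t}|lborel. g (\<omega> u)) = (LINT u:{s..t}|lborel. g (\<omega> u))"
    unfolding set_lebesgue_integral_def
  proof (rule integral_cong_AE)
    show "AE u in lborel. indicator {s<..t} u *\<^sub>R g (\<omega> u) = indicator {s..t} u *\<^sub>R g (\<omega> u)"
      using AE_lborel_singleton[of s] by eventually_elim (auto simp: indicator_def)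
  next
    show "(\<lambda>u. indicator {s<..t} u *\<^sub>R g (\<omega> u)) \<in> borel_measurable lborel"
      by (rule borel_measurable_integrable[OF path_set_integrable[OF assms(1,2), of "{s<..t}" t, unfolded set_integrable_def]]) auto
    show "(\<lambda>u. indicator {s..t} u *\<^sub>R g (\<omega> u)) \<in> borel_measurable lborel"
      by (rule borel_measurable_integrable[OF path_set_integrable[OF assms(1,2), of "{s..t}" t, unfolded set_integrable_def]]) auto
  qed
  finally show ?thesis .
qed

lemma path_integral_bound:
  assumes "\<omega> \<in> cadlag_paths" "0 \<le> s" "s \<le> t"
  shows "\<bar>LINT u:{s..t}|lborel. g (\<omega> u)\<bar> \<le> B * (t - s)"
proof -
  have int: "integrable lborel (\<lambda>u. indicator {s..t} u *\<^sub>R g (\<omega> u))"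
    using path_set_integrable[OF assms(1,2), of "{s..t}" t] unfolding set_integrable_def by simp
  have intB: "integrable lborel (\<lambda>u. indicator {s..t} u * B)"
    by (intro integrable_mult_left integrable_real_indicator) (simp_all add: emeasure_lborel_Icc_eq)
  have "\<bar>LINT u|lborel. indicator {s..t} u *\<^sub>R g (\<omega> u)\<bar> \<le> (LINT u|lborel. \<bar>indicator {s..t} u *\<^sub>R g (\<omega> u)\<bar>)"
    by (rule integral_abs_bound)
  also have "\<dots> \<le> (LINT u|lborel. indicator {s..t} u * B)"
  proof (rule integral_mono_AE[OF integrable_abs[OF int] intB])
    show "AE u in lborel. \<bar>indicator {s..t} u *\<^sub>R g (\<omega> u)\<bar> \<le> indicator {s..t} u * B"
      using bd by (intro always_eventually allI) (simp add: indicator_def)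
  qed
  also have "\<dots> = B * (t - s)" using assms by simp
  finally show ?thesis unfolding set_lebesgue_integral_def .
qed

lemma expectation_integrable:
  assumes "0 \<le> u" "A \<in> sets P" shows "set_integrable P A (\<lambda>\<omega>. g (\<omega> u))"
  unfolding set_integrable_def
proof (rule integrable_mult_indicator[OF assms(2)])
  show "integrable P (\<lambda>\<omega>. g (\<omega> u))"
  proof (rule integrable_const_bound)
    show "AE \<omega> in P. norm (g (\<omega> u)) \<le> B" using bd by simp
    show "(\<lambda>\<omega>. g (\<omega> u)) \<in> borel_measurable P"
      by (rule measurable_compose[OF coord_measurable_P[OF assms(1)] g])
  qed
qed

lemma expectation_bound:
  assumes "0 \<le> u" "A \<in> sets P" shows "\<bar>LINT \<omega>:A|P. g (\<omega> u)\<bar> \<le> B"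
proof -
  have int: "integrable P (\<lambda>\<omega>. indicator A \<omega> *\<^sub>R g (\<omega> u))"
    using expectation_integrable[OF assms] unfolding set_integrable_def .
  have "\<bar>LINT \<omega>|P. indicator A \<omega> *\<^sub>R g (\<omega> u)\<bar> \<le> (LINT \<omega>|P. \<bar>indicator A \<omega> *\<^sub>R g (\<omega> u)\<bar>)"
    by (rule integral_abs_bound)
  also have "\<dots> \<le> (LINT \<omega>|P. B)"
  proof (rule integral_mono_AE[OF integrable_abs[OF int]])
    show "AE \<omega> in P. \<bar>indicator A \<omega> *\<^sub>R g (\<omega> u)\<bar> \<le> B"
      using bd bound_nonneg by (intro AE_I2) (simp add: indicator_def)
  qed simp
  finally show ?thesis unfolding set_lebesgue_integral_def by (simp add: prob_space)
qed

lemma path_integral_fubini: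
  assumes A: "A \<in> sets P" and st: "0 \<le> s" "s \<le> t"
  shows "set_integrable lborel {s..t} (\<lambda>u. LINT \<omega>:A|P. g (\<omega> u))"
    "integrable P (\<lambda>\<omega>. indicator A \<omega> * (LINT u:{s..t}|lborel. g (\<omega> u)))"
    "(LINT \<omega>:A|P. LINT u:{s..t}|lborel. g (\<omega> u)) = (LINT u:{s..t}|lborel. LINT \<omega>:A|P. g (\<omega> u))"
proof -
  interpret pair_sigma_finite "lborel :: real measure" P ..
  let ?f = "\<lambda>u \<omega>. indicator {s..t} u * (indicator A \<omega> * g (\<omega> (max 0 u)))"
  have [measurable]: "A \<in> sets P" by (rule A)
  have int: "integrable (lborel \<Otimes>\<^sub>M P) (\<lambda>(u, \<omega>). ?f u \<omega>)"
  proof (rule Bochner_Integration.integrable_bound)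
    have "emeasure (lborel \<Otimes>\<^sub>M P) ({s..t} \<times> space P) = emeasure lborel {s..t} * emeasure P (space P)"
      by (rule sigma_finite_measure.emeasure_pair_measure_Times[OF prob_space_imp_sigma_finite[OF prob_space_axioms]]) simp_all
    then have "emeasure (lborel \<Otimes>\<^sub>M P) ({s..t} \<times> space P) < \<infinity>"
      by (simp add: emeasure_space_1 emeasure_lborel_Icc_eq)
    then show "integrable (lborel \<Otimes>\<^sub>M P) (\<lambda>p. indicator ({s..t} \<times> space P) p * B)"
      by (intro integrable_mult_left integrable_real_indicator) auto
    show "AE p in lborel \<Otimes>\<^sub>M P. norm (case p of (u, \<omega>) \<Rightarrow> ?f u \<omega>) \<le> norm (indicator ({s..t} \<times> space P) p * B)"
    proof (rule AE_I2)
      fix p assume "p \<in> space ((lborel :: real measure) \<Otimes>\<^sub>M P)"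
      then have "snd p \<in> space P" by (auto simp: space_pair_measure)
      moreover have "\<bar>g (snd p (max 0 (fst p)))\<bar> \<le> B" by (rule bd)
      ultimately show "norm (case p of (u, \<omega>) \<Rightarrow> ?f u \<omega>) \<le> norm (indicator ({s..t} \<times> space P) p * B)"
        using bound_nonneg by (cases p) (simp add: indicator_def abs_mult)
    qed
    show "(\<lambda>(u, \<omega>). ?f u \<omega>) \<in> borel_measurable (lborel \<Otimes>\<^sub>M P)"
      using g_joint by measurable
  qed
  have e1: "(LINT \<omega>|P. ?f u \<omega>) = indicator {s..t} u *\<^sub>R (LINT \<omega>:A|P. g (\<omega> u))" for u
    using st by (auto simp: indicator_def set_lebesgue_integral_def max_def)
  have e2: "(LINT u|lborel. ?f u \<omega>) = indicator A \<omega> *\<^sub>R (LINT u:{s..t}|lborel. g (\<omega> u))" for \<omega>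
    unfolding set_lebesgue_integral_def using st
    by (auto simp: indicator_def max_def intro!: Bochner_Integration.integral_cong)
  have "integrable lborel (\<lambda>u. LINT \<omega>|P. ?f u \<omega>)" using integrable_fst[OF int] by simp
  then show "set_integrable lborel {s..t} (\<lambda>u. LINT \<omega>:A|P. g (\<omega> u))" unfolding set_integrable_def e1 .
  have "integrable P (\<lambda>\<omega>. LINT u|lborel. ?f u \<omega>)" using integrable_snd[OF int] by simp
  then show "integrable P (\<lambda>\<omega>. indicator A \<omega> * (LINT u:{s..t}|lborel. g (\<omega> u)))" unfolding e2 by simp
  show "(LINT \<omega>:A|P. LINT u:{s..t}|lborel. g (\<omega> u)) = (LINT u:{s..t}|lborel. LINT \<omega>:A|P. g (\<omega> u))"
    using Fubini_integral[OF int] unfolding e1 e2 by (simp add: set_lebesgue_integral_def)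
qed

end

end

section \<open>From the martingale problem to Dynkin's formula\<close>

locale path_setting = jump_exponents a b + path_prob P
  for a b :: real and P :: "(real \<Rightarrow> real \<times> real) measure"
begin

definition compensated :: "(real \<times> real \<Rightarrow> real) \<Rightarrow> real \<Rightarrow> (real \<Rightarrow> real \<times> real) \<Rightarrow> real" where
  "compensated f t \<omega> = f (\<omega> t) - f (\<omega> 0) - (LINT u:{0..t}|lborel. L f (\<omega> u))"

text \<open>
  The martingale property in integrated form, with the time integral taken last.
\<close>

definition dynkin :: "(real \<times> real \<Rightarrow> real) \<Rightarrow> bool" where
  "dynkin f \<longleftrightarrow> (\<forall>s t A. 0 \<le> s \<longrightarrow> s \<le> t \<longrightarrow> A \<in> sets (path_filtration s) \<longrightarrow>
     (LINT \<omega>:A|P. f (\<omega> t)) - (LINT \<omega>:A|P. f (\<omega> s)) = (LINT u:{s..t}|lborel. LINT \<omega>:A|P. L f (\<omega> u)))"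

lemma dynkinD:
  "dynkin f \<Longrightarrow> 0 \<le> s \<Longrightarrow> s \<le> t \<Longrightarrow> A \<in> sets (path_filtration s) \<Longrightarrow>
     (LINT \<omega>:A|P. f (\<omega> t)) - (LINT \<omega>:A|P. f (\<omega> s)) = (LINT u:{s..t}|lborel. LINT \<omega>:A|P. L f (\<omega> u))"
  unfolding dynkin_def by blast

context
  fixes f :: "real \<times> real \<Rightarrow> real" and K B :: real
  assumes lip: "lipschitz_fun K f" and bd: "\<And>x. \<bar>f x\<bar> \<le> B"
begin

lemma f_meas: "f \<in> borel_measurable borel" by (rule lipschitz_fun_measurable[OF lip])

lemma Lf_meas: "L f \<in> borel_measurable borel" by (rule L_measurable[OF f_meas])

lemma Lf_bound: "\<bar>L f x\<bar> \<le> K * moment" by (rule L_bound[OF lip])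

lemma compensated_bound:
  assumes "\<omega> \<in> cadlag_paths" "0 \<le> t"
  shows "\<bar>compensated f t \<omega>\<bar> \<le> 2 * B + K * moment * t"
proof -
  have "\<bar>LINT u:{0..t}|lborel. L f (\<omega> u)\<bar> \<le> K * moment * (t - 0)"
    by (rule path_integral_bound[OF Lf_meas Lf_bound assms(1) _ assms(2)]) simp
  then show ?thesis using bd[of "\<omega> t"] bd[of "\<omega> 0"] unfolding compensated_def by simp
qed

lemma compensated_increment:
  assumes "\<omega> \<in> cadlag_paths" "0 \<le> s" "s \<le> t"
  shows "compensated f t \<omega> - compensated f s \<omega> = f (\<omega> t) - f (\<omega> s) - (LINT u:{s..t}|lborel. L f (\<omega> u))"
  using path_integral_split[OF Lf_meas Lf_bound assms] by (simp add: compensated_def)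

lemma compensated_measurable:
  assumes "0 \<le> t" shows "compensated f t \<in> borel_measurable P"
proof -
  have "integrable P (\<lambda>\<omega>. indicator (space P) \<omega> * (LINT u:{0..t}|lborel. L f (\<omega> u)))"
    by (rule path_integral_fubini(2)[OF Lf_meas Lf_bound sets.top _ assms]) simp
  then have "integrable P (\<lambda>\<omega>. LINT u:{0..t}|lborel. L f (\<omega> u))"
    by (rule Bochner_Integration.integrable_cong[THEN iffD1, rotated 2]) simp_all
  then have 1: "(\<lambda>\<omega>. LINT u:{0..t}|lborel. L f (\<omega> u)) \<in> borel_measurable P" by (rule borel_measurable_integrable)
  have 2: "(\<lambda>\<omega>. f (\<omega> u)) \<in> borel_measurable P" if "0 \<le> u" for u
    by (rule measurable_compose[OF coord_measurable_P[OF that] f_meas])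
  show ?thesis unfolding compensated_def[abs_def]
    by (intro borel_measurable_diff 1 2 assms order_refl)
qed

lemma compensated_integrable:
  assumes "0 \<le> t" shows "integrable P (compensated f t)"
proof (rule integrable_const_bound)
  show "AE \<omega> in P. norm (compensated f t \<omega>) \<le> 2 * B + K * moment * t"
    by (rule AE_I2) (simp only: space_P real_norm_def compensated_bound[OF _ assms])
qed (rule compensated_measurable[OF assms])

lemma compensated_set_integral:
  assumes A: "A \<in> sets P" and st: "0 \<le> s" "s \<le> t"
  shows "(LINT \<omega>:A|P. compensated f t \<omega>) - (LINT \<omega>:A|P. compensated f s \<omega>) =
    (LINT \<omega>:A|P. f (\<omega> t)) - (LINT \<omega>:A|P. f (\<omega> s)) - (LINT u:{s..t}|lborel. LINT \<omega>:A|P. L f (\<omega> u))"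
proof -
  have si: "set_integrable P A (compensated f u)" if "0 \<le> u" for u
    unfolding set_integrable_def by (rule integrable_mult_indicator[OF A compensated_integrable[OF that]])
  have fi: "set_integrable P A (\<lambda>\<omega>. f (\<omega> u))" if "0 \<le> u" for u
    by (rule expectation_integrable[OF f_meas bd that A])
  note fub = path_integral_fubini[OF Lf_meas Lf_bound A st]
  have Ii: "set_integrable P A (\<lambda>\<omega>. LINT u:{s..t}|lborel. L f (\<omega> u))"
    using fub(2) by (simp add: set_integrable_def)
  have t0: "0 \<le> t" using st by simp
  have "(LINT \<omega>:A|P. compensated f t \<omega>) - (LINT \<omega>:A|P. compensated f s \<omega>) = (LINT \<omega>:A|P. compensated f t \<omega> - compensated f s \<omega>)"
    by (rule set_integral_diff(2)[symmetric, OF si[OF t0] si[OF st(1)]])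
  also have "\<dots> = (LINT \<omega>:A|P. f (\<omega> t) - f (\<omega> s) - (LINT u:{s..t}|lborel. L f (\<omega> u)))"
    by (rule set_lebesgue_integral_cong[OF A]) (use compensated_increment[OF _ st] sets.sets_into_space[OF A] in \<open>auto simp: space_P\<close>)
  also have "\<dots> = (LINT \<omega>:A|P. f (\<omega> t) - f (\<omega> s)) - (LINT \<omega>:A|P. LINT u:{s..t}|lborel. L f (\<omega> u))"
    by (rule set_integral_diff(2)[OF set_integral_diff(1)[OF fi[OF t0] fi[OF st(1)]] Ii])
  also have "(LINT \<omega>:A|P. f (\<omega> t) - f (\<omega> s)) = (LINT \<omega>:A|P. f (\<omega> t)) - (LINT \<omega>:A|P. f (\<omega> s))"
    by (rule set_integral_diff(2)[OF fi[OF t0] fi[OF st(1)]])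
  finally show ?thesis using fub(3) by simp
qed

lemma compensated_set_integral_eq_iff:
  assumes A: "A \<in> sets P" and st: "0 \<le> s" "s \<le> t"
  shows "(LINT \<omega>:A|P. compensated f t \<omega>) = (LINT \<omega>:A|P. compensated f s \<omega>) \<longleftrightarrow>
    (LINT \<omega>:A|P. f (\<omega> t)) - (LINT \<omega>:A|P. f (\<omega> s)) = (LINT u:{s..t}|lborel. LINT \<omega>:A|P. L f (\<omega> u))"
  using compensated_set_integral[OF assms] by linarith

end

text \<open>
  Conditional expectations enter only here and in \<open>martingaleI\<close>; afterwards all arguments use
  integrals over events of the past.
\<close>

lemma martingale_imp_dynkin:
  assumes f: "f \<in> C2c" and m: "martingale P path_filtration (compensated f)"
  shows "dynkin f"
  unfolding dynkin_def
proof (intro allI impI)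
  fix s t :: real and A :: "(real \<Rightarrow> real \<times> real) set" assume st: "0 \<le> s" "s \<le> t" and A: "A \<in> sets (path_filtration s)"
  obtain K B where lip: "lipschitz_fun K f" and bd: "\<And>x. \<bar>f x\<bar> \<le> B" using C2c_lipschitz_bounded[OF f] by blast
  interpret finite_measure_subalgebra P "path_filtration s" by standard (rule subalgebra_P)
  note AP = filtration_sets[OF A]
  have t0: "0 \<le> t" using st by simp
  have ce: "AE \<omega> in P. real_cond_exp P (path_filtration s) (compensated f t) \<omega> = compensated f s \<omega>"
    using m st unfolding martingale_def by blast
  have "(LINT \<omega>:A|P. compensated f t \<omega>) = (LINT \<omega>:A|P. real_cond_exp P (path_filtration s) (compensated f t) \<omega>)"
    by (rule real_cond_exp_intA[OF compensated_integrable[OF lip bd t0] A])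
  also have "\<dots> = (LINT \<omega>:A|P. compensated f s \<omega>)"
    unfolding set_lebesgue_integral_def
  proof (rule integral_cong_AE)
    show "AE \<omega> in P. indicator A \<omega> *\<^sub>R real_cond_exp P (path_filtration s) (compensated f t) \<omega> = indicator A \<omega> *\<^sub>R compensated f s \<omega>"
      using ce by eventually_elim simp
    show "(\<lambda>\<omega>. indicator A \<omega> *\<^sub>R real_cond_exp P (path_filtration s) (compensated f t) \<omega>) \<in> borel_measurable P"
      using AP by (intro borel_measurable_scaleR borel_measurable_indicator borel_measurable_cond_exp2)
    show "(\<lambda>\<omega>. indicator A \<omega> *\<^sub>R compensated f s \<omega>) \<in> borel_measurable P"
      using AP by (intro borel_measurable_scaleR borel_measurable_indicator compensated_measurable[OF lip bd st(1)])
  qed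
  finally show "(LINT \<omega>:A|P. f (\<omega> t)) - (LINT \<omega>:A|P. f (\<omega> s)) = (LINT u:{s..t}|lborel. LINT \<omega>:A|P. L f (\<omega> u))"
    using compensated_set_integral_eq_iff[OF lip bd AP st] by blast
qed

lemma martingaleI:
  assumes f: "f \<in> C2c"
    and adapted: "\<And>t. 0 \<le> t \<Longrightarrow> compensated f t \<in> borel_measurable (path_filtration t)"
    and eq: "\<And>s t A. 0 \<le> s \<Longrightarrow> s \<le> t \<Longrightarrow> A \<in> sets (path_filtration s) \<Longrightarrow>
      (LINT \<omega>:A|P. compensated f t \<omega>) = (LINT \<omega>:A|P. compensated f s \<omega>)"
  shows "martingale P path_filtration (compensated f)"
  unfolding martingale_def
proof (intro conjI allI impI)
  obtain K B where lip: "lipschitz_fun K f" and bd: "\<And>x. \<bar>f x\<bar> \<le> B" using C2c_lipschitz_bounded[OF f] by blast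
  show "filtration (space P) path_filtration" unfolding space_P by (rule filtration_path_filtration)
  show "subalgebra P (path_filtration t)" for t by (rule subalgebra_P)
  show "compensated f t \<in> borel_measurable (path_filtration t)" if "0 \<le> t" for t
    by (rule adapted[OF that])
  show "integrable P (compensated f t)" if "0 \<le> t" for t
    by (rule compensated_integrable[OF lip bd that])
  show "AE \<omega> in P. real_cond_exp P (path_filtration s) (compensated f t) \<omega> = compensated f s \<omega>" if st: "0 \<le> s \<and> s \<le> t" for s t
  proof -
    interpret finite_measure_subalgebra P "path_filtration s" by standard (rule subalgebra_P)
    have st': "0 \<le> s" "s \<le> t" "0 \<le> t" using st by auto
    show ?thesis
      by (rule real_cond_exp_charact[OF eq[OF st'(1,2)] compensated_integrable[OF lip bd st'(3)]
            compensated_integrable[OF lip bd st'(1)] adapted[OF st'(1)]])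
  qed
qed

lemma dynkin_limit:
  assumes d: "\<And>n. dynkin (f n)" and lip: "\<And>n. lipschitz_fun K (f n)" and bd: "\<And>n x. \<bar>f n x\<bar> \<le> B"
    and lim: "\<And>x. (\<lambda>n. f n x) \<longlonglongrightarrow> g x"
  shows "dynkin g"
  unfolding dynkin_def
proof (intro allI impI)
  fix s t :: real and A :: "(real \<Rightarrow> real \<times> real) set" assume st: "0 \<le> s" "s \<le> t" and A: "A \<in> sets (path_filtration s)"
  note AP = filtration_sets[OF A]
  have t0: "0 \<le> t" using st by simp
  have e: "(\<lambda>n. LINT \<omega>:A|P. F n (\<omega> u)) \<longlonglongrightarrow> (LINT \<omega>:A|P. G (\<omega> u))"
    if F: "\<And>n. F n \<in> borel_measurable borel" "\<And>n x. \<bar>F n x\<bar> \<le> C" "\<And>x. (\<lambda>n. F n x) \<longlonglongrightarrow> G x" and u: "0 \<le> u"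
    for F :: "nat \<Rightarrow> real \<times> real \<Rightarrow> real" and G :: "real \<times> real \<Rightarrow> real" and C u :: real
    unfolding set_lebesgue_integral_def
  proof (rule integral_dominated_convergence)
    have G: "G \<in> borel_measurable borel" by (rule borel_measurable_LIMSEQ_real[OF F(3) F(1)])
    have m: "(\<lambda>\<omega>. H (\<omega> u)) \<in> borel_measurable P" if "H \<in> borel_measurable borel" for H :: "real \<times> real \<Rightarrow> real"
      by (rule measurable_compose[OF coord_measurable_P[OF u] that])
    show "(\<lambda>\<omega>. indicator A \<omega> *\<^sub>R G (\<omega> u)) \<in> borel_measurable P"
      by (intro borel_measurable_scaleR borel_measurable_indicator AP m G)
    show "(\<lambda>\<omega>. indicator A \<omega> *\<^sub>R F n (\<omega> u)) \<in> borel_measurable P" for n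
      by (intro borel_measurable_scaleR borel_measurable_indicator AP m F)
    show "integrable P (\<lambda>\<omega>. C)" by simp
    show "AE \<omega> in P. (\<lambda>n. indicator A \<omega> *\<^sub>R F n (\<omega> u)) \<longlonglongrightarrow> indicator A \<omega> *\<^sub>R G (\<omega> u)"
      by (intro AE_I2 tendsto_intros F)
    have "0 \<le> C" using F(2)[of 0 0] by linarith
    then show "AE \<omega> in P. norm (indicator A \<omega> *\<^sub>R F n (\<omega> u)) \<le> C" for n
      using F(2) by (intro AE_I2) (simp add: indicator_def)
  qed
  have Lm: "L (f n) \<in> borel_measurable borel" for n by (rule L_measurable[OF lipschitz_fun_measurable[OF lip]])
  have Lb: "\<bar>L (f n) x\<bar> \<le> K * moment" for n x by (rule L_bound[OF lip])
  have Lim: "(\<lambda>n. L (f n) x) \<longlonglongrightarrow> L g x" for x by (rule L_tendsto[OF lip lim])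
  have gm: "L g \<in> borel_measurable borel" by (rule borel_measurable_LIMSEQ_real[OF Lim Lm])
  have gb: "\<bar>L g x\<bar> \<le> K * moment" for x
    using tendsto_rabs[OF Lim[of x]] by (rule LIMSEQ_le_const2) (use Lb in blast)
  have 1: "(\<lambda>n. (LINT \<omega>:A|P. f n (\<omega> t)) - (LINT \<omega>:A|P. f n (\<omega> s))) \<longlonglongrightarrow> (LINT \<omega>:A|P. g (\<omega> t)) - (LINT \<omega>:A|P. g (\<omega> s))"
    by (intro tendsto_diff e[OF lipschitz_fun_measurable[OF lip] bd lim] t0 st)
  have 2: "(\<lambda>n. LINT u:{s..t}|lborel. LINT \<omega>:A|P. L (f n) (\<omega> u)) \<longlonglongrightarrow> (LINT u:{s..t}|lborel. LINT \<omega>:A|P. L g (\<omega> u))"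
    unfolding set_lebesgue_integral_def[where M = lborel]
  proof (rule integral_dominated_convergence)
    show "(\<lambda>u. indicator {s..t} u *\<^sub>R (LINT \<omega>:A|P. L g (\<omega> u))) \<in> borel_measurable lborel"
      using path_integral_fubini(1)[OF gm gb AP st] unfolding set_integrable_def by (rule borel_measurable_integrable)
    show "(\<lambda>u. indicator {s..t} u *\<^sub>R (LINT \<omega>:A|P. L (f n) (\<omega> u))) \<in> borel_measurable lborel" for n
      using path_integral_fubini(1)[OF Lm Lb AP st] unfolding set_integrable_def by (rule borel_measurable_integrable)
    show "integrable lborel (\<lambda>u. indicator {s..t} u * (K * moment))"
      by (intro integrable_mult_left integrable_real_indicator) (simp_all add: emeasure_lborel_Icc_eq)
    show "AE u in lborel. (\<lambda>n. indicator {s..t} u *\<^sub>R (LINT \<omega>:A|P. L (f n) (\<omega> u))) \<longlonglongrightarrow> indicator {s..t} u *\<^sub>R (LINT \<omega>:A|P. L g (\<omega> u))"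
    proof (rule always_eventually, rule allI)
      fix u show "(\<lambda>n. indicator {s..t} u *\<^sub>R (LINT \<omega>:A|P. L (f n) (\<omega> u))) \<longlonglongrightarrow> indicator {s..t} u *\<^sub>R (LINT \<omega>:A|P. L g (\<omega> u))"
      proof (cases "u \<in> {s..t}")
        case True
        then have "0 \<le> u" using st by simp
        then show ?thesis by (intro tendsto_scaleR tendsto_const e[OF Lm Lb Lim])
      qed simp
    qed
    show "AE u in lborel. norm (indicator {s..t} u *\<^sub>R (LINT \<omega>:A|P. L (f n) (\<omega> u))) \<le> indicator {s..t} u * (K * moment)" for n
    proof (rule always_eventually, rule allI)
      fix u show "norm (indicator {s..t} u *\<^sub>R (LINT \<omega>:A|P. L (f n) (\<omega> u))) \<le> indicator {s..t} u * (K * moment)"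
        using expectation_bound[OF Lm[of n] Lb _ AP, of u] st by (cases "u \<in> {s..t}") auto
    qed
  qed
  have "(LINT \<omega>:A|P. f n (\<omega> t)) - (LINT \<omega>:A|P. f n (\<omega> s)) = (LINT u:{s..t}|lborel. LINT \<omega>:A|P. L (f n) (\<omega> u))" for n
    by (rule dynkinD[OF d st A])
  with 1 2 show "(LINT \<omega>:A|P. g (\<omega> t)) - (LINT \<omega>:A|P. g (\<omega> s)) = (LINT u:{s..t}|lborel. LINT \<omega>:A|P. L g (\<omega> u))"
    by (simp add: LIMSEQ_unique)
qed

text \<open>
  Barriers are Lipschitz functions without compact support, so they are reached from \<open>C\<^sup>2\<close> functions in two
  limits: a cutoff at infinity and a mollification.
\<close>

lemma dynkin_lipschitz:
  assumes C2c: "\<And>f. f \<in> C2c \<Longrightarrow> dynkin f" and g: "lipschitz_fun K g" "\<And>x. \<bar>g x\<bar> \<le> B"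
  shows "dynkin g"
proof (rule dynkin_limit)
  show "dynkin (\<lambda>x. g x * cutoff n x)" for n
  proof -
    have "g x * cutoff n x = 0" if "real n + 1 < norm x" for x using cutoff_properties(3)[OF that] by simp
    then obtain f where f: "\<And>m. f m \<in> C2c" "\<And>m. lipschitz_fun (K + B) (f m)" "\<And>m x. \<bar>f m x\<bar> \<le> B"
        "\<And>x. (\<lambda>m. f m x) \<longlonglongrightarrow> g x * cutoff n x"
      using lipschitz_compact_support_approx[OF lipschitz_cutoff(1)[OF g] _ lipschitz_cutoff(2)[OF g], of "real n + 1" n] by metis
    show ?thesis by (rule dynkin_limit[OF C2c[OF f(1)] f(2,3,4)])
  qed
  show "lipschitz_fun (K + B) (\<lambda>x. g x * cutoff n x)" for n by (rule lipschitz_cutoff(1)[OF g])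
  show "\<bar>g x * cutoff n x\<bar> \<le> B" for n x by (rule lipschitz_cutoff(2)[OF g])
  show "(\<lambda>n. g x * cutoff n x) \<longlonglongrightarrow> g x" for x by (rule lipschitz_cutoff(3)[OF g])
qed

lemma dynkin_lower:
  assumes d: "dynkin g" and g: "lipschitz_fun K g" and c: "\<And>x. - c \<le> L g x"
    and st: "0 \<le> s" "s \<le> t" and A: "A \<in> sets (path_filtration s)" and c0: "0 \<le> c"
  shows "- c * (t - s) \<le> (LINT \<omega>:A|P. g (\<omega> t)) - (LINT \<omega>:A|P. g (\<omega> s))"
proof -
  note AP = filtration_sets[OF A]
  have Lm: "L g \<in> borel_measurable borel" by (rule L_measurable[OF lipschitz_fun_measurable[OF g]])
  have Lb: "\<bar>L g x\<bar> \<le> K * moment" for x by (rule L_bound[OF g])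
  have pt: "- c \<le> (LINT \<omega>:A|P. L g (\<omega> u))" if "0 \<le> u" for u
  proof -
    have "(LINT \<omega>:A|P. - c) \<le> (LINT \<omega>:A|P. L g (\<omega> u))"
    proof (rule set_integral_mono)
      show "set_integrable P A (\<lambda>\<omega>. - c)"
        unfolding set_integrable_def by (rule integrable_mult_indicator[OF AP integrable_const])
      show "set_integrable P A (\<lambda>\<omega>. L g (\<omega> u))" by (rule expectation_integrable[OF Lm Lb that AP])
      show "- c \<le> L g (\<omega> u)" for \<omega> :: "real \<Rightarrow> real \<times> real" by (rule c)
    qed
    moreover have "(LINT \<omega>:A|P. - c) = - c * measure P A" using AP by (simp add: set_lebesgue_integral_def)
    moreover have "c * measure P A \<le> c * 1" by (intro mult_left_mono c0) simp
    ultimately show ?thesis by simp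
  qed
  have "(LINT u:{s..t}|lborel. - c) \<le> (LINT u:{s..t}|lborel. LINT \<omega>:A|P. L g (\<omega> u))"
  proof (rule set_integral_mono)
    show "set_integrable lborel {s..t} (\<lambda>u. - c)"
      unfolding set_integrable_def
      by (intro integrable_scaleR_left integrable_real_indicator) (simp_all add: emeasure_lborel_Icc_eq)
    show "set_integrable lborel {s..t} (\<lambda>u. LINT \<omega>:A|P. L g (\<omega> u))"
      by (rule path_integral_fubini(1)[OF Lm Lb AP st])
    show "- c \<le> (LINT \<omega>:A|P. L g (\<omega> u))" if "u \<in> {s..t}" for u
      using that st by (intro pt) simp
  qed
  moreover have "(LINT u:{s..t}|lborel. - c) = - c * (t - s)" using st by (simp add: set_lebesgue_integral_def)
  ultimately show ?thesis using dynkinD[OF d st A] by simp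
qed

end

section \<open>Escape from the diagonals\<close>

context path_setting
begin

definition occupation :: "(real \<times> real) set \<Rightarrow> real \<Rightarrow> real" where
  "occupation S u = (LINT \<omega>:space P|P. indicator S (\<omega> u))"

lemma ind_bound: "\<bar>indicator S (x::real\<times>real) :: real\<bar> \<le> 1"
  by (simp add: indicator_def)

lemma ind_meas: "S \<in> sets borel \<Longrightarrow> (indicator S :: real\<times>real \<Rightarrow> real) \<in> borel_measurable borel"
  by simp

lemma coord_sets: "S \<in> sets borel \<Longrightarrow> 0 \<le> u \<Longrightarrow> {\<omega> \<in> space P. \<omega> u \<in> S} \<in> sets P"
  using measurable_sets[OF coord_measurable_P[of u], of S] by (simp add: vimage_def Int_def conj_commute)

lemma occupation_eq_prob:
  assumes "S \<in> sets borel" "0 \<le> u"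
  shows "occupation S u = prob {\<omega> \<in> space P. \<omega> u \<in> S}"
proof -
  have "occupation S u = (LINT \<omega>|P. indicator {\<omega> \<in> space P. \<omega> u \<in> S} \<omega>)"
    unfolding occupation_def set_lebesgue_integral_def
    by (rule Bochner_Integration.integral_cong) (simp_all add: indicator_def)
  also have "\<dots> = prob {\<omega> \<in> space P. \<omega> u \<in> S}"
    using coord_sets[OF assms] by simp
  finally show ?thesis .
qed

lemma occupation_integrable: "S \<in> sets borel \<Longrightarrow> 0 \<le> s \<Longrightarrow> s \<le> t \<Longrightarrow> set_integrable lborel {s..t} (occupation S)"
  unfolding occupation_def[abs_def] by (rule path_integral_fubini(1)[OF ind_meas ind_bound sets.top])

lemma occupation_nonneg: "0 \<le> occupation S u"
  unfolding occupation_def set_lebesgue_integral_def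
  by (rule Bochner_Integration.integral_nonneg) (simp add: indicator_def)

lemma occupation_mono:
  assumes "S \<in> sets borel" "S' \<in> sets borel" "S \<subseteq> S'" "0 \<le> u" shows "occupation S u \<le> occupation S' u"
  unfolding occupation_eq_prob[OF assms(1,4)] occupation_eq_prob[OF assms(2,4)]
  by (rule finite_measure_mono[OF _ coord_sets[OF assms(2,4)]]) (use assms(3) in blast)

lemma space_in_filtration: "space P \<in> sets (path_filtration s)"
  using sets.top[of "path_filtration s"] by (simp add: space_P path_filtration_def space_coord_sigma)

lemma set_integrable_const_Icc: "set_integrable lborel {s..t::real} (\<lambda>u. c :: real)"
  unfolding set_integrable_def
  by (intro integrable_scaleR_left integrable_real_indicator) (simp_all add: emeasure_lborel_Icc_eq)

lemma set_integral_const_Icc: "s \<le> t \<Longrightarrow> (LINT u:{s..t::real}|lborel. c :: real) = c * (t - s)"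
  by (simp add: set_lebesgue_integral_def)

text \<open>
  A function with values in \<open>[0, 1]\<close> can gain at most \<open>1\<close>, so a large drift on \<open>S\<close> limits the time spent there.
\<close>

lemma occupation_bound:
  assumes d: "dynkin g" and g: "lipschitz_fun K g" "\<And>x. 0 \<le> g x" "\<And>x. g x \<le> 1"
    and S: "S \<in> sets borel" and T: "0 \<le> T"
    and lower: "\<And>x. k * indicator S x - c \<le> L g x"
  shows "k * (LINT u:{0..T}|lborel. occupation S u) \<le> 1 + c * T"
proof -
  have Lm: "L g \<in> borel_measurable borel" by (rule L_measurable[OF lipschitz_fun_measurable[OF g(1)]])
  have Lb: "\<bar>L g x\<bar> \<le> K * moment" for x by (rule L_bound[OF g(1)])
  have gm: "g \<in> borel_measurable borel" by (rule lipschitz_fun_measurable[OF g(1)])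
  have gb: "\<bar>g x\<bar> \<le> 1" for x using g(2)[of x] g(3)[of x] by linarith
  note ei = expectation_integrable[OF ind_meas[OF S] ind_bound _ sets.top]
  have cint: "set_integrable P (space P) (\<lambda>\<omega>. r)" for r :: real
    unfolding set_integrable_def by (rule integrable_mult_indicator[OF sets.top integrable_const])
  have cval: "(LINT \<omega>:space P|P. r) = r" for r :: real
    by (simp add: set_lebesgue_integral_def prob_space)
  have pt: "k * occupation S u - c \<le> (LINT \<omega>:space P|P. L g (\<omega> u))" if "0 \<le> u" for u
  proof -
    have "(LINT \<omega>:space P|P. k * indicator S (\<omega> u) - c) \<le> (LINT \<omega>:space P|P. L g (\<omega> u))"
      by (rule set_integral_mono[OF set_integral_diff(1)[OF set_integrable_mult_right[OF ei[OF that]] cint]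
            expectation_integrable[OF Lm Lb that sets.top] lower])
    moreover have "(LINT \<omega>:space P|P. k * indicator S (\<omega> u) - c) = k * occupation S u - c"
      using set_integral_diff(2)[OF set_integrable_mult_right[OF ei[OF that], of k] cint[of c]]
      by (simp add: occupation_def cval)
    ultimately show ?thesis by simp
  qed
  have oi: "set_integrable lborel {0..T} (\<lambda>u. k * occupation S u)"
    using occupation_integrable[OF S order_refl T] by (rule set_integrable_mult_right)
  have "(LINT u:{0..T}|lborel. k * occupation S u - c) \<le> (LINT u:{0..T}|lborel. LINT \<omega>:space P|P. L g (\<omega> u))"
    by (rule set_integral_mono[OF set_integral_diff(1)[OF oi set_integrable_const_Icc]
          path_integral_fubini(1)[OF Lm Lb sets.top order_refl T]]) (rule pt, simp)
  also have "\<dots> = (LINT \<omega>:space P|P. g (\<omega> T)) - (LINT \<omega>:space P|P. g (\<omega> 0))"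
    by (rule dynkinD[OF d order_refl T space_in_filtration, symmetric])
  also have "\<dots> \<le> 1"
  proof -
    have "(LINT \<omega>:space P|P. g (\<omega> T)) \<le> (LINT \<omega>:space P|P. 1)"
      by (rule set_integral_mono[OF expectation_integrable[OF gm gb T sets.top] cint g(3)])
    moreover have "(LINT \<omega>:space P|P. 0) \<le> (LINT \<omega>:space P|P. g (\<omega> 0))"
      by (rule set_integral_mono[OF cint expectation_integrable[OF gm gb order_refl sets.top] g(2)])
    ultimately show ?thesis unfolding cval by linarith
  qed
  finally have "(LINT u:{0..T}|lborel. k * occupation S u - c) \<le> 1" .
  moreover have "(LINT u:{0..T}|lborel. k * occupation S u - c) = k * (LINT u:{0..T}|lborel. occupation S u) - c * T"
    using set_integral_diff(2)[OF oi set_integrable_const_Icc[of 0 T c]] set_integral_const_Icc[OF T, of c] by simp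
  ultimately show ?thesis by linarith
qed

definition strip :: "real \<Rightarrow> (real \<times> real) set" where
  "strip \<delta> = {x. \<bar>gap x\<bar> \<le> \<delta>}"

lemma strip_sets: "strip \<delta> \<in> sets borel"
proof -
  have "{x \<in> space borel. \<bar>gap x\<bar> \<le> \<delta>} \<in> sets borel" by measurable
  then show ?thesis by (simp add: strip_def)
qed

text \<open>
  The barrier controls the half of the strip inside \<open>V\<close> and its mirror image controls the other half.
\<close>

lemma strip_occupation:
  assumes D: "\<And>f. f \<in> C2c \<Longrightarrow> dynkin f" and \<theta>: "good_exponent \<theta>"
  obtains C where "0 < C" "\<And>\<delta> T. 0 < \<delta> \<Longrightarrow> \<delta> \<le> 1/8 \<Longrightarrow> 0 \<le> T \<Longrightarrow>
    (LINT u:{0..T}|lborel. occupation (strip \<delta>) u) \<le> C * (\<delta> powr \<beta> + T * \<delta> powr (\<beta> - \<theta>))"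
proof -
  obtain C where C: "0 \<le> C"
    "\<And>\<delta> x. 0 < \<delta> \<Longrightarrow> \<delta> \<le> 1 \<Longrightarrow> - C * \<delta> powr (- \<theta>) \<le> L (strip_barrier \<delta>) x"
    "\<And>\<delta> x. 0 < \<delta> \<Longrightarrow> \<delta> \<le> 1 \<Longrightarrow> - C * \<delta> powr (- \<theta>) \<le> L (\<lambda>x. strip_barrier \<delta> (prod.swap x)) x"
    using L_strip_barrier_lower[OF \<theta>] by metis
  obtain c where c: "0 < c"
    "\<And>\<delta> x. 0 < \<delta> \<Longrightarrow> \<delta> \<le> 1/8 \<Longrightarrow> x \<in> V \<Longrightarrow> gap x \<le> \<delta> \<Longrightarrow> c * \<delta> powr (- \<beta>) \<le> L (strip_barrier \<delta>) x"
    "\<And>\<delta> x. 0 < \<delta> \<Longrightarrow> \<delta> \<le> 1/8 \<Longrightarrow> x \<notin> V \<Longrightarrow> - \<delta> \<le> gap x \<Longrightarrow> c * \<delta> powr (- \<beta>) \<le> L (\<lambda>x. strip_barrier \<delta> (prod.swap x)) x"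
    using L_strip_barrier_strip by metis
  define C' where "C' = 2 / c * (1 + C)"
  show ?thesis
  proof
    show "0 < C'" using c(1) C(1) by (simp add: C'_def)
  next
    fix \<delta> T :: real assume \<delta>: "0 < \<delta>" "\<delta> \<le> 1/8" and T: "0 \<le> T"
    then have \<delta>1: "\<delta> \<le> 1" by simp
    define S1 where "S1 = strip \<delta> \<inter> V"
    define S2 where "S2 = strip \<delta> - V"
    have S: "S1 \<in> sets borel" "S2 \<in> sets borel" unfolding S1_def S2_def using strip_sets V_sets by auto
    let ?k = "c * \<delta> powr (- \<beta>)" and ?c = "C * \<delta> powr (- \<theta>)"
    have k0: "0 \<le> ?k" and c0: "0 \<le> ?c" using c(1) C(1) by simp_all
    have b1: "?k * (LINT u:{0..T}|lborel. occupation S1 u) \<le> 1 + ?c * T"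
    proof (rule occupation_bound[OF dynkin_lipschitz[OF D strip_barrier_lipschitz(1)[OF \<delta>(1)]]
          strip_barrier_lipschitz(1)[OF \<delta>(1)] strip_barrier_bounds(1)[OF \<delta>(1)] strip_barrier_bounds(2)[OF \<delta>(1)] S(1) T])
      show "\<bar>strip_barrier \<delta> x\<bar> \<le> 1" for x using strip_barrier_bounds[OF \<delta>(1), of x] by simp
      show "?k * indicator S1 x - ?c \<le> L (strip_barrier \<delta>) x" for x
      proof (cases "x \<in> S1")
        case True
        then have "x \<in> V" and "gap x \<le> \<delta>" "- \<delta> \<le> gap x" by (auto simp: S1_def strip_def)
        then show ?thesis using c(2)[OF \<delta>, of x] c0 True by simp
      next
        case False
        then show ?thesis using C(2)[OF \<delta>(1) \<delta>1, of x] by simp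
      qed
    qed
    have b2: "?k * (LINT u:{0..T}|lborel. occupation S2 u) \<le> 1 + ?c * T"
    proof (rule occupation_bound[OF dynkin_lipschitz[OF D strip_barrier_lipschitz(2)[OF \<delta>(1)]]
          strip_barrier_lipschitz(2)[OF \<delta>(1)] strip_barrier_bounds(1)[OF \<delta>(1)] strip_barrier_bounds(2)[OF \<delta>(1)] S(2) T])
      show "\<bar>strip_barrier \<delta> (prod.swap x)\<bar> \<le> 1" for x using strip_barrier_bounds[OF \<delta>(1), of "prod.swap x"] by simp
      show "?k * indicator S2 x - ?c \<le> L (\<lambda>x. strip_barrier \<delta> (prod.swap x)) x" for x
      proof (cases "x \<in> S2")
        case True
        then have "x \<notin> V" and "gap x \<le> \<delta>" "- \<delta> \<le> gap x" by (auto simp: S2_def strip_def)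
        then show ?thesis using c(3)[OF \<delta>, of x] c0 True by simp
      next
        case False
        then show ?thesis using C(3)[OF \<delta>(1) \<delta>1, of x] by simp
      qed
    qed
    have "occupation (strip \<delta>) u = occupation S1 u + occupation S2 u" for u
    proof -
      have "(indicator (strip \<delta>) (\<omega> u) :: real) = indicator S1 (\<omega> u) + indicator S2 (\<omega> u)" for \<omega> :: "real \<Rightarrow> real \<times> real"
        by (simp add: S1_def S2_def indicator_def)
      then have e: "occupation (strip \<delta>) u = (LINT \<omega>:space P|P. indicator S1 (\<omega> u) + indicator S2 (\<omega> u))"
        by (simp add: occupation_def)
      show ?thesis
      proof (cases "0 \<le> u")
        case True
        show ?thesis unfolding e
          unfolding occupation_def by (rule set_integral_add(2)[OF expectation_integrable[OF ind_meas ind_bound True sets.top]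
             expectation_integrable[OF ind_meas ind_bound True sets.top]]) (fact S)+
      next
        case False
        \<comment> \<open>Paths are extensional, so negative times carry the constant value \<open>undefined\<close>.\<close>
        have z: "\<omega> u = undefined" if "\<omega> \<in> space P" for \<omega>
          using that False by (simp add: space_P cadlag_paths_def extensional_def)
        have "occupation Q u = indicator Q undefined" for Q
        proof -
          have "occupation Q u = (LINT \<omega>|P. indicator Q undefined)"
            unfolding occupation_def set_lebesgue_integral_def by (rule Bochner_Integration.integral_cong) (simp_all add: z)
          then show ?thesis by (simp add: prob_space)
        qed
        then show ?thesis by (simp add: S1_def S2_def indicator_def)
      qed
    qed
    then have "(LINT u:{0..T}|lborel. occupation (strip \<delta>) u) = (LINT u:{0..T}|lborel. occupation S1 u + occupation S2 u)" by simp
    also have "\<dots> = (LINT u:{0..T}|lborel. occupation S1 u) + (LINT u:{0..T}|lborel. occupation S2 u)"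
      by (rule set_integral_add(2)[OF occupation_integrable[OF S(1) order_refl T] occupation_integrable[OF S(2) order_refl T]])
    finally have "?k * (LINT u:{0..T}|lborel. occupation (strip \<delta>) u) \<le> 2 * (1 + ?c * T)"
      using b1 b2 by (simp add: distrib_left)
    also have "\<dots> \<le> 2 * (1 + C) * (1 + \<delta> powr (- \<theta>) * T)"
    proof -
      have "0 \<le> \<delta> powr (- \<theta>) * T" using T by simp
      then show ?thesis using C(1) by (simp add: algebra_simps)
    qed
    finally have "(LINT u:{0..T}|lborel. occupation (strip \<delta>) u) \<le> 2 * (1 + C) * (1 + \<delta> powr (- \<theta>) * T) / ?k"
      using c(1) \<delta> by (subst pos_le_divide_eq) (simp_all add: mult.commute)
    also have "\<dots> = C' * ((1 + \<delta> powr (- \<theta>) * T) * \<delta> powr \<beta>)"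
      using c(1) \<delta> by (simp add: C'_def powr_minus field_simps)
    also have "(1 + \<delta> powr (- \<theta>) * T) * \<delta> powr \<beta> = \<delta> powr \<beta> + T * \<delta> powr (\<beta> - \<theta>)"
      using \<delta> by (simp add: distrib_right powr_diff powr_minus field_simps)
    finally show "(LINT u:{0..T}|lborel. occupation (strip \<delta>) u) \<le> C' * (\<delta> powr \<beta> + T * \<delta> powr (\<beta> - \<theta>))" .
  qed
qed

lemma set_integral_mono_Icc:
  assumes "set_integrable lborel {s..t} f" "set_integrable lborel {s..t} g" "\<And>u. s \<le> u \<Longrightarrow> u \<le> t \<Longrightarrow> f u \<le> g u"
  shows "(LINT u:{s..t::real}|lborel. f u :: real) \<le> (LINT u:{s..t}|lborel. g u)"
  by (rule set_integral_mono[OF assms(1,2)]) (use assms(3) in simp)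

text \<open>
  Let \<open>\<delta>\<close> tend to \<open>0\<close> in \<open>strip_occupation\<close>: both exponents of \<open>\<delta>\<close> are positive.
\<close>

lemma diagonal_null:
  assumes D: "\<And>f. f \<in> C2c \<Longrightarrow> dynkin f" and T: "0 \<le> T"
  shows "(LINT u:{0..T}|lborel. occupation (strip 0) u) = 0"
proof -
  obtain \<theta> where \<theta>: "good_exponent \<theta>" using good_exponent_exists by blast
  obtain C where C: "0 < C" "\<And>\<delta> T. 0 < \<delta> \<Longrightarrow> \<delta> \<le> 1/8 \<Longrightarrow> 0 \<le> T \<Longrightarrow>
    (LINT u:{0..T}|lborel. occupation (strip \<delta>) u) \<le> C * (\<delta> powr \<beta> + T * \<delta> powr (\<beta> - \<theta>))"
    using strip_occupation[OF D \<theta>] by metis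
  have \<beta>\<theta>: "0 < \<beta> - \<theta>" using \<theta> by (simp add: good_exponent_def)
  have "((\<lambda>\<delta>. C * (\<delta> powr \<beta> + T * \<delta> powr (\<beta> - \<theta>))) \<longlongrightarrow> C * (0 powr \<beta> + T * 0 powr (\<beta> - \<theta>))) (at_right 0)"
    using \<beta>\<theta> \<beta>_bounds by (intro tendsto_intros tendsto_powr') (auto simp: eventually_at_right_field intro!: exI[of _ 1])
  then have lim: "((\<lambda>\<delta>. C * (\<delta> powr \<beta> + T * \<delta> powr (\<beta> - \<theta>))) \<longlongrightarrow> 0) (at_right 0)" by simp
  have "(LINT u:{0..T}|lborel. occupation (strip 0) u) \<le> 0"
  proof (rule tendsto_lowerbound[OF lim])
    show "\<forall>\<^sub>F \<delta> in at_right 0. (LINT u:{0..T}|lborel. occupation (strip 0) u) \<le> C * (\<delta> powr \<beta> + T * \<delta> powr (\<beta> - \<theta>))"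
      unfolding eventually_at_right_field
    proof (intro exI[of _ "1/8"] conjI allI impI)
      fix \<delta> :: real assume \<delta>: "0 < \<delta>" "\<delta> < 1/8"
      have "(LINT u:{0..T}|lborel. occupation (strip 0) u) \<le> (LINT u:{0..T}|lborel. occupation (strip \<delta>) u)"
      proof (rule set_integral_mono_Icc[OF occupation_integrable[OF strip_sets order_refl T] occupation_integrable[OF strip_sets order_refl T]])
        fix u :: real assume "0 \<le> u"
        show "occupation (strip 0) u \<le> occupation (strip \<delta>) u"
          using \<delta> by (intro occupation_mono[OF strip_sets strip_sets _ \<open>0 \<le> u\<close>]) (auto simp: strip_def)
      qed
      also have "\<dots> \<le> C * (\<delta> powr \<beta> + T * \<delta> powr (\<beta> - \<theta>))" using \<delta> by (intro C(2) T) simp_all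
      finally show "(LINT u:{0..T}|lborel. occupation (strip 0) u) \<le> C * (\<delta> powr \<beta> + T * \<delta> powr (\<beta> - \<theta>))" .
    qed simp
  qed simp
  moreover have "0 \<le> (LINT u:{0..T}|lborel. occupation (strip 0) u)"
    unfolding set_lebesgue_integral_def by (rule Bochner_Integration.integral_nonneg) (simp add: occupation_nonneg)
  ultimately show ?thesis by simp
qed

lemma AE_diagonal_null:
  assumes D: "\<And>f. f \<in> C2c \<Longrightarrow> dynkin f" and T: "0 \<le> T"
  shows "AE u in lborel. u \<in> {0..T} \<longrightarrow> occupation (strip 0) u = 0"
proof -
  have "integrable lborel (\<lambda>u. indicator {0..T} u *\<^sub>R occupation (strip 0) u)"
    using occupation_integrable[OF strip_sets order_refl T] unfolding set_integrable_def .
  then have "AE u in lborel. indicator {0..T} u *\<^sub>R occupation (strip 0) u = 0"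
    using diagonal_null[OF D T] occupation_nonneg
    by (subst (asm) integral_nonneg_eq_0_iff_AE[symmetric] | subst integral_nonneg_eq_0_iff_AE[symmetric])+
       (simp_all add: set_lebesgue_integral_def)
  then show ?thesis by eventually_elim (simp add: indicator_def)
qed

text \<open>
  The strip is rarely occupied on average, hence rarely at some time of \<open>[T/2, T]\<close>. The factor \<open>4\<close>, twice
  the mean value, leaves room for a strict inequality.
\<close>

lemma exists_good_time:
  assumes D: "\<And>f. f \<in> C2c \<Longrightarrow> dynkin f" and T: "0 < T" and R: "0 < R"
    and le: "(LINT u:{0..T}|lborel. occupation (strip \<delta>) u) \<le> R"
  obtains t where "T / 2 \<le> t" "t \<le> T" "occupation (strip 0) t = 0" "occupation (strip \<delta>) t \<le> 4 * R / T"
proof -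
  have "\<exists>t. T / 2 \<le> t \<and> t \<le> T \<and> occupation (strip 0) t = 0 \<and> occupation (strip \<delta>) t \<le> 4 * R / T"
  proof (rule ccontr)
    assume n: "\<not> ?thesis"
    have T0: "0 \<le> T" "0 \<le> T / 2" "T / 2 \<le> T" using T by simp_all
    have aed: "AE u in lborel. u \<in> {0..T} \<longrightarrow> occupation (strip 0) u = 0"
      by (rule AE_diagonal_null[OF _ T0(1)]) (rule D)
    have i1: "integrable lborel (\<lambda>u. indicator {T/2..T} u *\<^sub>R (4 * R / T))"
      using set_integrable_const_Icc[of "T/2" T "4 * R / T"] unfolding set_integrable_def .
    have i2: "integrable lborel (\<lambda>u. indicator {0..T} u *\<^sub>R occupation (strip \<delta>) u)"
      using occupation_integrable[OF strip_sets order_refl T0(1)] unfolding set_integrable_def .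
    have "(LINT u|lborel. indicator {T/2..T} u *\<^sub>R (4 * R / T)) \<le> (LINT u|lborel. indicator {0..T} u *\<^sub>R occupation (strip \<delta>) u)"
    proof (rule integral_mono_AE[OF i1 i2])
      show "AE u in lborel. indicator {T/2..T} u *\<^sub>R (4 * R / T) \<le> indicator {0..T} u *\<^sub>R occupation (strip \<delta>) u"
        using aed
      proof eventually_elim
        case (elim u)
        show ?case
        proof (cases "u \<in> {T/2..T}")
          case True
          then have "u \<in> {0..T}" using T by simp
          then have "4 * R / T \<le> occupation (strip \<delta>) u" using n True elim by force
          then show ?thesis using True \<open>u \<in> {0..T}\<close> by simp
        qed (simp add: occupation_nonneg indicator_def)
      qed
    qed
    also have "\<dots> \<le> R" using le unfolding set_lebesgue_integral_def .
    finally have "4 * R / T * (T - T / 2) \<le> R"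
      using set_integral_const_Icc[OF T0(3), of "4 * R / T"] unfolding set_lebesgue_integral_def by simp
    then show False using T R by (simp add: field_simps)
  qed
  then show ?thesis using that by blast
qed

end

context path_setting
begin

lemma coord_event_in_filtration:
  assumes "S \<in> sets borel" "0 \<le> u" "u \<le> s"
  shows "{\<omega> \<in> space P. \<omega> u \<in> S} \<in> sets (path_filtration s)"
proof -
  have "(\<lambda>\<omega>. \<omega> u) \<in> measurable (path_filtration s) (borel :: (real \<times> real) measure)"
    unfolding path_filtration_def using assms by (intro coord_measurable) simp
  from measurable_sets[OF this assms(1)] show ?thesis
    by (simp add: vimage_def Int_def conj_commute space_P path_filtration_def space_coord_sigma)
qed

text \<open>
  On \<open>V\<close> outside the strip of width \<open>\<delta>\<close> the barrier of the smaller width \<open>\<epsilon>\<close> is within \<open>(\<epsilon> / \<delta>)\<^sup>1\<^sup>-\<^sup>\<beta>\<close> of the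
  indicator of \<open>V\<close>, and outside \<open>V\<close> it vanishes. Its submartingale inequality therefore says that
  \<open>V\<close> is hardly ever left.
\<close>

lemma sector_transition:
  assumes D: "\<And>f. f \<in> C2c \<Longrightarrow> dynkin f"
    and lower: "\<And>x. - c \<le> L (strip_barrier \<epsilon>) x" and c: "0 \<le> c"
    and \<epsilon>: "0 < \<epsilon>" "\<epsilon> \<le> \<delta>" and st: "0 \<le> s" "s \<le> t"
  shows "prob {\<omega> \<in> space P. \<omega> s \<in> V \<and> \<omega> t \<notin> V} \<le> occupation (strip \<delta>) s + (\<epsilon> / \<delta>) powr (1 - \<beta>) + c * (t - s)"
proof -
  define A where "A = {\<omega> \<in> space P. \<omega> s \<in> V}"
  define E where "E = {\<omega> \<in> space P. \<omega> s \<in> V \<and> \<omega> t \<notin> V}"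
  define r where "r = (\<epsilon> / \<delta>) powr (1 - \<beta>)"
  let ?g = "strip_barrier \<epsilon>"
  have A: "A \<in> sets (path_filtration s)"
    unfolding A_def by (rule coord_event_in_filtration[OF V_sets st(1) order_refl])
  note AP = filtration_sets[OF A]
  have t0: "0 \<le> t" using st by simp
  have E: "E \<in> sets P"
  proof -
    have "E = A - {\<omega> \<in> space P. \<omega> t \<in> V}" by (auto simp: E_def A_def)
    then show ?thesis using AP coord_sets[OF V_sets t0] by simp
  qed
  have lip: "lipschitz_fun (2 / \<epsilon>) ?g" by (rule strip_barrier_lipschitz(1)[OF \<epsilon>(1)])
  have gb: "\<bar>?g x\<bar> \<le> 1" for x using strip_barrier_bounds[OF \<epsilon>(1), of x] by simp
  have gm: "?g \<in> borel_measurable borel" by (rule lipschitz_fun_measurable[OF lip])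
  have dg: "dynkin ?g" by (rule dynkin_lipschitz[OF D lip gb])
  have low: "- c * (t - s) \<le> (LINT \<omega>:A|P. ?g (\<omega> t)) - (LINT \<omega>:A|P. ?g (\<omega> s))"
    by (rule dynkin_lower[OF dg lip lower st A c])
  have near: "1 \<le> ?g x + indicator (strip \<delta>) x + r" if "x \<in> V" for x
  proof (cases "x \<in> strip \<delta>")
    case True
    then show ?thesis using strip_barrier_bounds(1)[OF \<epsilon>(1), of x] by (simp add: r_def)
  next
    case False
    then have g: "\<delta> < gap x" using that by (simp add: strip_def V_iff_gap)
    then have "(\<epsilon> / gap x) powr (1 - \<beta>) \<le> r"
      unfolding r_def using \<epsilon> \<beta>_bounds by (intro powr_mono2 divide_left_mono) auto
    then show ?thesis using g \<epsilon> False by (simp add: strip_barrier_def barrier_def)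
  qed
  note ie = expectation_integrable[OF ind_meas[OF strip_sets] ind_bound st(1) sets.top]
  note it = expectation_integrable[OF gm gb t0 AP] and is' = expectation_integrable[OF gm gb st(1) AP]
  have i1: "integrable P (\<lambda>\<omega>. indicator A \<omega> *\<^sub>R ?g (\<omega> s) - indicator A \<omega> *\<^sub>R ?g (\<omega> t)
      + indicator (space P) \<omega> *\<^sub>R indicator (strip \<delta>) (\<omega> s) + r)"
    using it is' ie unfolding set_integrable_def
    by (intro Bochner_Integration.integrable_add Bochner_Integration.integrable_diff integrable_const)
  have "prob E = (LINT \<omega>|P. indicator E \<omega>)" using E by simp
  also have "\<dots> \<le> (LINT \<omega>|P. indicator A \<omega> *\<^sub>R ?g (\<omega> s) - indicator A \<omega> *\<^sub>R ?g (\<omega> t)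
      + indicator (space P) \<omega> *\<^sub>R indicator (strip \<delta>) (\<omega> s) + r)"
  proof (rule integral_mono_AE[OF _ i1])
    show "integrable P (indicator E :: _ \<Rightarrow> real)" using E by (intro integrable_real_indicator) (simp_all add: less_top[symmetric])
    show "AE \<omega> in P. indicator E \<omega> \<le> indicator A \<omega> *\<^sub>R ?g (\<omega> s) - indicator A \<omega> *\<^sub>R ?g (\<omega> t)
      + indicator (space P) \<omega> *\<^sub>R indicator (strip \<delta>) (\<omega> s) + r"
    proof (rule AE_I2)
      fix \<omega> assume w: "\<omega> \<in> space P"
      have r0: "0 \<le> r" by (simp add: r_def)
      show "indicator E \<omega> \<le> indicator A \<omega> *\<^sub>R ?g (\<omega> s) - indicator A \<omega> *\<^sub>R ?g (\<omega> t)
        + indicator (space P) \<omega> *\<^sub>R indicator (strip \<delta>) (\<omega> s) + r"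
      proof (cases "\<omega> s \<in> V")
        case True
        show ?thesis
        proof (cases "\<omega> t \<in> V")
          case t: True
          then show ?thesis using near[OF True] strip_barrier_bounds(2)[OF \<epsilon>(1), of "\<omega> t"] True w by (simp add: A_def E_def)
        next
          case t: False
          then have "?g (\<omega> t) = 0" using \<epsilon>(1) by (intro strip_barrier_eq_0) (simp_all add: V_iff_gap)
          then show ?thesis using near[OF True] True w t by (simp add: A_def E_def)
        qed
      next
        case False
        then show ?thesis using r0 w by (simp add: A_def E_def indicator_def)
      qed
    qed
  qed
  also have "\<dots> = (LINT \<omega>:A|P. ?g (\<omega> s)) - (LINT \<omega>:A|P. ?g (\<omega> t)) + occupation (strip \<delta>) s + r"
  proof -
    have "integrable P (\<lambda>\<omega>. indicator A \<omega> *\<^sub>R ?g (\<omega> s))" "integrable P (\<lambda>\<omega>. indicator A \<omega> *\<^sub>R ?g (\<omega> t))"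
      "integrable P (\<lambda>\<omega>. indicator (space P) \<omega> *\<^sub>R (indicator (strip \<delta>) (\<omega> s) :: real))"
      using it is' ie unfolding set_integrable_def by blast+
    then show ?thesis
      unfolding occupation_def set_lebesgue_integral_def
      by (simp only: Bochner_Integration.integral_add Bochner_Integration.integral_diff
          Bochner_Integration.integrable_add Bochner_Integration.integrable_diff integrable_const)
         (simp add: prob_space)
  qed
  also have "\<dots> \<le> occupation (strip \<delta>) s + r + c * (t - s)" using low by (simp add: algebra_simps)
  finally show ?thesis unfolding E_def r_def .
qed

text \<open>
  At scale \<open>T\<close> the strip has width \<open>T\<^sup>\<mu>\<close> and the barrier width \<open>T\<close> to the power \<open>\<mu>'\<close>, with \<open>1/\<beta> < \<mu> < \<mu>' < 1/\<theta>\<close>. The first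
  inequality makes the strip unlikely at time \<open>T\<close>, the second makes the barrier
  sharp, and the third keeps its loss over a time of order \<open>T\<close> small. All errors are powers of \<open>T\<close>
  with exponent at least \<open>k > 0\<close>.
\<close>

lemma escape_times:
  assumes D: "\<And>f. f \<in> C2c \<Longrightarrow> dynkin f"
  obtains t :: "nat \<Rightarrow> real" and C \<rho> :: real
  where "\<And>n. 0 < t n" "t \<longlonglongrightarrow> 0" "\<And>n. occupation (strip 0) (t n) = 0" "0 \<le> C" "0 \<le> \<rho>" "\<rho> < 1"
    "\<And>n. prob {\<omega> \<in> space P. \<omega> (t (Suc n)) \<in> V \<and> \<omega> (t n) \<notin> V} \<le> C * \<rho> ^ n"
proof -
  obtain \<theta> where \<theta>: "good_exponent \<theta>" using good_exponent_exists by blast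
  have "0 \<le> a * \<kappa>" using exponents \<kappa>_ge_1 by simp
  then have \<theta>0: "0 < \<theta>" and \<theta>\<beta>: "\<theta> < \<beta>" using \<theta> by (auto simp: good_exponent_def)
  obtain Cs where Cs: "0 < Cs" "\<And>\<delta> T. 0 < \<delta> \<Longrightarrow> \<delta> \<le> 1/8 \<Longrightarrow> 0 \<le> T \<Longrightarrow>
    (LINT u:{0..T}|lborel. occupation (strip \<delta>) u) \<le> Cs * (\<delta> powr \<beta> + T * \<delta> powr (\<beta> - \<theta>))"
    using strip_occupation[OF D \<theta>] by metis
  obtain Cl where Cl: "0 \<le> Cl"
    "\<And>\<delta> x. 0 < \<delta> \<Longrightarrow> \<delta> \<le> 1 \<Longrightarrow> - Cl * \<delta> powr (- \<theta>) \<le> L (strip_barrier \<delta>) x"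
    using L_strip_barrier_lower[OF \<theta>] by metis
  have "1 / \<beta> < 1 / \<theta>" using \<theta>0 \<theta>\<beta> by (simp add: frac_less2)
  then obtain \<mu>' where \<mu>': "1 / \<beta> < \<mu>'" "\<mu>' < 1 / \<theta>" using dense by blast
  then obtain \<mu> where \<mu>: "1 / \<beta> < \<mu>" "\<mu> < \<mu>'" using dense by blast
  have \<mu>0: "0 < \<mu>" using \<mu>(1) \<beta>_bounds by (meson less_trans zero_less_divide_1_iff)
  define k where "k = Min {\<mu> * \<beta> - 1, \<mu> * (\<beta> - \<theta>), (\<mu>' - \<mu>) * (1 - \<beta>), 1 - \<mu>' * \<theta>}"
  have k: "0 < k" "k \<le> \<mu> * \<beta> - 1" "k \<le> \<mu> * (\<beta> - \<theta>)" "k \<le> (\<mu>' - \<mu>) * (1 - \<beta>)" "k \<le> 1 - \<mu>' * \<theta>"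
  proof -
    have "0 < \<mu> * \<beta> - 1" "0 < 1 - \<mu>' * \<theta>" using \<mu>(1) \<mu>'(2) \<beta>_bounds \<theta>0 by (simp_all add: field_simps)
    moreover have "0 < \<mu> * (\<beta> - \<theta>)" "0 < (\<mu>' - \<mu>) * (1 - \<beta>)" using \<mu>(2) \<mu>0 \<beta>_bounds \<theta>\<beta> by simp_all
    ultimately show "0 < k" unfolding k_def by simp
  qed (simp_all add: k_def)
  \<comment> \<open>The largest scale at which the strip width is at most \<open>1/8\<close>.\<close>
  define T0 :: real where "T0 = (1/8) powr (1 / \<mu>)"
  have T0: "0 < T0" "T0 \<le> 1" "T0 powr \<mu> = 1/8" using \<mu>0 by (simp_all add: T0_def powr_le1 powr_powr)
  define T where "T n = T0 * (1/2) ^ n" for n :: nat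
  have T: "0 < T n" "T n \<le> T0" "T n \<le> 1" for n
  proof -
    have "(1/2 :: real) ^ n \<le> 1" by (simp add: power_le_one)
    then have "T0 * (1/2) ^ n \<le> T0 * 1" using T0 by (intro mult_left_mono) auto
    then have le: "T n \<le> T0" by (simp add: T_def)
    show "0 < T n" using T0 by (simp add: T_def)
    show "T n \<le> T0" "T n \<le> 1" using le T0 by linarith+
  qed
  define \<delta> where "\<delta> n = T n powr \<mu>" for n
  define \<epsilon> where "\<epsilon> n = T n powr \<mu>'" for n
  have \<delta>: "0 < \<delta> n" "\<delta> n \<le> 1/8" for n
  proof -
    have "T n powr \<mu> \<le> T0 powr \<mu>" using T \<mu>0 by (intro powr_mono2) (auto simp: less_imp_le)
    then show "0 < \<delta> n" "\<delta> n \<le> 1/8" using T[of n] T0 by (simp_all add: \<delta>_def)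
  qed
  have \<epsilon>: "0 < \<epsilon> n" "\<epsilon> n \<le> \<delta> n" for n
    using T[of n] \<mu>(2) by (auto simp: \<epsilon>_def \<delta>_def intro!: powr_mono')
  define R where "R n = Cs * (\<delta> n powr \<beta> + T n * \<delta> n powr (\<beta> - \<theta>))" for n
  have R: "0 < R n" for n using Cs(1) T[of n] \<delta>[of n] by (auto simp: R_def intro!: mult_pos_pos add_pos_pos)
  have "\<exists>t. T n / 2 \<le> t \<and> t \<le> T n \<and> occupation (strip 0) t = 0 \<and> occupation (strip (\<delta> n)) t \<le> 4 * R n / T n" for n
  proof -
    have "(LINT u:{0..T n}|lborel. occupation (strip (\<delta> n)) u) \<le> R n"
      unfolding R_def using T[of n] by (intro Cs(2) \<delta>) simp
    from exists_good_time[OF D T(1) R this] show ?thesis by metis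
  qed
  then obtain t where t: "\<And>n. T n / 2 \<le> t n" "\<And>n. t n \<le> T n" "\<And>n. occupation (strip 0) (t n) = 0"
      "\<And>n. occupation (strip (\<delta> n)) (t n) \<le> 4 * R n / T n" by metis
  have le_k: "T n powr q \<le> T n powr k" if "k \<le> q" for n q using that T by (intro powr_mono') (auto simp: less_imp_le)
  have TS: "T (Suc n) = T n / 2" for n by (simp add: T_def)
  define C where "C = (8 * Cs + 1 + 2 * Cl) * (T0 / 2) powr k"
  define \<rho> :: real where "\<rho> = (1/2) powr k"
  have step: "prob {\<omega> \<in> space P. \<omega> (t (Suc n)) \<in> V \<and> \<omega> (t n) \<notin> V} \<le> C * \<rho> ^ n" for n
  proof -
    let ?m = "Suc n"
    have st: "0 \<le> t ?m" "t ?m \<le> t n" using t(1)[of ?m] t(2)[of ?m] t(1)[of n] T[of ?m] TS[of n] by linarith+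
    have \<epsilon>1: "\<epsilon> ?m \<le> 1" using \<epsilon>[of ?m] \<delta>[of ?m] by linarith
    have low: "- (Cl * \<epsilon> ?m powr (- \<theta>)) \<le> L (strip_barrier (\<epsilon> ?m)) x" for x
      using Cl(2)[OF \<epsilon>(1) \<epsilon>1] by simp
    have "prob {\<omega> \<in> space P. \<omega> (t ?m) \<in> V \<and> \<omega> (t n) \<notin> V} \<le>
        occupation (strip (\<delta> ?m)) (t ?m) + (\<epsilon> ?m / \<delta> ?m) powr (1 - \<beta>) + Cl * \<epsilon> ?m powr (- \<theta>) * (t n - t ?m)"
      using Cl(1) by (intro sector_transition[OF D low _ \<epsilon> st]) simp_all
    also have "\<dots> \<le> 8 * Cs * T ?m powr k + T ?m powr k + 2 * Cl * T ?m powr k"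
    proof (intro add_mono)
      have e1: "\<delta> ?m powr \<beta> / T ?m = T ?m powr (\<mu> * \<beta> - 1)"
        using T[of ?m] by (simp add: \<delta>_def powr_powr powr_diff)
      have e2: "\<delta> ?m powr (\<beta> - \<theta>) = T ?m powr (\<mu> * (\<beta> - \<theta>))" by (simp add: \<delta>_def powr_powr)
      have "4 * R ?m / T ?m = 4 * Cs * (\<delta> ?m powr \<beta> / T ?m + \<delta> ?m powr (\<beta> - \<theta>))"
        using T[of ?m] by (simp add: R_def field_simps)
      also have "\<dots> \<le> 4 * Cs * (T ?m powr k + T ?m powr k)"
        unfolding e1 e2 using Cs(1) by (intro mult_left_mono add_mono le_k k) simp
      finally show "occupation (strip (\<delta> ?m)) (t ?m) \<le> 8 * Cs * T ?m powr k" using t(4)[of ?m] by simp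
      have "\<epsilon> ?m / \<delta> ?m = T ?m powr (\<mu>' - \<mu>)" by (simp add: \<epsilon>_def \<delta>_def powr_diff)
      then have "(\<epsilon> ?m / \<delta> ?m) powr (1 - \<beta>) = T ?m powr ((\<mu>' - \<mu>) * (1 - \<beta>))" by (simp add: powr_powr)
      then show "(\<epsilon> ?m / \<delta> ?m) powr (1 - \<beta>) \<le> T ?m powr k" using le_k[OF k(4)] by simp
      have "t n - t ?m \<le> 2 * T ?m" using t(2)[of n] st(1) TS[of n] by linarith
      then have "Cl * \<epsilon> ?m powr (- \<theta>) * (t n - t ?m) \<le> Cl * \<epsilon> ?m powr (- \<theta>) * (2 * T ?m)"
        using Cl(1) by (intro mult_left_mono) auto
      also have "\<dots> = 2 * Cl * (T ?m powr 1 * T ?m powr (- (\<mu>' * \<theta>)))"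
        using T[of ?m] by (simp add: \<epsilon>_def powr_powr)
      also have "T ?m powr 1 * T ?m powr (- (\<mu>' * \<theta>)) = T ?m powr (1 - \<mu>' * \<theta>)"
        by (subst powr_add[symmetric]) simp
      also have "2 * Cl * T ?m powr (1 - \<mu>' * \<theta>) \<le> 2 * Cl * T ?m powr k"
        using Cl(1) by (intro mult_left_mono le_k k) simp
      finally show "Cl * \<epsilon> ?m powr (- \<theta>) * (t n - t ?m) \<le> 2 * Cl * T ?m powr k" .
    qed
    also have "\<dots> = (8 * Cs + 1 + 2 * Cl) * T ?m powr k" by (simp add: algebra_simps)
    also have "T ?m powr k = (T0 / 2) powr k * \<rho> ^ n"
    proof -
      have "T ?m = (T0 / 2) * (1/2) ^ n" by (simp add: T_def)
      moreover have "((1/2 :: real) ^ n) powr k = \<rho> ^ n"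
        unfolding \<rho>_def by (simp add: powr_realpow[symmetric] powr_powr mult.commute)
      ultimately show ?thesis using T0 by (simp only: powr_mult)
    qed
    finally show ?thesis by (simp add: C_def mult.assoc)
  qed
  show ?thesis
  proof (rule that[of t C \<rho>])
    show "0 < t n" for n using t(1)[of n] T[of n] by linarith
    show "t \<longlonglongrightarrow> 0"
    proof (rule tendsto_sandwich[of "\<lambda>_. 0" t _ T])
      show "\<forall>\<^sub>F n in sequentially. 0 \<le> t n"
        using t(1) T by (intro always_eventually allI) (meson divide_nonneg_pos less_eq_real_def order_trans zero_less_numeral)
      show "\<forall>\<^sub>F n in sequentially. t n \<le> T n" using t(2) by simp
      have "(\<lambda>n. T0 * (1/2) ^ n) \<longlonglongrightarrow> T0 * 0" by (intro tendsto_intros LIMSEQ_realpow_zero) auto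
      then show "T \<longlonglongrightarrow> 0" by (simp add: T_def[abs_def])
    qed simp
    show "occupation (strip 0) (t n) = 0" for n by (rule t(3))
    show "0 \<le> \<rho>" by (simp add: \<rho>_def)
    show "\<rho> < 1" using powr_less_mono2[of k "1/2" 1] k(1) by (simp add: \<rho>_def)
    show "0 \<le> C" using Cs(1) Cl(1) by (simp add: C_def)
    show "prob {\<omega> \<in> space P. \<omega> (t (Suc n)) \<in> V \<and> \<omega> (t n) \<notin> V} \<le> C * \<rho> ^ n" for n by (rule step)
  qed
qed

end

section \<open>The mirror image of a solution\<close>

definition swap_path :: "(real \<Rightarrow> real \<times> real) \<Rightarrow> real \<Rightarrow> real \<times> real" where
  "swap_path \<omega> = restrict (\<lambda>u. prod.swap (\<omega> u)) {0..}"

lemma swap_path_apply: "0 \<le> u \<Longrightarrow> swap_path \<omega> u = prod.swap (\<omega> u)"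
  by (simp add: swap_path_def)

lemma swap_path_cadlag:
  assumes "\<omega> \<in> cadlag_paths" shows "swap_path \<omega> \<in> cadlag_paths"
  unfolding cadlag_paths_def mem_Collect_eq
proof (intro conjI allI impI)
  have sw: "isCont prod.swap (p :: real \<times> real)" for p
    unfolding prod.swap_def by (intro continuous_intros)
  show "swap_path \<omega> \<in> extensional {0..}" by (simp add: swap_path_def)
  show "continuous (at_right t) (swap_path \<omega>)" if t: "0 \<le> t" for t
  proof -
    have "(\<omega> \<longlongrightarrow> \<omega> t) (at_right t)" using assms t by (simp add: cadlag_paths_def continuous_within)
    then have "((\<lambda>u. prod.swap (\<omega> u)) \<longlongrightarrow> prod.swap (\<omega> t)) (at_right t)"
      by (rule isCont_tendsto_compose[OF sw])
    moreover have "\<forall>\<^sub>F u in at_right t. prod.swap (\<omega> u) = swap_path \<omega> u"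
      using t by (auto simp: eventually_at_right_field swap_path_apply intro!: exI[of _ "t + 1"])
    ultimately show ?thesis
      using t by (auto simp: continuous_within swap_path_apply intro: Lim_transform_eventually)
  qed
  show "\<exists>l. (swap_path \<omega> \<longlongrightarrow> l) (at_left t)" if t: "0 < t" for t
  proof -
    obtain l where "(\<omega> \<longlongrightarrow> l) (at_left t)" using assms t by (auto simp: cadlag_paths_def)
    then have "((\<lambda>u. prod.swap (\<omega> u)) \<longlongrightarrow> prod.swap l) (at_left t)"
      by (rule isCont_tendsto_compose[OF sw])
    moreover have "\<forall>\<^sub>F u in at_left t. prod.swap (\<omega> u) = swap_path \<omega> u"
      using t by (auto simp: eventually_at_left_field swap_path_apply intro!: exI[of _ 0])
    ultimately have "(swap_path \<omega> \<longlongrightarrow> prod.swap l) (at_left t)" by (rule Lim_transform_eventually)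
    then show ?thesis by blast
  qed
qed

lemma swap_path_measurable:
  assumes "T \<subseteq> {0..}" shows "swap_path \<in> measurable (coord_sigma T) (coord_sigma T)"
proof -
  have "swap_path \<in> measurable (coord_sigma T) (sigma cadlag_paths
     {(\<lambda>\<omega>. \<omega> s) -` A \<inter> cadlag_paths | s A. s \<in> T \<and> A \<in> sets (borel :: (real \<times> real) measure)})"
  proof (rule measurable_measure_of)
    show "swap_path \<in> space (coord_sigma T) \<rightarrow> cadlag_paths"
      by (auto simp: space_coord_sigma swap_path_cadlag)
    fix Y assume "Y \<in> {(\<lambda>\<omega>. \<omega> s) -` A \<inter> cadlag_paths | s A. s \<in> T \<and> A \<in> sets (borel :: (real \<times> real) measure)}"
    then obtain s A where Y: "Y = (\<lambda>\<omega>. \<omega> s) -` A \<inter> cadlag_paths" and s: "s \<in> T" and A: "A \<in> sets (borel :: (real \<times> real) measure)"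
      by blast
    have "(\<lambda>\<omega> :: real \<Rightarrow> real \<times> real. prod.swap (\<omega> s)) \<in> measurable (coord_sigma T) borel"
      by (rule measurable_compose[OF coord_measurable[OF s] swap_measurable])
    from measurable_sets[OF this A]
    have "(\<lambda>\<omega> :: real \<Rightarrow> real \<times> real. prod.swap (\<omega> s)) -` A \<inter> space (coord_sigma T) \<in> sets (coord_sigma T)" .
    moreover have "swap_path -` Y \<inter> space (coord_sigma T) = (\<lambda>\<omega>. prod.swap (\<omega> s)) -` A \<inter> space (coord_sigma T)"
      using s assms by (auto simp: Y space_coord_sigma swap_path_cadlag swap_path_apply)
    ultimately show "swap_path -` Y \<inter> space (coord_sigma T) \<in> sets (coord_sigma T)" by simp
  qed auto
  then show ?thesis unfolding coord_sigma_def .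
qed

lemma lipschitz_fun_swap: "lipschitz_fun K f \<Longrightarrow> lipschitz_fun K (\<lambda>x. f (prod.swap x))"
proof -
  assume f: "lipschitz_fun K f"
  have n: "norm (prod.swap x - prod.swap y) = norm (x - y)" for x y :: "real \<times> real"
    by (simp add: norm_prod_def add.commute)
  show ?thesis unfolding lipschitz_fun_def
    using lipschitz_funD[OF f, of "prod.swap _" "prod.swap _"] unfolding n by blast
qed

context jump_exponents
begin

lemma solution_path_setting:
  assumes "martingale_problem_solution L x P" shows "path_setting a b P"
proof -
  have "prob_space P" "sets P = sets path_space"
    using assms unfolding martingale_problem_solution_def by blast+
  then show ?thesis
    by (intro path_setting.intro path_prob.intro path_prob_axioms.intro jump_exponents_axioms)
qed

lemma solution_martingale:
  assumes "martingale_problem_solution L x P" "f \<in> C2c"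
  shows "martingale P path_filtration (path_setting.compensated a b f)"
proof -
  interpret path_setting a b P by (rule solution_path_setting[OF assms(1)])
  show ?thesis using assms unfolding martingale_problem_solution_def compensated_def[abs_def] by blast
qed

lemma solution_dynkin:
  assumes "martingale_problem_solution L x P" "f \<in> C2c"
  shows "path_setting.dynkin a b P f"
proof -
  interpret path_setting a b P by (rule solution_path_setting[OF assms(1)])
  show ?thesis by (rule martingale_imp_dynkin[OF assms(2) solution_martingale[OF assms]])
qed

lemma solution_adapted:
  assumes "martingale_problem_solution L x P" "f \<in> C2c" "0 \<le> t"
  shows "path_setting.compensated a b f t \<in> borel_measurable (path_filtration t)"
  using solution_martingale[OF assms(1,2)] assms(3) unfolding martingale_def by blast

lemma solutionI:
  assumes "path_setting a b Q" "measure Q {\<omega> \<in> space Q. \<omega> 0 = x} = 1"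
    and "\<And>f t. f \<in> C2c \<Longrightarrow> 0 \<le> t \<Longrightarrow> path_setting.compensated a b f t \<in> borel_measurable (path_filtration t)"
    and "\<And>f s t A. f \<in> C2c \<Longrightarrow> 0 \<le> s \<Longrightarrow> s \<le> t \<Longrightarrow> A \<in> sets (path_filtration s) \<Longrightarrow>
      (LINT \<omega>:A|Q. path_setting.compensated a b f t \<omega>) = (LINT \<omega>:A|Q. path_setting.compensated a b f s \<omega>)"
  shows "martingale_problem_solution L x Q"
proof -
  interpret path_setting a b Q by (rule assms(1))
  have "martingale Q path_filtration (compensated f)" if "f \<in> C2c" for f
    using assms(3,4)[OF that] by (rule martingaleI[OF that])
  then show ?thesis
    unfolding martingale_problem_solution_def compensated_def[abs_def]
    using prob_space_axioms sets_P assms(2) by blast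
qed

text \<open>
  For almost every path the set of times on the diagonals is a null set, so the compensated process of \<open>f\<close> along
  the swapped path is that of \<open>f \<circ> swap\<close> along the original one.
\<close>

lemma swap_solution:
  assumes sol: "martingale_problem_solution L 0 P"
  shows "martingale_problem_solution L 0 (distr P path_space swap_path)"
proof -
  interpret P: path_setting a b P by (rule solution_path_setting[OF sol])
  let ?Q = "distr P path_space swap_path"
  have swm: "swap_path \<in> measurable P path_space"
    unfolding measurable_cong_sets[OF P.sets_P refl] path_space_def by (rule swap_path_measurable) simp
  have pQ: "prob_space ?Q" by (rule P.prob_space_distr[OF swm])
  have setQ: "path_setting a b ?Q"
    by (intro path_setting.intro path_prob.intro path_prob_axioms.intro jump_exponents_axioms pQ) simp
  have D: "P.dynkin f" if "f \<in> C2c" for f by (rule solution_dynkin[OF sol that])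
  note ad = solution_adapted[OF sol]
  have space: "space path_space = (cadlag_paths :: (real \<Rightarrow> real \<times> real) set)"
    by (simp add: path_space_def space_coord_sigma)
  have offdiag: "AE \<omega> in P. AE u in lborel. u \<in> {0..t} \<longrightarrow> gap (\<omega> u) \<noteq> 0" if t: "0 \<le> t" for t
  proof -
    note im = P.ind_meas[OF P.strip_sets[of 0]]
    let ?I = "\<lambda>\<omega>. LINT u:{0..t}|lborel. (indicator (P.strip 0) (\<omega> u) :: real)"
    have int: "integrable P (\<lambda>\<omega>. indicator (space P) \<omega> * ?I \<omega>)"
      by (rule P.path_integral_fubini(2)[OF im P.ind_bound sets.top order_refl t])
    have "(LINT \<omega>:space P|P. ?I \<omega>) = (LINT u:{0..t}|lborel. P.occupation (P.strip 0) u)"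
      unfolding P.occupation_def by (rule P.path_integral_fubini(3)[OF im P.ind_bound sets.top order_refl t])
    also have "\<dots> = 0" by (rule P.diagonal_null[OF D t])
    finally have z: "(LINT \<omega>|P. indicator (space P) \<omega> * ?I \<omega>) = 0" by (simp add: set_lebesgue_integral_def)
    have Inn: "0 \<le> ?I \<omega>" for \<omega> :: "real \<Rightarrow> real \<times> real"
      unfolding set_lebesgue_integral_def by (rule Bochner_Integration.integral_nonneg) (simp add: indicator_def)
    have "AE \<omega> in P. indicator (space P) \<omega> * ?I \<omega> = 0"
      using integral_nonneg_eq_0_iff_AE[OF int] z Inn by simp
    with AE_space[of P] show ?thesis
    proof eventually_elim
      case (elim \<omega>)
      then have w: "\<omega> \<in> cadlag_paths" and I0: "?I \<omega> = 0" by (simp_all add: P.space_P)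
      have "integrable lborel (\<lambda>u. indicator {0..t} u *\<^sub>R (indicator (P.strip 0) (\<omega> u) :: real))"
        using P.path_set_integrable[OF im P.ind_bound w order_refl subset_refl, of t] unfolding set_integrable_def by simp
      from integral_nonneg_eq_0_iff_AE[OF this] I0
      have "AE u in lborel. indicator {0..t} u *\<^sub>R (indicator (P.strip 0) (\<omega> u) :: real) = 0"
        by (simp add: set_lebesgue_integral_def)
      then show ?case by eventually_elim (auto simp: indicator_def P.strip_def)
    qed
  qed
  have comp: "AE \<omega> in P. P.compensated f t (swap_path \<omega>) = P.compensated (\<lambda>x. f (prod.swap x)) t \<omega>"
    if f: "f \<in> C2c" and t: "0 \<le> t" for f t
  proof -
    obtain K B where lip: "lipschitz_fun K f" and bd: "\<And>x. \<bar>f x\<bar> \<le> B" using C2c_lipschitz_bounded[OF f] by blast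
    have fm: "f \<in> borel_measurable borel" by (rule lipschitz_fun_measurable[OF lip])
    have Lfm: "L f \<in> borel_measurable borel" by (rule L_measurable[OF fm])
    have lip': "lipschitz_fun K (\<lambda>x. f (prod.swap x))" by (rule lipschitz_fun_swap[OF lip])
    have Lfm': "L (\<lambda>x. f (prod.swap x)) \<in> borel_measurable borel" by (rule L_measurable[OF lipschitz_fun_measurable[OF lip']])
    show ?thesis
      using offdiag[OF t] AE_space[of P]
    proof eventually_elim
      case (elim \<omega>)
      then have w: "\<omega> \<in> cadlag_paths" by (simp add: P.space_P)
      have "(LINT u:{0..t}|lborel. L f (swap_path \<omega> u)) = (LINT u:{0..t}|lborel. L (\<lambda>x. f (prod.swap x)) (\<omega> u))"
        unfolding set_lebesgue_integral_def
      proof (rule integral_cong_AE)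
        show "(\<lambda>u. indicator {0..t} u *\<^sub>R L f (swap_path \<omega> u)) \<in> borel_measurable lborel"
          using P.path_set_integrable[OF Lfm L_bound[OF lip] swap_path_cadlag[OF w] order_refl subset_refl, of t]
          unfolding set_integrable_def by (intro borel_measurable_integrable) simp
        show "(\<lambda>u. indicator {0..t} u *\<^sub>R L (\<lambda>x. f (prod.swap x)) (\<omega> u)) \<in> borel_measurable lborel"
          using P.path_set_integrable[OF Lfm' L_bound[OF lip'] w order_refl subset_refl, of t]
          unfolding set_integrable_def by (intro borel_measurable_integrable) simp
        show "AE u in lborel. indicator {0..t} u *\<^sub>R L f (swap_path \<omega> u) = indicator {0..t} u *\<^sub>R L (\<lambda>x. f (prod.swap x)) (\<omega> u)"
          using elim(1)
        proof eventually_elim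
          case (elim u)
          show ?case
          proof (cases "u \<in> {0..t}")
            case True
            then show ?thesis using L_swap[OF fm, of "\<omega> u"] elim by (simp add: swap_path_apply)
          qed simp
        qed
      qed
      then show ?case using t by (simp add: P.compensated_def swap_path_apply)
    qed
  qed
  show ?thesis
  proof (rule solutionI[OF setQ _ ad])
    have z: "{\<omega> \<in> space path_space. \<omega> 0 = (0::real \<times> real)} \<in> sets path_space"
      using P.coord_sets[of "{0}" 0] by (simp add: P.sets_P sets_eq_imp_space_eq[OF P.sets_P])
    have "measure ?Q {\<omega> \<in> space ?Q. \<omega> 0 = 0} = measure P (swap_path -` {\<omega> \<in> space path_space. \<omega> 0 = 0} \<inter> space P)"
      using z by (simp add: measure_distr[OF swm])
    also have "swap_path -` {\<omega> \<in> space path_space. \<omega> 0 = 0} \<inter> space P = {\<omega> \<in> space P. \<omega> 0 = 0}"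
      by (auto simp: space P.space_P swap_path_cadlag swap_path_apply prod_eq_iff)
    also have "measure P \<dots> = 1" using sol unfolding martingale_problem_solution_def by blast
    finally show "measure ?Q {\<omega> \<in> space ?Q. \<omega> 0 = 0} = 1" .
  next
    fix f :: "real \<times> real \<Rightarrow> real" and s t :: real and A :: "(real \<Rightarrow> real \<times> real) set"
    assume f: "f \<in> C2c" and st: "0 \<le> s" "s \<le> t" and A: "A \<in> sets (path_filtration s)"
    have t0: "0 \<le> t" using st by simp
    obtain K B where lip: "lipschitz_fun K f" and bd: "\<And>x. \<bar>f x\<bar> \<le> B" using C2c_lipschitz_bounded[OF f] by blast
    have lip': "lipschitz_fun K (\<lambda>x. f (prod.swap x))" by (rule lipschitz_fun_swap[OF lip])
    define A' where "A' = swap_path -` A \<inter> space P"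
    have A': "A' \<in> sets (path_filtration s)"
      using measurable_sets[OF swap_path_measurable[of "{0..s}"], of A] A
      by (simp add: A'_def path_filtration_def P.space_P space_coord_sigma subset_eq)
    note AP' = P.filtration_sets[OF A']
    have AQ: "A \<in> sets path_space"
      using P.filtration_sets[OF A] by (simp add: P.sets_P)
    have tr: "(LINT \<omega>:A|?Q. P.compensated f u \<omega>) = (LINT \<omega>:A'|P. P.compensated (\<lambda>x. f (prod.swap x)) u \<omega>)" if u: "0 \<le> u" for u
    proof -
      have cm: "P.compensated f u \<in> borel_measurable path_space"
        using P.compensated_measurable[OF lip bd u] measurable_cong_sets[OF P.sets_P refl] by blast
      have "(LINT \<omega>:A|?Q. P.compensated f u \<omega>) = (LINT \<omega>|P. indicator A (swap_path \<omega>) *\<^sub>R P.compensated f u (swap_path \<omega>))"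
        unfolding set_lebesgue_integral_def
        by (rule integral_distr[OF swm]) (intro borel_measurable_scaleR borel_measurable_indicator AQ cm)
      also have "\<dots> = (LINT \<omega>|P. indicator A' \<omega> *\<^sub>R P.compensated (\<lambda>x. f (prod.swap x)) u \<omega>)"
      proof (rule integral_cong_AE)
        show "(\<lambda>\<omega>. indicator A (swap_path \<omega>) *\<^sub>R P.compensated f u (swap_path \<omega>)) \<in> borel_measurable P"
          by (rule measurable_compose[OF swm]) (intro borel_measurable_scaleR borel_measurable_indicator AQ cm)
        show "(\<lambda>\<omega>. indicator A' \<omega> *\<^sub>R P.compensated (\<lambda>x. f (prod.swap x)) u \<omega>) \<in> borel_measurable P"
          by (intro borel_measurable_scaleR borel_measurable_indicator AP' P.compensated_measurable[OF lip' _ u, of B]) (rule bd)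
        show "AE \<omega> in P. indicator A (swap_path \<omega>) *\<^sub>R P.compensated f u (swap_path \<omega>) = indicator A' \<omega> *\<^sub>R P.compensated (\<lambda>x. f (prod.swap x)) u \<omega>"
          using comp[OF f u] AE_space[of P] by eventually_elim (simp add: A'_def indicator_def)
      qed
      finally show ?thesis unfolding set_lebesgue_integral_def .
    qed
    have "P.dynkin (\<lambda>x. f (prod.swap x))" by (rule P.dynkin_lipschitz[OF D lip' bd])
    from P.dynkinD[OF this st A']
    have "(LINT \<omega>:A'|P. P.compensated (\<lambda>x. f (prod.swap x)) t \<omega>) = (LINT \<omega>:A'|P. P.compensated (\<lambda>x. f (prod.swap x)) s \<omega>)"
      using P.compensated_set_integral_eq_iff[OF lip' bd AP' st] by blast
    then show "(LINT \<omega>:A|?Q. P.compensated f t \<omega>) = (LINT \<omega>:A|?Q. P.compensated f s \<omega>)"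
      using tr[OF t0] tr[OF st(1)] by simp
  qed
qed

end

section \<open>Conditioning on the germ of a solution\<close>

context jump_exponents
begin

text \<open>
  The events \<open>B n\<close> belong to the past of times that tend to \<open>0\<close>. Once \<open>t n \<le> s\<close> the martingale property on
  \<open>A \<inter> B n\<close> is part of the hypothesis, and it passes to the limit. For \<open>s = 0\<close> it is obtained from times
  \<open>r > 0\<close> that tend to \<open>0\<close>, by right continuity of the compensated process.
\<close>

lemma conditioned_solution:
  assumes sol: "martingale_problem_solution L x P"
    and t: "\<And>n. 0 < t n" "t \<longlonglongrightarrow> 0"
    and Bn: "\<And>n. B n \<in> sets (path_filtration (t n))"
    and B: "B' \<in> sets P" "measure P B' = 1 / 2"
    and lim: "AE \<omega> in P. (\<lambda>n::nat. indicator (B n) \<omega> :: real) \<longlonglongrightarrow> indicator B' \<omega>"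
  shows "martingale_problem_solution L x (density P (\<lambda>\<omega>. ennreal (2 * indicator B' \<omega>)))"
proof -
  interpret P: path_setting a b P by (rule solution_path_setting[OF sol])
  let ?Q = "density P (\<lambda>\<omega>. ennreal (2 * indicator B' \<omega>))"
  have dm: "(\<lambda>\<omega>. ennreal (2 * indicator B' \<omega>)) \<in> borel_measurable P" using B(1) by simp
  have setsQ: "sets ?Q = sets path_space" by (simp add: P.sets_P)
  have "emeasure ?Q (space ?Q) = (\<integral>\<^sup>+\<omega>. ennreal (2 * indicator B' \<omega>) * indicator (space P) \<omega> \<partial>P)"
    using emeasure_density[OF dm sets.top] by simp
  also have "\<dots> = (\<integral>\<^sup>+\<omega>. 2 * indicator B' \<omega> \<partial>P)"
    by (intro nn_integral_cong) (simp add: indicator_def)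
  also have "\<dots> = 2 * emeasure P B'" using B(1) by (simp add: nn_integral_cmult_indicator)
  also have "\<dots> = 2 * ennreal (1/2)" by (simp only: P.emeasure_eq_measure B(2))
  also have "\<dots> = ennreal 2 * ennreal (1/2)" by (simp only: ennreal_numeral)
  also have "\<dots> = ennreal (2 * (1/2))" by (rule ennreal_mult[symmetric]) simp_all
  finally have "emeasure ?Q (space ?Q) = 1" by simp
  then have pQ: "prob_space ?Q" by (rule prob_spaceI)
  have setQ: "path_setting a b ?Q"
    by (intro path_setting.intro path_prob.intro path_prob_axioms.intro jump_exponents_axioms pQ setsQ)
  have D: "P.dynkin f" if "f \<in> C2c" for f by (rule solution_dynkin[OF sol that])
  show ?thesis
  proof (rule solutionI[OF setQ _ solution_adapted[OF sol]])
    have p1: "P.prob {\<omega> \<in> space P. \<omega> 0 = x} = 1" using sol unfolding martingale_problem_solution_def by blast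
    have s: "{\<omega> \<in> space P. \<omega> 0 = x} \<in> sets P" using P.coord_sets[of "{x}" 0] by simp
    have "AE \<omega> in P. \<omega> \<in> {\<omega> \<in> space P. \<omega> 0 = x}" using P.prob_eq_1[OF s] p1 by blast
    then have "AE \<omega> in ?Q. \<omega> \<in> {\<omega> \<in> space P. \<omega> 0 = x}"
      unfolding AE_density[OF dm] by eventually_elim simp
    then show "measure ?Q {\<omega> \<in> space ?Q. \<omega> 0 = x} = 1"
      using prob_space.prob_eq_1[OF pQ, of "{\<omega> \<in> space P. \<omega> 0 = x}"] s by simp
  next
    fix f :: "real \<times> real \<Rightarrow> real" and s u :: real and A :: "(real \<Rightarrow> real \<times> real) set"
    assume f: "f \<in> C2c" and su: "0 \<le> s" "s \<le> u" and A: "A \<in> sets (path_filtration s)"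
    have u0: "0 \<le> u" using su by simp
    obtain K C where lip: "lipschitz_fun K f" and bd: "\<And>x. \<bar>f x\<bar> \<le> C" using C2c_lipschitz_bounded[OF f] by blast
    let ?Y = "P.compensated f"
    note Ym = P.compensated_measurable[OF lip bd] and Yi = P.compensated_integrable[OF lip bd]
    note AP = P.filtration_sets[OF A]
    have Bs: "B n \<in> sets P" for n by (rule P.filtration_sets[OF Bn])
    have toP: "(LINT \<omega>:A|?Q. F \<omega>) = 2 * (LINT \<omega>:A \<inter> B'|P. F \<omega>)" if "F \<in> borel_measurable P" for F :: "(real \<Rightarrow> real \<times> real) \<Rightarrow> real"
    proof -
      have "(LINT \<omega>:A|?Q. F \<omega>) = (LINT \<omega>|P. (2 * indicator B' \<omega>) *\<^sub>R (indicator A \<omega> *\<^sub>R F \<omega>))"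
        unfolding set_lebesgue_integral_def
      proof (rule integral_density)
        show "(\<lambda>\<omega>. indicator A \<omega> *\<^sub>R F \<omega>) \<in> borel_measurable P"
          by (intro borel_measurable_scaleR borel_measurable_indicator AP that)
        show "(\<lambda>\<omega>. 2 * indicator B' \<omega> :: real) \<in> borel_measurable P"
          by (intro borel_measurable_times borel_measurable_const borel_measurable_indicator B(1))
      qed simp
      also have "\<dots> = (LINT \<omega>|P. 2 * (indicator (A \<inter> B') \<omega> *\<^sub>R F \<omega>))"
        by (rule Bochner_Integration.integral_cong) (simp_all add: indicator_inter_arith)
      finally show ?thesis by (simp add: set_lebesgue_integral_def)
    qed
    have later: "(LINT \<omega>:A \<inter> B'|P. ?Y u \<omega>) = (LINT \<omega>:A \<inter> B'|P. ?Y r \<omega>)" if r: "0 < r" "s \<le> r" "r \<le> u" for r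
    proof -
      have r0: "0 \<le> r" using r by simp
      have conv: "(\<lambda>n. LINT \<omega>:A \<inter> B n|P. ?Y v \<omega>) \<longlonglongrightarrow> (LINT \<omega>:A \<inter> B'|P. ?Y v \<omega>)" if v: "0 \<le> v" for v
        unfolding set_lebesgue_integral_def
      proof (rule integral_dominated_convergence)
        show "(\<lambda>\<omega>. indicator (A \<inter> B') \<omega> *\<^sub>R ?Y v \<omega>) \<in> borel_measurable P"
          by (intro borel_measurable_scaleR borel_measurable_indicator sets.Int AP B(1) Ym v)
        show "(\<lambda>\<omega>. indicator (A \<inter> B n) \<omega> *\<^sub>R ?Y v \<omega>) \<in> borel_measurable P" for n
          by (intro borel_measurable_scaleR borel_measurable_indicator sets.Int AP Bs Ym v)
        show "integrable P (\<lambda>\<omega>. norm (?Y v \<omega>))" by (rule integrable_norm[OF Yi[OF v]])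
        show "AE \<omega> in P. (\<lambda>n. indicator (A \<inter> B n) \<omega> *\<^sub>R ?Y v \<omega>) \<longlonglongrightarrow> indicator (A \<inter> B') \<omega> *\<^sub>R ?Y v \<omega>"
          using lim
        proof eventually_elim
          case (elim \<omega>)
          have "(\<lambda>n. (indicator A \<omega> * indicator (B n) \<omega>) *\<^sub>R ?Y v \<omega>) \<longlonglongrightarrow> (indicator A \<omega> * indicator B' \<omega>) *\<^sub>R ?Y v \<omega>"
            by (intro tendsto_scaleR tendsto_mult tendsto_const elim)
          then show ?case by (simp only: indicator_inter_arith)
        qed
        show "AE \<omega> in P. norm (indicator (A \<inter> B n) \<omega> *\<^sub>R ?Y v \<omega>) \<le> norm (?Y v \<omega>)" for n
          by (rule AE_I2) (simp add: indicator_def)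
      qed
      have "\<forall>\<^sub>F n in sequentially. t n < r" using t(2) r(1) by (rule order_tendstoD(2))
      then have "\<forall>\<^sub>F n in sequentially. (LINT \<omega>:A \<inter> B n|P. ?Y u \<omega>) = (LINT \<omega>:A \<inter> B n|P. ?Y r \<omega>)"
      proof eventually_elim
        case (elim n)
        have "B n \<in> sets (path_filtration r)"
          using Bn[of n] sets_coord_sigma_mono[of "{0..t n}" "{0..r}"] elim by (auto simp: path_filtration_def)
        moreover have "A \<in> sets (path_filtration r)"
          using A sets_coord_sigma_mono[of "{0..s}" "{0..r}"] r(2) by (auto simp: path_filtration_def)
        ultimately have AB: "A \<inter> B n \<in> sets (path_filtration r)" by (rule sets.Int[rotated])
        show ?case
          using P.compensated_set_integral_eq_iff[OF lip bd P.filtration_sets[OF AB] r0 r(3)]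
            P.dynkinD[OF D[OF f] r0 r(3) AB] by blast
      qed
      then have "(\<lambda>n. LINT \<omega>:A \<inter> B n|P. ?Y u \<omega>) \<longlonglongrightarrow> (LINT \<omega>:A \<inter> B'|P. ?Y r \<omega>)"
        using conv[OF r0] by (subst tendsto_cong)
      then show ?thesis using conv[OF u0] by (rule LIMSEQ_unique[rotated])
    qed
    have "(LINT \<omega>:A \<inter> B'|P. ?Y u \<omega>) = (LINT \<omega>:A \<inter> B'|P. ?Y s \<omega>)"
    proof (cases "0 < s \<or> u = s")
      case True
      then show ?thesis using later[of s] su by auto
    next
      case False
      then have s0: "s = 0" and u: "0 < u" using su by auto
      define r where "r n = min u (1 / real (Suc n))" for n
      have r: "0 < r n" "r n \<le> u" for n using u by (simp_all add: r_def)
      have rl: "r \<longlonglongrightarrow> 0"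
      proof -
        have "(\<lambda>n. 1 / real (Suc n)) \<longlonglongrightarrow> 0" using lim_inverse_n'[THEN LIMSEQ_Suc] by simp
        then have "(\<lambda>n. min u (1 / real (Suc n))) \<longlonglongrightarrow> min u 0" by (intro tendsto_min tendsto_const)
        then show ?thesis using u by (simp add: r_def[abs_def] min_def)
      qed
      have fc: "continuous_on UNIV f" by (rule lipschitz_fun_continuous[OF lip])
      have Lfm: "L f \<in> borel_measurable borel" by (rule L_measurable[OF lipschitz_fun_measurable[OF lip]])
      have "(\<lambda>n. LINT \<omega>:A \<inter> B'|P. ?Y (r n) \<omega>) \<longlonglongrightarrow> (LINT \<omega>:A \<inter> B'|P. ?Y 0 \<omega>)"
        unfolding set_lebesgue_integral_def
      proof (rule integral_dominated_convergence)
        show "(\<lambda>\<omega>. indicator (A \<inter> B') \<omega> *\<^sub>R ?Y 0 \<omega>) \<in> borel_measurable P"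
          by (intro borel_measurable_scaleR borel_measurable_indicator sets.Int AP B(1) Ym order_refl)
        show "(\<lambda>\<omega>. indicator (A \<inter> B') \<omega> *\<^sub>R ?Y (r n) \<omega>) \<in> borel_measurable P" for n
          by (intro borel_measurable_scaleR borel_measurable_indicator sets.Int AP B(1) Ym less_imp_le r)
        show "integrable P (\<lambda>\<omega>. 2 * C + K * moment * u)" by simp
        show "AE \<omega> in P. norm (indicator (A \<inter> B') \<omega> *\<^sub>R ?Y (r n) \<omega>) \<le> 2 * C + K * moment * u" for n
        proof (rule AE_I2)
          fix \<omega> assume "\<omega> \<in> space P"
          then have "\<bar>?Y (r n) \<omega>\<bar> \<le> 2 * C + K * moment * r n"
            using P.compensated_bound[OF lip bd _ less_imp_le[OF r(1)]] by (simp add: P.space_P)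
          also have "\<dots> \<le> 2 * C + K * moment * u"
            using r(2) moment_nonneg lipschitz_fun_nonneg[OF lip] by (intro add_left_mono mult_left_mono) auto
          finally show "norm (indicator (A \<inter> B') \<omega> *\<^sub>R ?Y (r n) \<omega>) \<le> 2 * C + K * moment * u"
            using abs_ge_zero[of "?Y (r n) \<omega>"] by (cases "\<omega> \<in> A \<inter> B'") (simp_all del: Int_iff abs_ge_zero)
        qed
        show "AE \<omega> in P. (\<lambda>n. indicator (A \<inter> B') \<omega> *\<^sub>R ?Y (r n) \<omega>) \<longlonglongrightarrow> indicator (A \<inter> B') \<omega> *\<^sub>R ?Y 0 \<omega>"
        proof (rule AE_I2)
          fix \<omega> assume "\<omega> \<in> space P"
          then have w: "\<omega> \<in> cadlag_paths" by (simp add: P.space_P)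
          have "(\<lambda>n. f (\<omega> (r n))) \<longlonglongrightarrow> f (\<omega> 0)"
            by (rule continuous_on_tendsto_compose[OF fc cadlag_right_limit[OF w order_refl rl r(1)]]) auto
          moreover have "(\<lambda>n. LINT v:{0..r n}|lborel. L f (\<omega> v)) \<longlonglongrightarrow> 0"
          proof (rule Lim_null_comparison)
            have "\<bar>LINT v:{0..r n}|lborel. L f (\<omega> v)\<bar> \<le> K * moment * (r n - 0)" for n
              by (rule P.path_integral_bound[OF Lfm L_bound[OF lip] w order_refl less_imp_le[OF r(1)]])
            then show "\<forall>\<^sub>F n in sequentially. norm (LINT v:{0..r n}|lborel. L f (\<omega> v)) \<le> K * moment * r n" by simp
            show "(\<lambda>n. K * moment * r n) \<longlonglongrightarrow> 0" using tendsto_mult_left[OF rl, of "K * moment"] by simp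
          qed
          ultimately have "(\<lambda>n. ?Y (r n) \<omega>) \<longlonglongrightarrow> f (\<omega> 0) - f (\<omega> 0) - 0"
            unfolding P.compensated_def by (intro tendsto_diff tendsto_const)
          moreover have "?Y 0 \<omega> = 0"
            using P.path_integral_bound[OF Lfm L_bound[OF lip] w order_refl order_refl] by (simp add: P.compensated_def)
          ultimately show "(\<lambda>n. indicator (A \<inter> B') \<omega> *\<^sub>R ?Y (r n) \<omega>) \<longlonglongrightarrow> indicator (A \<inter> B') \<omega> *\<^sub>R ?Y 0 \<omega>"
            by (intro tendsto_scaleR tendsto_const) simp
        qed
      qed
      moreover have "(LINT \<omega>:A \<inter> B'|P. ?Y (r n) \<omega>) = (LINT \<omega>:A \<inter> B'|P. ?Y u \<omega>)" for n
        using later[OF r(1) _ r(2), of n] r(1)[of n] s0 by simp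
      ultimately have "(\<lambda>n::nat. LINT \<omega>:A \<inter> B'|P. ?Y u \<omega>) \<longlonglongrightarrow> (LINT \<omega>:A \<inter> B'|P. ?Y 0 \<omega>)" by simp
      then show ?thesis unfolding s0 using LIMSEQ_const_iff by blast
    qed
    then show "(LINT \<omega>:A|?Q. ?Y u \<omega>) = (LINT \<omega>:A|?Q. ?Y s \<omega>)"
      using toP[OF Ym[OF u0]] toP[OF Ym[OF su(1)]] by simp
  qed
qed

lemma martingale_problem_not_unique:
  assumes sol: "martingale_problem_solution L 0 P"
    and unique: "\<And>Q. martingale_problem_solution L 0 Q \<Longrightarrow> Q = P"
  shows False
proof -
  interpret P: path_setting a b P by (rule solution_path_setting[OF sol])
  have D: "P.dynkin f" if "f \<in> C2c" for f by (rule solution_dynkin[OF sol that])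
  have swm: "swap_path \<in> measurable P path_space"
    unfolding measurable_cong_sets[OF P.sets_P refl] path_space_def by (rule swap_path_measurable) simp
  have swapP: "distr P path_space swap_path = P" by (rule unique[OF swap_solution[OF sol]])
  let ?E = "\<lambda>u. {\<omega> \<in> space P. \<omega> u \<in> V}"
  have half: "P.prob (?E u) = 1 / 2" if u: "0 \<le> u" "P.occupation (P.strip 0) u = 0" for u
  proof -
    note Es = P.coord_sets[OF V_sets u(1)]
    have Ds: "{\<omega> \<in> space P. \<omega> u \<in> P.strip 0} \<in> sets P" by (rule P.coord_sets[OF P.strip_sets u(1)])
    have Vsw: "prod.swap -` V \<in> sets borel"
      using measurable_sets[OF swap_measurable V_sets] by simp
    note Fs = P.coord_sets[OF Vsw u(1)]
    have "P.prob (?E u) = measure (distr P path_space swap_path) (?E u)" by (simp add: swapP)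
    also have "\<dots> = P.prob (swap_path -` (?E u) \<inter> space P)"
      using Es by (intro measure_distr[OF swm]) (simp add: P.sets_P)
    also have "swap_path -` (?E u) \<inter> space P = {\<omega> \<in> space P. \<omega> u \<in> prod.swap -` V}"
      using u(1) by (auto simp: P.space_P swap_path_cadlag swap_path_apply)
    finally have sym: "P.prob (?E u) = P.prob {\<omega> \<in> space P. \<omega> u \<in> prod.swap -` V}" .
    have z: "P.prob {\<omega> \<in> space P. \<omega> u \<in> P.strip 0} = 0"
      using u P.occupation_eq_prob[OF P.strip_sets u(1)] by simp
    have dis: "(?E u \<union> {\<omega> \<in> space P. \<omega> u \<in> prod.swap -` V}) \<inter> {\<omega> \<in> space P. \<omega> u \<in> P.strip 0} = {}"
      "?E u \<inter> {\<omega> \<in> space P. \<omega> u \<in> prod.swap -` V} = {}"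
      by (auto simp: V_iff_gap gap_swap P.strip_def)
    have "P.prob (space P) = P.prob (?E u \<union> {\<omega> \<in> space P. \<omega> u \<in> prod.swap -` V} \<union> {\<omega> \<in> space P. \<omega> u \<in> P.strip 0})"
      by (rule arg_cong[where f = P.prob]) (auto simp: V_iff_gap gap_swap P.strip_def)
    also have "\<dots> = P.prob (?E u \<union> {\<omega> \<in> space P. \<omega> u \<in> prod.swap -` V}) + P.prob {\<omega> \<in> space P. \<omega> u \<in> P.strip 0}"
      by (rule P.finite_measure_Union[OF sets.Un[OF Es Fs] Ds dis(1)])
    also have "P.prob (?E u \<union> {\<omega> \<in> space P. \<omega> u \<in> prod.swap -` V}) = P.prob (?E u) + P.prob {\<omega> \<in> space P. \<omega> u \<in> prod.swap -` V}"
      by (rule P.finite_measure_Union[OF Es Fs dis(2)])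
    finally show ?thesis using sym z P.prob_space by simp
  qed
  obtain t C \<rho> where t: "\<And>n::nat. 0 < t n" "t \<longlonglongrightarrow> 0" "\<And>n. P.occupation (P.strip 0) (t n) = 0"
    and \<rho>: "0 \<le> C" "0 \<le> \<rho>" "\<rho> < 1"
    and tr: "\<And>n. P.prob {\<omega> \<in> space P. \<omega> (t (Suc n)) \<in> V \<and> \<omega> (t n) \<notin> V} \<le> C * \<rho> ^ n"
    by (rule P.escape_times[OF D], assumption, rule that)
  define B where "B n = ?E (t n)" for n
  have tn: "0 \<le> t n" for n using t(1)[of n] by simp
  have Bs: "B n \<in> sets P" for n unfolding B_def by (rule P.coord_sets[OF V_sets tn])
  have BF: "B n \<in> sets (path_filtration (t n))" for n
    unfolding B_def by (rule P.coord_event_in_filtration[OF V_sets tn order_refl])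
  have PB: "P.prob (B n) = 1 / 2" for n unfolding B_def by (rule half[OF tn t(3)])
  define N where "N n = (B n - B (Suc n)) \<union> (B (Suc n) - B n)" for n
  have Ns: "N n \<in> sets P" for n unfolding N_def using Bs by blast
  have PN: "P.prob (N n) \<le> 2 * C * \<rho> ^ n" for n
  proof -
    have "P.prob (B (Suc n) - B n) = P.prob (B (Suc n)) - P.prob (B (Suc n) \<inter> B n)"
      by (rule P.finite_measure_Diff'[OF Bs Bs])
    moreover have "P.prob (B n - B (Suc n)) = P.prob (B n) - P.prob (B n \<inter> B (Suc n))"
      by (rule P.finite_measure_Diff'[OF Bs Bs])
    ultimately have "P.prob (B n - B (Suc n)) = P.prob (B (Suc n) - B n)" by (simp add: PB Int_commute)
    moreover have "P.prob (B (Suc n) - B n) \<le> C * \<rho> ^ n"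
    proof -
      have "B (Suc n) - B n = {\<omega> \<in> space P. \<omega> (t (Suc n)) \<in> V \<and> \<omega> (t n) \<notin> V}" by (auto simp: B_def)
      then show ?thesis using tr[of n] by simp
    qed
    moreover have "P.prob (N n) \<le> P.prob (B n - B (Suc n)) + P.prob (B (Suc n) - B n)"
      unfolding N_def by (rule measure_Un_le) (use Bs in blast)+
    ultimately show ?thesis by simp
  qed
  have "summable (\<lambda>n. P.prob (N n))"
  proof (rule summable_comparison_test')
    show "summable (\<lambda>n. 2 * C * \<rho> ^ n)" using \<rho> by (intro summable_mult summable_geometric) simp
    show "norm (P.prob (N n)) \<le> 2 * C * \<rho> ^ n" if "0 \<le> n" for n using PN[of n] by simp
  qed
  then have BC: "AE \<omega> in P. \<forall>\<^sub>F n in sequentially. \<omega> \<in> space P - N n"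
    by (intro borel_cantelli_AE1 Ns) (simp_all add: less_top[symmetric])
  \<comment> \<open>Almost surely \<open>X\<^bsub>t\<^sub>n\<^esub> \<in> V\<close> eventually always or eventually never.\<close>
  define B' where "B' = {\<omega> \<in> space P. \<forall>\<^sub>F n in sequentially. \<omega> \<in> B n}"
  have B's: "B' \<in> sets P"
  proof -
    have "B' = (\<Union>m. \<Inter>n\<in>{m..}. B n)"
      using Bs sets.sets_into_space[OF Bs] by (auto simp: B'_def eventually_sequentially)
    then show ?thesis using Bs by auto
  qed
  have lim: "AE \<omega> in P. (\<lambda>n::nat. indicator (B n) \<omega> :: real) \<longlonglongrightarrow> indicator B' \<omega>"
    using BC AE_space[of P]
  proof eventually_elim
    case (elim \<omega>)
    then obtain m where m: "\<And>n. m \<le> n \<Longrightarrow> \<omega> \<notin> N n" by (auto simp: eventually_sequentially)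
    have const: "\<omega> \<in> B n \<longleftrightarrow> \<omega> \<in> B m" if "m \<le> n" for n
      using that
    proof (induction n rule: dec_induct)
      case (step k)
      have "\<omega> \<notin> N k" by (rule m[OF step(1)])
      then have "\<omega> \<in> B k \<longleftrightarrow> \<omega> \<in> B (Suc k)" unfolding N_def by blast
      with step.IH show ?case by blast
    qed (rule refl)
    have "\<omega> \<in> B' \<longleftrightarrow> \<omega> \<in> B m"
    proof
      assume "\<omega> \<in> B'"
      then obtain k where "\<And>n. k \<le> n \<Longrightarrow> \<omega> \<in> B n" by (auto simp: B'_def eventually_sequentially)
      then have "\<omega> \<in> B (max k m)" by simp
      then show "\<omega> \<in> B m" using const[of "max k m"] by simp
    next
      assume "\<omega> \<in> B m"
      then have "\<forall>n\<ge>m. \<omega> \<in> B n" using const by blast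
      then show "\<omega> \<in> B'" using elim by (auto simp: B'_def eventually_sequentially)
    qed
    with const have same: "\<omega> \<in> B n \<longleftrightarrow> \<omega> \<in> B'" if "m \<le> n" for n using that by blast
    have "\<forall>\<^sub>F n in sequentially. indicator (B n) \<omega> = (indicator B' \<omega> :: real)"
      using eventually_ge_at_top[of m] by eventually_elim (simp add: indicator_def same)
    then show ?case by (rule tendsto_eventually)
  qed
  have PB': "P.prob B' = 1 / 2"
  proof -
    have "(\<lambda>n. LINT \<omega>|P. (indicator (B n) \<omega> :: real)) \<longlonglongrightarrow> (LINT \<omega>|P. indicator B' \<omega>)"
    proof (rule integral_dominated_convergence[where w = "\<lambda>_. 1"])
      show "AE \<omega> in P. norm (indicator (B n) \<omega> :: real) \<le> 1" for n by (simp add: indicator_def)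
    qed (use lim Bs B's in simp_all)
    then have "(\<lambda>n::nat. 1 / 2 :: real) \<longlonglongrightarrow> P.prob B'" using Bs B's by (simp add: PB)
    then show ?thesis by (simp add: LIMSEQ_const_iff)
  qed
  let ?Q = "density P (\<lambda>\<omega>. ennreal (2 * indicator B' \<omega>))"
  have Q: "?Q = P" by (rule unique[OF conditioned_solution[OF sol t(1,2) BF B's PB' lim]])
  \<comment> \<open>The conditioned law charges only \<open>B'\<close>, but \<open>P\<close> gives the complement mass \<open>1/2\<close>.\<close>
  have "emeasure ?Q (space P - B') = (\<integral>\<^sup>+\<omega>. ennreal (2 * indicator B' \<omega>) * indicator (space P - B') \<omega> \<partial>P)"
    using B's by (intro emeasure_density) simp_all
  also have "\<dots> = (\<integral>\<^sup>+\<omega>. 0 \<partial>P)" by (intro nn_integral_cong) (simp add: indicator_def)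
  finally have "emeasure P (space P - B') = 0" by (simp add: Q)
  then have "P.prob (space P - B') = 0" by (simp add: measure_def)
  then show False using P.prob_compl[OF B's] PB' by simp
qed

end

theorem proposition6p9:
  fixes a b :: real
  assumes "0 < a" and "a < b" and "b < 2" and "a < (2 - b) / b"
  shows "\<not> martingale_problem_well_posed (jump_operator (J1 a b))"
proof
  assume wp: "martingale_problem_well_posed (jump_operator (J1 a b))"
  interpret jump_exponents a b by standard (fact assms)+
  from wp obtain P where "martingale_problem_solution L 0 P"
    "\<And>Q. martingale_problem_solution L 0 Q \<Longrightarrow> Q = P"
    unfolding martingale_problem_well_posed_def by (metis (no_types))
  then show False by (rule martingale_problem_not_unique)
qed

end
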